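(* Let $p\ge 3$ be odd. There is a constant $c_p>0$ such that the following holds. Let $D=D(n)\in\mathbb{N}$ satisfy $D\le\sqrt{n/(2p^2)}$, and let $\lambda=\lambda(n)\ge 0$ satisfy $\lambda\le c_p\, n^{-p/4}D^{-(p-2)/4}$. Let $\mathbb{P}$ be the law of the pair $(v,Y)$ where $v$ is uniform on the sphere $\{v\in\mathbb{R}^n:\|v\|^2=n\}$, $W\sim\mathrm{Wig}(p,n,1)$ is independent of $v$, and $Y=\lambda v^{\otimes p}+W$. Then, as $n\to\infty$, $\mathrm{Corr}_{\le D}(\mathbb{P})^2=O(\sqrt n)$, and therefore $\mathrm{MMSE}_{\le D}(\mathbb{P})=n-O(\sqrt n)$.
   Context: $\mathrm{Sym}^p(\mathbb{R}^n)$ denotes the space of real tensors $(T_{i_1,\dots,i_p})_{i\in[n]^p}$ invariant under permutations of the indices. The Wigner law $\mathrm{Wig}(p,n,\sigma^2)$ is the law of the symmetric tensor $W$ with $W_{i_1,\dots,i_p}=\frac{1}{\sqrt{p!}}\sum_{\pi\in S_p}G_{i_{\pi(1)},\dots,i_{\pi(p)}}$, where $G\in(\mathbb{R}^n)^{\otimes p}$ has i.i.d. $\mathcal{N}(0,\sigma^2)$ entries. $v^{\otimes p}$ is the tensor with entries $v_{i_1}\cdots v_{i_p}$. For $\mathbb{P}$ a law of pairs $(x,Y)\in\mathbb{R}^n\times\mathrm{Sym}^p(\mathbb{R}^n)$, $\mathrm{Corr}_{\le D}(\mathbb{P})=\sup_f \frac{\mathbb{E}_{(x,Y)\sim\mathbb{P}}\langle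 x,f(Y)\rangle}{\sqrt{\mathbb{E}_{Y\sim\mathbb{P}}\|f(Y)\|^2}}$, the supremum over maps $f:\mathrm{Sym}^p(\mathbb{R}^n)\to\mathbb{R}^n$ each coordinate of which is a polynomial of degree at most $D$ in the entries of $Y$, with $\mathbb{E}\|f(Y)\|^2\ne 0$; and $\mathrm{MMSE}_{\le D}(\mathbb{P})=\inf_f\mathbb{E}_{(x,Y)\sim\mathbb{P}}\|f(Y)-x\|^2$ over the same class of $f$. *)

theory Defs
  imports "HOL-Probability.Probability" "HOL-Library.Multiset" "HOL-Library.Landau_Symbols"
begin

text \<open>Vectors in R^n are functions nat => real (only coordinates < n matter);
  tensors in (R^n)^{\<otimes>p} are functions on index lists of length p with entries < n.\<close>

definition tuples :: "nat \<Rightarrow> nat \<Rightarrow> nat list set" where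
  "tuples n p = {is. length is = p \<and> set is \<subseteq> {..<n}}"

definition std_gauss :: "real measure" where
  "std_gauss = density lborel std_normal_density"

definition noise_space :: "nat \<Rightarrow> nat \<Rightarrow> ((nat \<Rightarrow> real) \<times> (nat list \<Rightarrow> real)) measure" where
  "noise_space n p = (PiM {..<n} (\<lambda>_. std_gauss)) \<Otimes>\<^sub>M (PiM (tuples n p) (\<lambda>_. std_gauss))"

definition vnorm :: "nat \<Rightarrow> (nat \<Rightarrow> real) \<Rightarrow> real" where
  "vnorm n x = sqrt (\<Sum>i<n. (x i)^2)"

text \<open>Uniform vector on the sphere {|v|^2 = n}: v = sqrt n * g / |g| with g standard Gaussian.\<close>
definition sphere_vec :: "nat \<Rightarrow> (nat \<Rightarrow> real) \<Rightarrow> (nat \<Rightarrow> real)" where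
  "sphere_vec n g = (\<lambda>i. if i < n then sqrt (real n) * g i / vnorm n g else 0)"

definition wigner :: "nat \<Rightarrow> nat \<Rightarrow> (nat list \<Rightarrow> real) \<Rightarrow> (nat list \<Rightarrow> real)" where
  "wigner n p G = (\<lambda>is. if is \<in> tuples n p then
      (1 / sqrt (fact p)) * (\<Sum>\<pi>\<in>{\<pi>. \<pi> permutes {..<p}}. G (map (\<lambda>k. is ! \<pi> k) [0..<p]))
     else 0)"

definition tensor_pow :: "nat \<Rightarrow> nat \<Rightarrow> (nat \<Rightarrow> real) \<Rightarrow> (nat list \<Rightarrow> real)" where
  "tensor_pow n p v = (\<lambda>is. if is \<in> tuples n p then (\<Prod>k<p. v (is ! k)) else 0)"

definition spiked_obs :: "nat \<Rightarrow> nat \<Rightarrow> real \<Rightarrow> (nat \<Rightarrow> real) \<Rightarrow> (nat list \<Rightarrow> real) \<Rightarrow> (nat list \<Rightarrow> real)" where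
  "spiked_obs n p lam g G = (\<lambda>is. lam * tensor_pow n p (sphere_vec n g) is + wigner n p G is)"

definition poly_deg_le :: "'v set \<Rightarrow> nat \<Rightarrow> (('v \<Rightarrow> real) \<Rightarrow> real) \<Rightarrow> bool" where
  "poly_deg_le T D F \<longleftrightarrow> (\<exists>c :: 'v multiset \<Rightarrow> real.
     \<forall>Y. F Y = (\<Sum>m\<in>{m. set_mset m \<subseteq> T \<and> size m \<le> D}. c m * (\<Prod>x\<in>#m. Y x)))"

definition poly_maps :: "nat \<Rightarrow> nat \<Rightarrow> nat \<Rightarrow> ((nat list \<Rightarrow> real) \<Rightarrow> (nat \<Rightarrow> real)) set" where
  "poly_maps n p D = {f. \<forall>i<n. poly_deg_le (tuples n p) D (\<lambda>Y. f Y i)}"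

definition low_deg_corr :: "nat \<Rightarrow> nat \<Rightarrow> nat \<Rightarrow> real \<Rightarrow> real" where
  "low_deg_corr n p D lam = Sup
     { (\<integral>\<omega>. (\<Sum>i<n. sphere_vec n (fst \<omega>) i * f (spiked_obs n p lam (fst \<omega>) (snd \<omega>)) i) \<partial>noise_space n p)
       / sqrt (\<integral>\<omega>. (\<Sum>i<n. (f (spiked_obs n p lam (fst \<omega>) (snd \<omega>)) i)^2) \<partial>noise_space n p)
     | f. f \<in> poly_maps n p D \<and>
          (\<integral>\<omega>. (\<Sum>i<n. (f (spiked_obs n p lam (fst \<omega>) (snd \<omega>)) i)^2) \<partial>noise_space n p) \<noteq> 0 }"

definition low_deg_mmse :: "nat \<Rightarrow> nat \<Rightarrow> nat \<Rightarrow> real \<Rightarrow> real" where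
  "low_deg_mmse n p D lam = Inf
     { (\<integral>\<omega>. (\<Sum>i<n. (f (spiked_obs n p lam (fst \<omega>) (snd \<omega>)) i - sphere_vec n (fst \<omega>) i)^2) \<partial>noise_space n p)
     | f. f \<in> poly_maps n p D }"

end

theory Submission
  imports Defs "HOL-Computational_Algebra.Polynomial" "HOL-Combinatorics.Multiset_Permutations"
begin

text \<open>
  The Wigner noise is a linear image of i.i.d. Gaussian noise \<open>G\<close>, so \<open>Y\<close> is a linear image of
  \<open>G + l v\<^sup>\<otimes>\<^sup>p\<close> with \<open>l = \<lambda> / sqrt (p!)\<close>. A dual certificate is a vector \<open>u(G)\<close> of polynomials with
  \<open>E \<langle>u(G), f(Y)\<rangle> = E \<langle>v, f(Y)\<rangle>\<close> for all \<open>f\<close> of degree at most \<open>D\<close>; Cauchy-Schwarz then bounds the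
  squared correlation by \<open>E |u|\<^sup>2\<close>. The Hermite coefficients of such a \<open>u\<close> are the joint cumulants of
  \<open>v\<^sub>i\<close> with the entries of \<open>v\<^sup>\<otimes>\<^sup>p\<close>.

  If \<open>v\<close> were Gaussian, these cumulants would count connected pairings, so each would be nonnegative
  and at most the corresponding moment. On the sphere the moments of total degree \<open>2 x\<close> are the Gaussian ones times
  \<open>w(x) = \<Prod>j<x. 1 / (1 + 2 j / n)\<close>, whose \<open>k\<close>-th differences are at most \<open>k! (n / 2)\<^sup>-\<^sup>k\<^sup>/\<^sup>2\<close>
  for \<open>x \<le> sqrt (n / 2)\<close>. For \<open>D \<le> sqrt (n / (2 p\<^sup>2))\<close> this perturbation costs only a factor \<open>2\<^sup>d\<close> in the
  cumulants of order \<open>d\<close>, and \<open>E |u|\<^sup>2\<close> is bounded by \<open>\<Sum>d\<le>D. (4 l\<^sup>2)\<^sup>d / d! * E \<langle>g, g'\<rangle>\<^sup>p\<^sup>d\<^sup>+\<^sup>1\<close> for independent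
  standard Gaussian vectors \<open>g, g'\<close>, which is \<open>sqrt n\<close> times a geometric sum.
\<close>

subsection \<open>Power series indexed by multisets\<close>

text \<open>Why cumulants: expand the Hermite monomial of index \<open>m\<close> at noise plus
  signal and average over \<open>v\<close>. The requirement on \<open>u\<close> becomes a triangular
  system: the sum over \<open>a \<subseteq># m\<close> of \<open>u a\<close> times the moment of
  \<open>m - a\<close> must be the moment of \<open>v_i\<close> with \<open>m\<close>. So
  \<open>u\<close> times the moment series is the derivative of that series in the variable of
  \<open>v_i\<close>, and \<open>u\<close> is a logarithmic derivative. Hence formal power series
  with one variable per index tuple, and bounds coefficient by coefficient.

  So the sphere series is written as \<open>E\<close> times the Gaussian one. Each derivative of
  \<open>E\<close> replaces the weight by a difference of the weight, and this gains the powers of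
  \<open>n\<close> that pay for dividing by \<open>E\<close>. Odd \<open>p\<close> matters because a
  single entry then has vanishing mean: corrections start with pairs of entries, which a factor 2
  per entry can absorb.\<close>

definition submsets :: "'a multiset \<Rightarrow> 'a multiset set" where
  "submsets m = {a. a \<subseteq># m}"

lemma submsets_iff [simp]: "a \<in> submsets m \<longleftrightarrow> a \<subseteq># m"
  by (simp add: submsets_def)

lemma finite_submsets [simp]: "finite (submsets m)"
proof (induction m)
  case empty
  then show ?case by (simp add: submsets_def)
next
  case (add x m)
  have "submsets (add_mset x m) \<subseteq> submsets m \<union> add_mset x ` submsets m"
  proof
    fix a assume a: "a \<in> submsets (add_mset x m)"
    show "a \<in> submsets m \<union> add_mset x ` submsets m"
    proof (cases "x \<in># a")
      case True
      then obtain b where b: "a = add_mset x b" by (meson mset_add)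
      with a show ?thesis by auto
    next
      case False
      with a have "a \<subseteq># m"
        by (metis submsets_iff add_mset_remove_trivial diff_single_trivial subset_eq_diff_conv
            add_mset_add_single)
      then show ?thesis by auto
    qed
  qed
  with add show ?case by (meson finite_UnI finite_imageI finite_subset)
qed

lemma submsets_empty [simp]: "submsets {#} = {{#}}"
  by (auto simp: submsets_def)

lemma mset_double_diff [simp]: "a \<subseteq># m \<Longrightarrow> m - (m - a) = a"
  by (simp add: subset_mset.diff_diff_right)

lemma sum_submsets_flip:
  fixes f :: "'a multiset \<Rightarrow> 'a multiset \<Rightarrow> 'b::comm_monoid_add"
  shows "(\<Sum>a\<in>submsets m. f a (m - a)) = (\<Sum>a\<in>submsets m. f (m - a) a)"
  by (rule sum.reindex_bij_witness[of _ "\<lambda>a. m - a" "\<lambda>a. m - a"])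
     (auto intro: diff_subset_eq_self)

text \<open>Both sides run over the decompositions of \<open>m\<close> into three parts; the
  bijection sends \<open>(a, b)\<close> to \<open>(a + b, a)\<close>. This is associativity of the
  product of series.\<close>

lemma sum_submsets_assoc:
  fixes h :: "'a multiset \<Rightarrow> 'a multiset \<Rightarrow> 'a multiset \<Rightarrow> 'b::comm_monoid_add"
  shows "(\<Sum>a\<in>submsets m. \<Sum>b\<in>submsets (m - a). h a b (m - a - b))
       = (\<Sum>c\<in>submsets m. \<Sum>a\<in>submsets c. h a (c - a) (m - c))"
proof -
  have "(\<Sum>(a,b)\<in>(SIGMA a:submsets m. submsets (m - a)). h a b (m - a - b))
      = (\<Sum>(c,a)\<in>(SIGMA c:submsets m. submsets c). h a (c - a) (m - c))"
    by (rule sum.reindex_bij_witness[of _ "\<lambda>(c,a). (a, c - a)" "\<lambda>(a,b). (a + b, a)"])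
       (auto simp: subset_mset.le_diff_conv2 add.commute subset_mset.add_diff_inverse
             intro: subset_mset.order_trans subset_mset.le_add_same_cancel1)
  then show ?thesis by (simp add: sum.Sigma)
qed

text \<open>Indexing by multisets allows infinitely many variables: every monomial has finitely many
  divisors, so products are finite sums without any condition on supports. A type of its own can be
  made an instance of the ring class.\<close>

typedef 'a mps = "UNIV :: ('a multiset \<Rightarrow> real) set"
  morphisms cf Mps by simp

lemma cf_Mps [simp]: "cf (Mps f) = f"
  by (simp add: Mps_inverse)

lemma mps_eqI: "(\<And>m. cf f m = cf g m) \<Longrightarrow> f = g"
  by (metis cf_inject ext)

instantiation mps :: (type) comm_ring_1
begin
definition "0 = Mps (\<lambda>_. 0)"
definition "1 = Mps (\<lambda>m. if m = {#} then 1 else 0)"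
definition "f + g = Mps (\<lambda>m. cf f m + cf g m)"
definition "f - g = Mps (\<lambda>m. cf f m - cf g m)"
definition "- f = Mps (\<lambda>m. - cf f m)"
definition "f * g = Mps (\<lambda>m. \<Sum>a\<in>submsets m. cf f a * cf g (m - a))"
instance
proof
  fix f g h :: "'a mps"
  show "f * g * h = f * (g * h)"
  proof (rule mps_eqI)
    fix m
    have "cf (f * g * h) m = (\<Sum>c\<in>submsets m. \<Sum>a\<in>submsets c. cf f a * cf g (c - a) * cf h (m - c))"
      by (simp add: times_mps_def sum_distrib_right)
    also have "\<dots> = (\<Sum>a\<in>submsets m. \<Sum>b\<in>submsets (m - a). cf f a * cf g b * cf h (m - a - b))"
      by (rule sum_submsets_assoc[symmetric])
    also have "\<dots> = cf (f * (g * h)) m"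
      by (simp add: times_mps_def sum_distrib_left mult.assoc)
    finally show "cf (f * g * h) m = cf (f * (g * h)) m" .
  qed
  show "f * g = g * f"
    by (rule mps_eqI)
       (simp add: times_mps_def sum_submsets_flip[where f="\<lambda>a b. cf f a * cf g b"] mult.commute)
  have "(\<Sum>a\<in>submsets m. (if a = {#} then 1 else 0) * cf f (m - a)) = cf f m" for m
    by (subst sum.remove[of _ "{#}"]) (auto intro!: sum.neutral)
  then show "1 * f = f"
    by (intro mps_eqI) (simp add: times_mps_def one_mps_def)
  show "(f + g) * h = f * h + g * h"
    by (rule mps_eqI) (simp add: times_mps_def plus_mps_def sum.distrib algebra_simps)
  have "cf (0::'a mps) {#} \<noteq> cf 1 {#}"
    by (simp add: zero_mps_def one_mps_def)
  then show "(0::'a mps) \<noteq> 1" by auto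
qed (auto simp: plus_mps_def minus_mps_def uminus_mps_def zero_mps_def intro!: mps_eqI)
end

lemma cf_0 [simp]: "cf 0 m = 0"
  and cf_1: "cf 1 m = (if m = {#} then 1 else 0)"
  and cf_add [simp]: "cf (f + g) m = cf f m + cf g m"
  and cf_diff [simp]: "cf (f - g) m = cf f m - cf g m"
  and cf_uminus [simp]: "cf (- f) m = - cf f m"
  and cf_mult: "cf (f * g) m = (\<Sum>a\<in>submsets m. cf f a * cf g (m - a))"
  by (simp_all add: zero_mps_def one_mps_def plus_mps_def minus_mps_def uminus_mps_def times_mps_def)

lemma cf_1_empty [simp]: "cf 1 {#} = 1"
  and cf_1_add [simp]: "cf 1 (add_mset x m) = 0"
  by (simp_all add: cf_1)

lemma cf_mult_empty [simp]: "cf (f * g) {#} = cf f {#} * cf g {#}"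
  by (simp add: cf_mult)

lemma cf_power_empty [simp]: "cf (f ^ k) {#} = cf f {#} ^ k"
  by (induction k) auto

lemma cf_sum [simp]: "cf (\<Sum>i\<in>A. f i) m = (\<Sum>i\<in>A. cf (f i) m)"
  by (induction A rule: infinite_finite_induct) auto

definition cst :: "real \<Rightarrow> 'a mps" where
  "cst c = Mps (\<lambda>m. if m = {#} then c else 0)"

lemma cf_cst_mult [simp]: "cf (cst c * f) m = c * cf f m"
  unfolding cf_mult
  by (subst sum.remove[of _ "{#}"]) (auto simp: cst_def intro!: sum.neutral)

section \<open>Coefficientwise comparison of products and powers\<close>

lemma cf_mult_cong:
  assumes "\<And>a. a \<subseteq># m \<Longrightarrow> cf f a = cf f' a" "\<And>a. a \<subseteq># m \<Longrightarrow> cf g a = cf g' a"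
  shows "cf (f * g) m = cf (f' * g') m"
  unfolding cf_mult by (intro sum.cong) (auto simp: assms)

lemma cf_mult_nonneg:
  assumes "\<And>a. a \<subseteq># m \<Longrightarrow> 0 \<le> cf f a" "\<And>a. a \<subseteq># m \<Longrightarrow> 0 \<le> cf g a"
  shows "0 \<le> cf (f * g) m"
  unfolding cf_mult by (intro sum_nonneg mult_nonneg_nonneg) (auto simp: assms)

lemma cf_power_nonneg:
  assumes "\<And>a. a \<subseteq># m \<Longrightarrow> 0 \<le> cf f a"
  shows "0 \<le> cf (f ^ k) m"
  using assms
proof (induction k arbitrary: m)
  case (Suc k)
  then show ?case
    unfolding power_Suc by (intro cf_mult_nonneg) (auto intro: subset_mset.trans)
qed (auto simp: cf_1)

text \<open>The hypotheses are asked only of the divisors of \<open>m\<close>, since the estimates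
  for the weights will hold only up to a bounded degree.\<close>

lemma cf_mult_mono:
  assumes "\<And>a. a \<subseteq># m \<Longrightarrow> \<bar>cf f a\<bar> \<le> cf F a" "\<And>a. a \<subseteq># m \<Longrightarrow> \<bar>cf g a\<bar> \<le> cf G a"
  shows "\<bar>cf (f * g) m\<bar> \<le> cf (F * G) m"
proof -
  have "\<bar>cf (f * g) m\<bar> \<le> (\<Sum>a\<in>submsets m. \<bar>cf f a * cf g (m - a)\<bar>)"
    unfolding cf_mult by (rule sum_abs)
  also have "\<dots> \<le> (\<Sum>a\<in>submsets m. cf F a * cf G (m - a))"
    by (intro sum_mono) (auto simp: abs_mult intro!: mult_mono assms order_trans[OF abs_ge_zero assms(1)])
  finally show ?thesis by (simp add: cf_mult)
qed

lemma cf_power_small: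
  assumes "cf f {#} = 0" "size m < k"
  shows "cf (f ^ k) m = 0"
  using assms(2)
proof (induction k arbitrary: m)
  case (Suc k)
  have "cf f a * cf (f ^ k) (m - a) = 0" if "a \<subseteq># m" for a
  proof (cases "a = {#}")
    case False
    then have "size (m - a) < k"
      using that Suc.prems size_mset_mono[OF that] by (simp add: size_Diff_submset nonempty_has_size)
    then show ?thesis using Suc.IH by simp
  qed (use assms in auto)
  then show ?case unfolding power_Suc cf_mult by (intro sum.neutral) simp
qed simp

subsection \<open>Derivations\<close>

text \<open>Formal partial derivative in the variable \<open>x\<close>. Coefficients are not
  normalized by factorials, hence the factor.\<close>

definition dv :: "'a \<Rightarrow> 'a mps \<Rightarrow> 'a mps" where
  "dv x f = Mps (\<lambda>m. (real (count m x) + 1) * cf f (add_mset x m))"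

lemma cf_dv: "cf (dv x f) m = (real (count m x) + 1) * cf f (add_mset x m)"
  by (simp add: dv_def)

lemma cf_via_dv: "cf f (add_mset x m) = cf (dv x f) m / (real (count m x) + 1)"
proof -
  have "real (count m x) + 1 \<noteq> 0" by linarith
  then show ?thesis by (simp add: cf_dv field_simps)
qed

text \<open>The weight \<open>count a x\<close> kills every \<open>a\<close> without
  \<open>x\<close>; each other \<open>a\<close> is \<open>add_mset x\<close> of a unique divisor of
  \<open>m\<close>.\<close>

lemma sum_submsets_count:
  fixes h :: "'a multiset \<Rightarrow> real"
  shows "(\<Sum>a\<in>submsets (add_mset x m). real (count a x) * h a)
       = (\<Sum>a\<in>submsets m. (real (count a x) + 1) * h (add_mset x a))"
proof -
  have "(\<Sum>a\<in>submsets (add_mset x m). real (count a x) * h a)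
      = (\<Sum>a\<in>add_mset x ` submsets m. real (count a x) * h a)"
  proof (rule sum.mono_neutral_right)
    show "add_mset x ` submsets m \<subseteq> submsets (add_mset x m)" by auto
    show "\<forall>a\<in>submsets (add_mset x m) - add_mset x ` submsets m. real (count a x) * h a = 0"
    proof
      fix a assume a: "a \<in> submsets (add_mset x m) - add_mset x ` submsets m"
      have "x \<notin># a"
      proof
        assume "x \<in># a"
        then obtain b where "a = add_mset x b" by (meson mset_add)
        with a show False by auto
      qed
      then show "real (count a x) * h a = 0" by (simp add: not_in_iff)
    qed
  qed simp
  also have "\<dots> = (\<Sum>a\<in>submsets m. (real (count a x) + 1) * h (add_mset x a))"
    by (subst sum.reindex) (auto simp: inj_on_def add.commute)
  finally show ?thesis .
qed

text \<open>Leibniz rule: the multiplicity of \<open>x\<close> in \<open>add_mset x m\<close> is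
  shared between the two factors, and by \<open>sum_submsets_count\<close> each share amounts to a
  derivative of that factor.\<close>

lemma dv_mult: "dv x (f * g) = dv x f * g + f * dv x g"
proof (rule mps_eqI)
  fix m
  let ?m = "add_mset x m"
  have "cf (dv x (f * g)) m = (\<Sum>a\<in>submsets ?m. (real (count m x) + 1) * (cf f a * cf g (?m - a)))"
    by (simp add: cf_dv cf_mult sum_distrib_left)
  also have "\<dots> = (\<Sum>a\<in>submsets ?m. real (count a x) * (cf f a * cf g (?m - a))
                      + real (count (?m - a) x) * (cf f a * cf g (?m - a)))"
  proof (rule sum.cong)
    fix a assume "a \<in> submsets ?m"
    then have "count a x \<le> count ?m x"
      unfolding submsets_iff by (rule mset_subset_eq_count)
    then have "real (count m x) + 1 = real (count a x) + real (count (?m - a) x)" by simp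
    then show "(real (count m x) + 1) * (cf f a * cf g (?m - a))
        = real (count a x) * (cf f a * cf g (?m - a)) + real (count (?m - a) x) * (cf f a * cf g (?m - a))"
      by (simp only: distrib_right)
  qed simp
  also have "\<dots> = (\<Sum>a\<in>submsets ?m. real (count a x) * (cf f a * cf g (?m - a)))
       + (\<Sum>a\<in>submsets ?m. real (count (?m - a) x) * (cf f a * cf g (?m - a)))"
    by (rule sum.distrib)
  also have "(\<Sum>a\<in>submsets ?m. real (count (?m - a) x) * (cf f a * cf g (?m - a)))
     = (\<Sum>a\<in>submsets ?m. real (count a x) * (cf f (?m - a) * cf g a))"
    by (rule sum_submsets_flip[where f="\<lambda>a b. real (count b x) * (cf f a * cf g b)"])
  also have "\<dots> = (\<Sum>a\<in>submsets m. (real (count a x) + 1) * (cf f (m - a) * cf g (add_mset x a)))"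
    by (subst sum_submsets_count) simp
  also have "\<dots> = (\<Sum>a\<in>submsets m. cf f (m - a) * cf (dv x g) a)"
    by (simp add: cf_dv algebra_simps)
  also have "\<dots> = cf (f * dv x g) m"
    unfolding cf_mult by (rule sum_submsets_flip[symmetric, where f="\<lambda>a b. cf f a * cf (dv x g) b"])
  also have "(\<Sum>a\<in>submsets ?m. real (count a x) * (cf f a * cf g (?m - a))) = cf (dv x f * g) m"
    by (subst sum_submsets_count) (simp add: cf_dv cf_mult mult.assoc)
  finally show "cf (dv x (f * g)) m = cf (dv x f * g + f * dv x g) m" by simp
qed

lemma dv_add: "dv x (f + g) = dv x f + dv x g"
  and dv_diff: "dv x (f - g) = dv x f - dv x g"
  and dv_uminus: "dv x (- f) = - dv x f"
  and dv_0 [simp]: "dv x 0 = 0"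
  and dv_1 [simp]: "dv x 1 = 0"
  by (auto intro!: mps_eqI simp: cf_dv algebra_simps)

lemma dv_cst_mult: "dv x (cst c * f) = cst c * dv x f"
  by (rule mps_eqI) (simp only: cf_dv cf_cst_mult mult.left_commute)

lemma cst_1 [simp]: "cst 1 = 1" by (auto intro!: mps_eqI simp: cst_def cf_1)

lemma cst_add: "cst (a + b) = cst a + cst b" by (auto intro!: mps_eqI simp: cst_def)

lemma dv_power: "dv x (f ^ Suc k) = cst (real (Suc k)) * (f ^ k * dv x f)"
proof (induction k)
  case (Suc k)
  have "dv x (f ^ Suc (Suc k)) = dv x f * f ^ Suc k + f * (cst (real (Suc k)) * (f ^ k * dv x f))"
    unfolding power_Suc[of f "Suc k"] dv_mult Suc ..
  also have "\<dots> = (1 + cst (real (Suc k))) * (f ^ Suc k * dv x f)"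
    by (simp add: algebra_simps)
  also have "1 + cst (real (Suc k)) = cst (real (Suc (Suc k)))"
    by (simp flip: cst_1 cst_add)
  finally show ?case .
qed simp

text \<open>Up to the factor \<open>count k x + 1\<close>, the coefficient of \<open>M\<close> at
  \<open>add_mset x k\<close> is that of \<open>A x * M\<close> at \<open>k\<close>, which involves
  only coefficients of \<open>M\<close> of smaller size.\<close>

lemma ode_unique:
  assumes "cf M {#} = cf M' {#}"
    and "\<And>x. dv x M = A x * M" "\<And>x. dv x M' = A x * M'"
  shows "M = M'"
proof -
  have "cf M m = cf M' m" for m
  proof (induction m rule: measure_induct_rule[of size])
    case (less m)
    show ?case
    proof (cases m)
      case (add x k)
      have "cf (A x * M) k = cf (A x * M') k"
        by (rule cf_mult_cong) (use less add in \<open>auto dest!: size_mset_mono\<close>)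
      then show ?thesis by (simp add: add cf_via_dv assms)
    qed (use assms in simp)
  qed
  then show ?thesis by (rule mps_eqI)
qed

subsection \<open>Composition with univariate power series\<close>

text \<open>Cutting the sum at \<open>size m\<close> loses nothing if \<open>f\<close> has no
  constant term, since \<open>f ^ k\<close> then starts in degree \<open>k\<close>; the lemmas on
  \<open>ucomp\<close> that rely on this assume it.\<close>

definition ucomp :: "(nat \<Rightarrow> real) \<Rightarrow> 'a mps \<Rightarrow> 'a mps" where
  "ucomp a f = Mps (\<lambda>m. \<Sum>k\<le>size m. a k * cf (f ^ k) m)"

lemma cf_ucomp:
  assumes "cf f {#} = 0" "size m \<le> n"
  shows "cf (ucomp a f) m = cf (\<Sum>k\<le>n. cst (a k) * f ^ k) m"
proof -
  have "(\<Sum>k\<le>n. a k * cf (f ^ k) m) = (\<Sum>k\<le>size m. a k * cf (f ^ k) m)"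
    by (rule sum.mono_neutral_right) (use assms cf_power_small[OF assms(1)] in auto)
  then show ?thesis by (simp add: ucomp_def)
qed

lemma cf_ucomp_empty [simp]: "cf (ucomp a f) {#} = a 0"
  by (simp add: ucomp_def)

lemma dv_sum: "dv x (\<Sum>i\<in>A. f i) = (\<Sum>i\<in>A. dv x (f i))"
  by (induction A rule: infinite_finite_induct) (auto simp: dv_add)

lemma dv_ucomp:
  fixes f :: "'a mps"
  assumes "cf f {#} = 0"
  shows "dv x (ucomp a f) = ucomp (\<lambda>k. real (Suc k) * a (Suc k)) f * dv x f"
proof (rule mps_eqI)
  fix m :: "'a multiset"
  define n where "n = size m"
  have "cf (dv x (ucomp a f)) m = cf (dv x (\<Sum>k\<le>Suc n. cst (a k) * f ^ k)) m"
    unfolding cf_dv by (subst cf_ucomp[OF assms, of _ "Suc n"]) (auto simp: n_def)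
  also have "dv x (\<Sum>k\<le>Suc n. cst (a k) * f ^ k) = (\<Sum>k\<le>n. cst (a (Suc k)) * dv x (f ^ Suc k))"
  proof -
    have "dv x (\<Sum>k\<le>Suc n. cst (a k) * f ^ k) = (\<Sum>k\<le>Suc n. cst (a k) * dv x (f ^ k))"
      by (simp only: dv_sum dv_cst_mult)
    also have "\<dots> = (\<Sum>k\<le>n. cst (a (Suc k)) * dv x (f ^ Suc k))"
      unfolding atMost_Suc_eq_insert_0 image_Suc_atMost[symmetric]
      by (subst sum.insert) (auto simp: sum.reindex)
    finally show ?thesis .
  qed
  also have "\<dots> = (\<Sum>k\<le>n. cst (real (Suc k) * a (Suc k)) * f ^ k) * dv x f"
    unfolding dv_power sum_distrib_right
    by (intro sum.cong refl mps_eqI) (simp add: mult.assoc)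
  also have "cf \<dots> m = cf (ucomp (\<lambda>k. real (Suc k) * a (Suc k)) f * dv x f) m"
    by (rule cf_mult_cong) (auto simp: cf_ucomp[OF assms, of _ n] n_def size_mset_mono)
  finally show "cf (dv x (ucomp a f)) m = cf (ucomp (\<lambda>k. real (Suc k) * a (Suc k)) f * dv x f) m" .
qed

definition geo :: "'a mps \<Rightarrow> 'a mps" where
  "geo f = ucomp (\<lambda>_. 1) f"

lemma geo_inverse:
  fixes f :: "'a mps"
  assumes "cf f {#} = 0"
  shows "geo f * (1 - f) = 1"
proof (rule mps_eqI)
  fix m :: "'a multiset"
  define n where "n = size m"
  have "cf (geo f * (1 - f)) m = cf ((\<Sum>k\<le>n. f ^ k) * (1 - f)) m"
    unfolding geo_def by (rule cf_mult_cong) (auto simp: cf_ucomp[OF assms, of _ n] n_def size_mset_mono)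
  also have "(\<Sum>k\<le>n. f ^ k) * (1 - f) = 1 - f ^ Suc n"
    using one_diff_power_eq[of f "Suc n"] by (simp only: lessThan_Suc_atMost mult.commute)
  also have "cf \<dots> m = cf 1 m"
    using cf_power_small[OF assms, of m "Suc n"] by (simp add: n_def)
  finally show "cf (geo f * (1 - f)) m = cf 1 m" .
qed

lemma dv_geo:
  assumes "cf f {#} = 0"
  shows "dv x (geo f) = dv x f * geo f ^ 2"
proof -
  have "dv x (geo f) * (1 - f) = geo f * dv x f"
    using arg_cong[OF geo_inverse[OF assms], of "dv x"] by (simp add: dv_mult dv_diff)
  then have "dv x (geo f) * (geo f * (1 - f)) = geo f ^ 2 * dv x f"
    unfolding power2_eq_square
    by (metis (no_types, lifting) mult.assoc mult.commute)
  then show ?thesis by (simp add: geo_inverse[OF assms] mult.commute)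
qed

lemma geo_nonneg:
  assumes "\<And>a. a \<subseteq># m \<Longrightarrow> 0 \<le> cf f a"
  shows "0 \<le> cf (geo f) m"
  unfolding geo_def ucomp_def by (auto intro!: sum_nonneg cf_power_nonneg assms)

text \<open>The recursion of \<open>ode_unique\<close> with absolute values: it is enough to compare
  logarithmic derivatives. Quotients and exponentials are bounded in this way without expanding
  them.\<close>

lemma ode_mono:
  assumes "\<bar>cf M {#}\<bar> \<le> cf M' {#}"
    and "\<And>x. dv x M = A x * M" "\<And>x. dv x M' = B x * M'"
    and "\<And>x a. add_mset x a \<subseteq># m \<Longrightarrow> \<bar>cf (A x) a\<bar> \<le> cf (B x) a"
  shows "\<bar>cf M m\<bar> \<le> cf M' m"
  using assms(4)
proof (induction m rule: measure_induct_rule[of size])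
  case (less m)
  show ?case
  proof (cases m)
    case (add x k)
    have "\<bar>cf (A x * M) k\<bar> \<le> cf (B x * M') k"
    proof (rule cf_mult_mono)
      fix a assume a: "a \<subseteq># k"
      then show "\<bar>cf (A x) a\<bar> \<le> cf (B x) a" using less.prems add by simp
      show "\<bar>cf M a\<bar> \<le> cf M' a"
      proof (rule less.IH)
        show "size a < size m" using size_mset_mono[OF a] add by simp
        fix y b assume "add_mset y b \<subseteq># a"
        with a add have "add_mset y b \<subseteq># m"
          by (metis add_mset_add_single mset_subset_eq_add_left subset_mset.order_trans)
        then show "\<bar>cf (A y) b\<bar> \<le> cf (B y) b" by (rule less.prems)
      qed
    qed
    then show ?thesis
      unfolding add cf_via_dv assms(2,3) by (simp add: divide_right_mono)
  qed (use assms in simp)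
qed

section \<open>Logarithm, inverse and exponential of a series\<close>

definition mlog :: "'a mps \<Rightarrow> 'a mps" where
  "mlog f = - ucomp (\<lambda>k. if k = 0 then 0 else 1 / real k) (1 - f)"

definition minv :: "'a mps \<Rightarrow> 'a mps" where
  "minv f = geo (1 - f)"

lemma minv_mult: "cf f {#} = 1 \<Longrightarrow> minv f * f = 1"
  using geo_inverse[of "1 - f"] by (simp add: minv_def)

lemma cf_mlog_empty [simp]: "cf (mlog f) {#} = 0"
  by (simp add: mlog_def)

lemma dv_mlog: "cf f {#} = 1 \<Longrightarrow> dv x (mlog f) = minv f * dv x f"
  unfolding mlog_def minv_def geo_def dv_uminus
  by (subst dv_ucomp) (simp_all add: dv_diff)

lemma dv_eq_mlog: "cf f {#} = 1 \<Longrightarrow> dv x f = dv x (mlog f) * f"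
  by (simp add: dv_mlog) (metis minv_mult mult.assoc mult.commute mult_1)

lemma dv_minv:
  assumes "cf f {#} = 1"
  shows "dv x (minv f) = - dv x (mlog f) * minv f"
  unfolding minv_def using assms
  by (subst dv_geo) (simp_all add: dv_diff dv_mlog minv_def power2_eq_square algebra_simps)

definition mexp :: "'a mps \<Rightarrow> 'a mps" where
  "mexp = ucomp (\<lambda>k. 1 / fact k)"

lemma cf_mexp_empty [simp]: "cf (mexp f) {#} = 1"
  by (simp add: mexp_def)

lemma dv_mexp: "cf f {#} = 0 \<Longrightarrow> dv x (mexp f) = dv x f * mexp f"
proof -
  have "(\<lambda>k. real (Suc k) * (1 / fact (Suc k))) = (\<lambda>k. 1 / fact k)"
    by (rule ext) (simp add: divide_simps)
  then show "cf f {#} = 0 \<Longrightarrow> dv x (mexp f) = dv x f * mexp f"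
    unfolding mexp_def by (subst dv_ucomp) (simp_all add: mult.commute)
qed

definition var :: "'a \<Rightarrow> 'a mps" where
  "var x = Mps (\<lambda>m. if m = {#x#} then 1 else 0)"

lemma cf_var_mult: "cf (var x * f) m = (if x \<in># m then cf f (m - {#x#}) else 0)"
proof (cases "x \<in># m")
  case True
  then show ?thesis
    unfolding cf_mult
    by (subst sum.remove[of _ "{#x#}"]) (auto simp: var_def intro!: sum.neutral)
next
  case False
  then show ?thesis
    unfolding cf_mult by (auto simp: var_def intro!: sum.neutral)
qed

subsection \<open>Gaussian moments\<close>

fun gmom :: "nat \<Rightarrow> real" where
  "gmom 0 = 1"
| "gmom (Suc 0) = 0"
| "gmom (Suc (Suc k)) = (real k + 1) * gmom k"

lemma gmom_Suc: "gmom (Suc k) = real k * gmom (k - 1)"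
  by (cases k) auto

lemma gmom_nonneg: "0 \<le> gmom k"
  by (induction k rule: gmom.induct) auto

lemma gmom_odd: "odd k \<Longrightarrow> gmom k = 0"
  by (induction k rule: gmom.induct) auto

text \<open>The joint moment of independent standard Gaussians in which \<open>c\<close> occurs
  \<open>count M c\<close> times.\<close>

definition gm :: "'a multiset \<Rightarrow> real" where
  "gm M = (\<Prod>c\<in>set_mset M. gmom (count M c))"

lemma gm_superset:
  assumes "finite A" "set_mset M \<subseteq> A"
  shows "gm M = (\<Prod>c\<in>A. gmom (count M c))"
  unfolding gm_def by (rule prod.mono_neutral_left) (use assms in \<open>auto simp: not_in_iff\<close>)

lemma gm_empty [simp]: "gm {#} = 1"
  by (simp add: gm_def)

text \<open>Wick's rule: the new factor \<open>c\<close> is paired with one of the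
  \<open>count M c\<close> equal factors, which disappears. If there is none, the coefficient is
  zero and the truncated difference does no harm.\<close>

lemma gm_add: "gm (add_mset c M) = real (count M c) * gm (M - {#c#})"
proof -
  let ?A = "insert c (set_mset M)"
  have "(\<Prod>d\<in>?A. gmom (count (add_mset c M) d))
      = gmom (Suc (count M c)) * (\<Prod>d\<in>?A - {c}. gmom (count M d))"
    by (subst prod.remove[of _ c]) (auto intro!: prod.cong split: if_splits)
  moreover have "(\<Prod>d\<in>?A. gmom (count (M - {#c#}) d))
      = gmom (count M c - 1) * (\<Prod>d\<in>?A - {c}. gmom (count M d))"
    by (subst prod.remove[of _ c]) (auto intro!: prod.cong split: if_splits)
  moreover have "gm (add_mset c M) = (\<Prod>d\<in>?A. gmom (count (add_mset c M) d))"
    by (rule gm_superset) auto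
  moreover have "gm (M - {#c#}) = (\<Prod>d\<in>?A. gmom (count (M - {#c#}) d))"
    by (rule gm_superset) (auto dest: in_diffD)
  ultimately show ?thesis by (simp add: gmom_Suc)
qed

lemma gm_nonneg: "0 \<le> gm M"
  by (simp add: gm_def gmom_nonneg prod_nonneg)

lemma gm_odd:
  assumes "odd (size M)"
  shows "gm M = 0"
proof -
  have "\<exists>c\<in>set_mset M. odd (count M c)"
  proof (rule ccontr)
    assume "\<not> ?thesis"
    then have "even (\<Sum>c\<in>set_mset M. count M c)" by (auto intro: dvd_sum)
    with assms show False by (simp add: size_multiset_overloaded_eq)
  qed
  then obtain c where "c \<in># M" "odd (count M c)" by auto
  then show ?thesis unfolding gm_def by (intro prod_zero) (auto intro!: bexI[of _ c] gmom_odd)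
qed

section \<open>The moment series of all monomials in a Gaussian vector\<close>

definition tot :: "'a list multiset \<Rightarrow> 'a multiset" where
  "tot m = (\<Sum>l\<in>#m. mset l)"

lemma tot_simps [simp]: "tot {#} = {#}" "tot (add_mset l m) = mset l + tot m" "tot (m + m') = tot m + tot m'"
  by (simp_all add: tot_def)

definition mfact :: "'a multiset \<Rightarrow> real" where
  "mfact m = (\<Prod>x\<in>set_mset m. fact (count m x))"

lemma mfact_superset:
  assumes "finite A" "set_mset M \<subseteq> A"
  shows "mfact M = (\<Prod>c\<in>A. fact (count M c))"
  unfolding mfact_def by (rule prod.mono_neutral_left) (use assms in \<open>auto simp: not_in_iff\<close>)

lemma mfact_pos [simp]: "0 < mfact m"
  by (simp add: mfact_def prod_pos)

lemma mfact_empty [simp]: "mfact {#} = 1"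
  by (simp add: mfact_def)

lemma mfact_add: "mfact (add_mset x m) = (real (count m x) + 1) * mfact m"
proof -
  let ?A = "insert x (set_mset m)"
  have "(\<Prod>d\<in>?A. fact (count (add_mset x m) d))
      = (fact (Suc (count m x)) :: real) * (\<Prod>d\<in>?A - {x}. fact (count m d))"
    by (subst prod.remove[of _ x]) (auto intro!: prod.cong split: if_splits)
  moreover have "(\<Prod>d\<in>?A. fact (count m d))
      = (fact (count m x) :: real) * (\<Prod>d\<in>?A - {x}. fact (count m d))"
    by (subst prod.remove[of _ x]) (auto intro!: prod.cong split: if_splits)
  moreover have "mfact (add_mset x m) = (\<Prod>d\<in>?A. fact (count (add_mset x m) d))"
    by (rule mfact_superset) auto
  moreover have "mfact m = (\<Prod>d\<in>?A. fact (count m d))"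
    by (rule mfact_superset) auto
  ultimately show ?thesis by (simp add: algebra_simps)
qed

text \<open>Power series in variables indexed by lists: the variable \<open>l\<close> stands for the monomial
  \<open>\<Prod>c\<leftarrow>l. g c\<close> of a standard Gaussian vector \<open>g\<close>, and \<open>mu\<close> is the exponential moment generating series
  of all these monomials.\<close>

definition mu :: "'a list mps" where
  "mu = Mps (\<lambda>m. gm (tot m) / mfact m)"

lemma cf_mu_empty [simp]: "cf mu {#} = 1"
  by (simp add: mu_def)

lemma cf_mu_nonneg: "0 \<le> cf mu m"
  by (simp add: mu_def gm_nonneg less_imp_le)

lemma cf_dv_mu: "cf (dv l mu) m = gm (mset l + tot m) / mfact m"
proof -
  have "real (count m l) + 1 \<noteq> 0" by linarith
  then show ?thesis by (simp add: cf_dv mu_def mfact_add)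
qed

lemma cf_dv_dv_mu: "cf (dv k (dv l mu)) m = gm (mset k + mset l + tot m) / mfact m"
proof -
  have "real (count m k) + 1 \<noteq> 0" by linarith
  then show ?thesis by (simp add: cf_dv[of k] cf_dv_mu mfact_add ac_simps)
qed

lemma count_tot:
  assumes "finite A" "set_mset m \<subseteq> A"
  shows "real (count (tot m) c) = (\<Sum>l\<in>A. real (count m l) * real (count (mset l) c))"
  using assms(2)
proof (induction m)
  case (add x m)
  have "(\<Sum>l\<in>A. real (count (add_mset x m) l) * real (count (mset l) c))
      = (\<Sum>l\<in>A. real (count m l) * real (count (mset l) c) + (if l = x then real (count (mset l) c) else 0))"
    by (rule sum.cong) (auto simp: algebra_simps)
  also have "\<dots> = real (count (tot m) c) + real (count (mset x) c)"
    using add assms(1) by (simp add: sum.distrib)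
  finally show ?case by simp
qed simp

text \<open>Gaussian integration by parts for the factor c of the monomial c # l.\<close>

lemma dv_mu_ibp:
  assumes "finite A" "set_mset m \<subseteq> A"
  shows "cf (dv (c # l) mu) m = cf (cst (real (count (mset l) c)) * dv (remove1 c l) mu
    + (\<Sum>k\<in>A. cst (real (count (mset k) c)) * (var k * dv l (dv (remove1 c k) mu)))) m"
proof -
  let ?g = "\<lambda>M. gm (M - {#c#})"
  \<comment> \<open>The factor \<open>count m k\<close> cancels against the factorials: it is
    \<open>mfact m\<close> divided by \<open>mfact (m - {#k#})\<close>.\<close>
  have *: "real (count m k) * real (count (mset k) c) * ?g (mset l + tot m) / mfact m
    = real (count (mset k) c) * cf (var k * dv l (dv (remove1 c k) mu)) m" for k
  proof (cases "k \<in># m \<and> c \<in> set k")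
    case True
    then obtain m' where m': "m = add_mset k m'" by (meson mset_add)
    have "real (count m' k) + 1 \<noteq> 0" by linarith
    moreover have "mset l + (mset k + tot m') - {#c#} = mset l + (mset k - {#c#}) + tot m'"
      using True by (simp add: multiset_eq_iff)
    ultimately show ?thesis
      using True by (simp add: m' cf_var_mult cf_dv_dv_mu mfact_add add.commute[of 1])
  next
    case False
    then show ?thesis
      by (auto simp: cf_var_mult iffD2[OF count_mset_0_iff] iffD2[OF count_eq_zero_iff])
  qed
  have "cf (dv (c # l) mu) m = real (count (mset l + tot m) c) * ?g (mset l + tot m) / mfact m"
    unfolding cf_dv_mu by (simp add: gm_add)
  also have "\<dots> = real (count (mset l) c) * ?g (mset l + tot m) / mfact m
    + (\<Sum>k\<in>A. real (count m k) * real (count (mset k) c) * ?g (mset l + tot m) / mfact m)"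
    by (simp add: count_tot[OF assms] distrib_right add_divide_distrib sum_distrib_right
        flip: sum_divide_distrib)
  also have "real (count (mset l) c) * ?g (mset l + tot m) / mfact m
    = real (count (mset l) c) * cf (dv (remove1 c l) mu) m"
    by (cases "c \<in> set l") (simp_all add: cf_dv_mu)
  finally show ?thesis by (simp add: *)
qed

subsection \<open>Positivity of the Gaussian cumulants\<close>

definition cumu :: "'a list mps" where "cumu = mlog mu"
definition nu :: "'a list mps" where "nu = minv mu"

lemma cf_cumu_empty [simp]: "cf cumu {#} = 0"
  by (simp add: cumu_def)

lemma nu_mu: "nu * mu = 1"
  by (simp add: nu_def minv_mult)

lemma cf_nu_empty [simp]: "cf nu {#} = 1"
  using arg_cong[OF nu_mu, of "\<lambda>f. cf f {#}"] by simp

lemma dv_mu: "dv l mu = dv l cumu * mu"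
  by (simp add: cumu_def flip: dv_eq_mlog)

lemma dv_nu: "dv l nu = - dv l cumu * nu"
  by (simp add: cumu_def nu_def dv_minv)

lemma dv_mu_nu: "dv l mu * nu = dv l cumu"
  by (simp add: dv_mu mult.assoc mult.commute[of mu] nu_mu)

lemma dv_dv_mu_nu: "dv k (dv l mu) * nu = dv k (dv l cumu) + dv k cumu * dv l cumu"
proof -
  have "dv k (dv l mu) = (dv k (dv l cumu) + dv k cumu * dv l cumu) * mu"
    by (simp add: dv_mu dv_mult algebra_simps)
  then show ?thesis by (simp add: mult.assoc mult.commute[of mu] nu_mu)
qed

text \<open>Integration by parts divided by \<open>mu\<close>. Once \<open>c\<close> is paired with
  a factor of another monomial \<open>k\<close>, the remainders of the two monomials lie either in
  one connected component, which gives the second derivative of \<open>cumu\<close>, or in two,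
  which gives the product. No negative sign occurs.\<close>

lemma dv_cumu_rec:
  "cf (dv (c # l) cumu) m = real (count (mset l) c) * cf (dv (remove1 c l) cumu) m
    + (\<Sum>k\<in>set_mset m. real (count (mset k) c) *
        cf (dv l (dv (remove1 c k) cumu) + dv l cumu * dv (remove1 c k) cumu) (m - {#k#}))"
proof -
  let ?R = "cst (real (count (mset l) c)) * dv (remove1 c l) mu
    + (\<Sum>k\<in>set_mset m. cst (real (count (mset k) c)) * (var k * dv l (dv (remove1 c k) mu)))"
  have "cf (dv (c # l) cumu) m = cf (dv (c # l) mu * nu) m" by (simp add: dv_mu_nu)
  also have "\<dots> = cf (?R * nu) m"
    by (rule cf_mult_cong, rule dv_mu_ibp) (auto dest: set_mset_mono)
  also have "?R * nu = cst (real (count (mset l) c)) * (dv (remove1 c l) mu * nu)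
    + (\<Sum>k\<in>set_mset m. cst (real (count (mset k) c)) * (var k * (dv l (dv (remove1 c k) mu) * nu)))"
    by (simp add: distrib_right sum_distrib_right mult.assoc)
  finally show ?thesis
    unfolding dv_mu_nu dv_dv_mu_nu by (simp add: cf_var_mult)
qed

lemma size_tot_mono: "a \<subseteq># m \<Longrightarrow> size (tot a) \<le> size (tot m)"
  by (metis le_add1 size_union subset_mset.add_diff_inverse tot_simps(3))

text \<open>The empty list stands for the constant monomial 1, so its variable enters
  \<open>mu\<close> through an exponential factor and \<open>cumu\<close> linearly.\<close>

lemma dv_Nil_cumu: "dv [] cumu = 1"
proof -
  have "dv [] mu = mu" by (rule mps_eqI) (simp add: cf_dv_mu, simp add: mu_def)
  then show ?thesis
    using dv_mu_nu[of "[]"] by (metis mult.commute nu_mu)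
qed

text \<open>Each pairing in \<open>dv_cumu_rec\<close> lowers the total degree, so induction on it
  applies to every term on the right. Empty lists do not add to the degree and are treated
  apart.\<close>

lemma cumu_nonneg:
  fixes m :: "'a list multiset"
  shows "0 \<le> cf cumu m"
proof (induction m rule: measure_induct_rule[of "\<lambda>m. size (tot m)"])
  case (less m)
  consider "m = {#}" | "[] \<in># m" | c l where "c # l \<in># m"
    by (metis multiset_nonemptyE neq_Nil_conv)
  then show ?case
  proof cases
    case 2
    then obtain m' where m': "m = add_mset [] m'" by (meson mset_add)
    show ?thesis unfolding m' cf_via_dv dv_Nil_cumu by (simp add: cf_1)
  next
    case 3
    then obtain m' where m': "m = add_mset (c # l) m'" by (meson mset_add)
    have dvn: "0 \<le> cf (dv k cumu) a" if "length k + size (tot a) < size (tot m)"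
      for k :: "'a list" and a
      unfolding cf_dv using less[of "add_mset k a"] that by simp
    have "0 \<le> cf (dv (c # l) cumu) m'"
      unfolding dv_cumu_rec
    proof (intro add_nonneg_nonneg sum_nonneg)
      show "0 \<le> real (count (mset l) c) * cf (dv (remove1 c l) cumu) m'"
        by (intro mult_nonneg_nonneg dvn) (auto simp: m' length_remove1)
      fix k assume k: "k \<in># m'"
      then obtain m'' where m'': "m' = add_mset k m''" by (meson mset_add)
      show "0 \<le> real (count (mset k) c) *
        cf (dv l (dv (remove1 c k) cumu) + dv l cumu * dv (remove1 c k) cumu) (m' - {#k#})"
      proof (cases "c \<in> set k")
        case True
        then have len: "length k = Suc (length (remove1 c k))"
          using length_pos_if_in_set[OF True] by (simp add: length_remove1)
        have "0 \<le> cf (dv l (dv (remove1 c k) cumu)) m''"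
          unfolding cf_dv[of l]
          by (intro mult_nonneg_nonneg dvn) (auto simp: m' m'' len)
        moreover have "0 \<le> cf (dv l cumu * dv (remove1 c k) cumu) m''"
        proof (rule cf_mult_nonneg; rule dvn)
          fix a assume "a \<subseteq># m''"
          from size_tot_mono[OF this]
          show "length l + size (tot a) < size (tot m)"
            and "length (remove1 c k) + size (tot a) < size (tot m)"
            by (auto simp: m' m'' len)
        qed
        ultimately show ?thesis by (simp add: m'')
      qed (simp add: iffD2[OF count_mset_0_iff])
    qed
    then show ?thesis unfolding m' cf_via_dv by simp
  qed simp
qed

lemma dv_cumu_nonneg: "0 \<le> cf (dv l cumu) m"
  unfolding cf_dv by (intro mult_nonneg_nonneg cumu_nonneg) simp

text \<open>The logarithmic derivatives of \<open>nu\<close> and \<open>mu\<close> differ only in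
  sign, and those of \<open>mu\<close> are nonnegative.\<close>

lemma nu_bound: "\<bar>cf nu m\<bar> \<le> cf mu m"
proof (rule ode_mono)
  show "dv x nu = (- dv x cumu) * nu" for x :: "'a list" by (rule dv_nu)
  show "dv x mu = dv x cumu * mu" for x :: "'a list" by (rule dv_mu)
qed (use dv_cumu_nonneg in auto)

subsection \<open>Parity\<close>

definition even_mps :: "'a list mps \<Rightarrow> bool" where
  "even_mps f \<longleftrightarrow> (\<forall>m. odd (size (tot m)) \<longrightarrow> cf f m = 0)"

lemma even_mps_mult:
  assumes "even_mps f" "even_mps g"
  shows "even_mps (f * g)"
  unfolding even_mps_def
proof (intro allI impI)
  fix m :: "'a list multiset" assume m: "odd (size (tot m))"
  have "cf f a * cf g (m - a) = 0" if "a \<subseteq># m" for a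
  proof -
    have "size (tot m) = size (tot a) + size (tot (m - a))"
      using that by (metis size_union subset_mset.add_diff_inverse tot_simps(3))
    with m have "odd (size (tot a)) \<or> odd (size (tot (m - a)))" by auto
    with assms show ?thesis by (auto simp: even_mps_def)
  qed
  then show "cf (f * g) m = 0" by (auto simp: cf_mult intro!: sum.neutral)
qed

lemma even_mps_1: "even_mps 1"
  by (auto simp: even_mps_def cf_1)

lemma even_mu: "even_mps mu"
  by (auto simp: even_mps_def mu_def gm_odd)

lemma even_mps_ucomp:
  assumes "even_mps f"
  shows "even_mps (ucomp a f)"
proof -
  have "even_mps (f ^ k)" for k
    by (induction k) (auto simp: even_mps_1 even_mps_mult assms)
  then show ?thesis by (auto simp: even_mps_def ucomp_def)
qed

lemma even_cumu: "even_mps cumu"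
proof -
  have "even_mps (1 - mu)" using even_mu even_mps_1 by (auto simp: even_mps_def)
  from even_mps_ucomp[OF this] show ?thesis
    by (auto simp: cumu_def mlog_def even_mps_def)
qed

subsection \<open>Iterated differences of the weights\<close>

fun fdiff :: "nat \<Rightarrow> (nat \<Rightarrow> real) \<Rightarrow> nat \<Rightarrow> real" where
  "fdiff 0 h x = h x"
| "fdiff (Suc k) h x = fdiff k h (Suc x) - fdiff k h x"

lemma fdiff_Suc': "fdiff (Suc k) h x = fdiff k (\<lambda>x. h (Suc x) - h x) x"
  by (induction k arbitrary: x) auto

text \<open>A shift by \<open>j\<close> telescopes into \<open>j\<close> unit steps, each of which
  is one more difference.\<close>

lemma fdiff_shift_diff: "fdiff k (\<lambda>x. h (x + j) - h x) x = (\<Sum>i<j. fdiff (Suc k) h (x + i))"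
proof -
  have shift: "fdiff k (\<lambda>x. h (x + j)) x = fdiff k h (x + j)" for j x
    by (induction k arbitrary: x) auto
  have diff: "fdiff k (\<lambda>x. f x - g x) x = fdiff k f x - fdiff k g x" for f g x
    by (induction k arbitrary: x) auto
  show ?thesis
    unfolding diff shift by (induction j) auto
qed

lemma fdiff_scale: "fdiff k (\<lambda>x. c * g x) x = c * fdiff k g x"
  by (induction k arbitrary: x) (auto simp: algebra_simps)

text \<open>Leibniz rule for differences with a linear factor. At \<open>k = 0\<close> the truncated
  \<open>k - 1\<close> is multiplied by zero.\<close>

lemma fdiff_times_id: "fdiff k (\<lambda>x. real x * g x) x = real x * fdiff k g x + real k * fdiff (k - 1) g (Suc x)"
proof (induction k arbitrary: x)
  case (Suc k)
  have "fdiff (Suc k) (\<lambda>x. real x * g x) x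
    = (1 + real x) * fdiff k g (Suc x) + real k * fdiff (k - 1) g (Suc (Suc x))
      - (real x * fdiff k g x + real k * fdiff (k - 1) g (Suc x))"
    by (simp only: fdiff.simps Suc.IH of_nat_Suc add.commute)
  also have "\<dots> = real x * fdiff (Suc k) g x + real (Suc k) * fdiff (Suc k - 1) g (Suc x)"
    by (cases k) (simp_all add: algebra_simps)
  finally show ?case .
qed simp

text \<open>For \<open>N = n / 2\<close> this is \<open>n ^ x\<close> divided by
  \<open>n (n + 2) ... (n + 2 x - 2)\<close>, where the denominator is the moment of order
  \<open>2 x\<close> of the norm of a standard Gaussian vector in dimension
  \<open>n\<close>.\<close>

definition wt :: "real \<Rightarrow> nat \<Rightarrow> real" where
  "wt N x = (\<Prod>j<x. 1 / (1 + real j / N))"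

lemma wt_0 [simp]: "wt N 0 = 1"
  by (simp add: wt_def)

lemma wt_Suc: "wt N (Suc x) = wt N x / (1 + real x / N)"
  by (simp add: wt_def)

lemma wt_pos: "0 < N \<Longrightarrow> 0 < wt N x"
  by (auto simp: wt_def intro!: prod_pos divide_pos_pos add_pos_nonneg)

lemma wt_le_1: "0 < N \<Longrightarrow> wt N x \<le> 1"
  unfolding wt_def by (intro prod_le_1) (auto simp: divide_le_eq_1 add_pos_nonneg)

lemma wt_diff:
  assumes "0 < N"
  shows "wt N (Suc x) - wt N x = - (1 / N) * (real x * wt N (Suc x))"
proof -
  have "1 + real x / N > 0" using assms by (simp add: add_pos_nonneg)
  then have "wt N x = wt N (Suc x) * (1 + real x / N)" by (simp add: wt_Suc)
  then show ?thesis by (simp add: algebra_simps)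
qed

text \<open>The difference equation \<open>wt_diff\<close> has a coefficient linear in
  \<open>x\<close>, so taking \<open>k\<close> further differences leaves only two terms.\<close>

lemma fdiff_Suc_wt:
  assumes "0 < N"
  shows "fdiff (Suc k) (wt N) x
    = - (1 / N) * (real x * fdiff k (wt N) (x + 1) + real k * fdiff (k - 1) (wt N) (x + 2))"
proof -
  have shift: "fdiff k (\<lambda>x. wt N (Suc x)) x = fdiff k (wt N) (Suc x)" for k x
    by (induction k arbitrary: x) auto
  have "fdiff (Suc k) (wt N) x = fdiff k (\<lambda>x. - (1 / N) * (real x * wt N (Suc x))) x"
    unfolding fdiff_Suc' wt_diff[OF assms] ..
  also have "\<dots> = - (1 / N) * (real x * fdiff k (wt N) (x + 1) + real k * fdiff (k - 1) (wt N) (x + 2))"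
    unfolding fdiff_scale fdiff_times_id shift by simp
  finally show ?thesis .
qed

text \<open>The recursion lowers the order by as much as it raises \<open>x\<close>, so the range
  \<open>x + k \<le> X\<close> is inherited. Each of its two terms is at most
  \<open>fact r * s ^ Suc r\<close>: the first because \<open>x \<le> sqrt N\<close>, the second
  because the order drops by two while \<open>1 / N = s * s\<close>. For \<open>r > 0\<close> their
  sum fits under \<open>fact (Suc r)\<close>; for \<open>r = 0\<close> the second is absent.\<close>

lemma fdiff_wt_bound:
  assumes N: "0 < N" and X: "real X ^ 2 \<le> N" and "x + k \<le> X"
  shows "\<bar>fdiff k (wt N) x\<bar> \<le> fact k * (1 / sqrt N) ^ k"
  using assms(3)
proof (induction k arbitrary: x rule: less_induct)
  case (less k)
  define s where "s = 1 / sqrt N"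
  have s: "0 < s" "1 / N = s * s" using N by (simp_all add: s_def)
  have sX: "s * real X \<le> 1"
    using N X real_le_rsqrt[OF X] by (simp add: s_def)
  show ?case
  proof (cases k)
    case 0
    then show ?thesis using wt_pos[OF N, of x] wt_le_1[OF N, of x] by simp
  next
    case (Suc r)
    have 1: "\<bar>fdiff r (wt N) (x + 1)\<bar> \<le> fact r * s ^ r"
      using less(1)[of r "x + 1"] less(2) Suc by (simp add: s_def)
    have A: "s * s * (real x * \<bar>fdiff r (wt N) (x + 1)\<bar>) \<le> fact r * s ^ Suc r"
    proof -
      have "s * real x \<le> s * real X" using less(2) s by (intro mult_left_mono) auto
      then have "s * real x \<le> 1" using sX by linarith
      then have "(s * real x) * (s * \<bar>fdiff r (wt N) (x + 1)\<bar>) \<le> 1 * (s * (fact r * s ^ r))"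
        using 1 s by (intro mult_mono mult_left_mono) auto
      then show ?thesis by (simp add: mult_ac)
    qed
    have B: "s * s * (real r * \<bar>fdiff (r - 1) (wt N) (x + 2)\<bar>) \<le> (if r = 0 then 0 else fact r * s ^ Suc r)"
    proof (cases r)
      case (Suc q)
      have "\<bar>fdiff q (wt N) (x + 2)\<bar> \<le> fact q * s ^ q"
        using less(1)[of q "x + 2"] less(2) \<open>k = Suc r\<close> Suc by (simp add: s_def)
      then have "s * s * (real r * \<bar>fdiff q (wt N) (x + 2)\<bar>) \<le> s * s * (real r * (fact q * s ^ q))"
        using s by (intro mult_left_mono) auto
      then show ?thesis by (simp add: Suc mult_ac)
    qed simp
    have "\<bar>fdiff k (wt N) x\<bar> = s * s * \<bar>real x * fdiff r (wt N) (x + 1) + real r * fdiff (r - 1) (wt N) (x + 2)\<bar>"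
      unfolding Suc fdiff_Suc_wt[OF N] abs_mult using N s by simp
    also have "\<dots> \<le> s * s * (real x * \<bar>fdiff r (wt N) (x + 1)\<bar> + real r * \<bar>fdiff (r - 1) (wt N) (x + 2)\<bar>)"
      using s by (intro mult_left_mono order_trans[OF abs_triangle_ineq]) (auto simp: abs_mult)
    also have "\<dots> \<le> fact r * s ^ Suc r + (if r = 0 then 0 else fact r * s ^ Suc r)"
      using A B by (simp add: distrib_left)
    also have "\<dots> \<le> fact (Suc r) * s ^ Suc r"
    proof (cases "r = 0")
      case False
      then have "fact r * s ^ Suc r + (if r = 0 then 0 else fact r * s ^ Suc r) = (2 * fact r) * s ^ Suc r"
        by simp
      also have "\<dots> \<le> ((1 + real r) * fact r) * s ^ Suc r"
        using s False by (intro mult_right_mono) auto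
      finally show ?thesis by simp
    qed simp
    finally show ?thesis by (simp add: Suc s_def)
  qed
qed

subsection \<open>Reweighted Gaussian moments\<close>

definition rw :: "(nat \<Rightarrow> real) \<Rightarrow> 'a list mps" where
  "rw h = Mps (\<lambda>m. h (size (tot m) div 2) * cf mu m)"

definition half_deg :: "'a list \<Rightarrow> 'a list multiset \<Rightarrow> nat" where
  "half_deg l a = (length l + size (tot a)) div 2"

lemma size_tot_diff: "a \<subseteq># m \<Longrightarrow> size (tot m) = size (tot a) + size (tot (m - a))"
  by (metis size_union subset_mset.add_diff_inverse tot_simps(3))

lemma dv_cumu_odd: "odd (length l + size (tot a)) \<Longrightarrow> cf (dv l cumu) a = 0"
  using even_cumu[unfolded even_mps_def, rule_format, of "add_mset l a"] by (simp add: cf_dv)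

text \<open>The weight depends on the total degree only, so in the expansion of
  \<open>dv l cumu * mu\<close> the degree of the first factor becomes a shift of the weight. Half
  degrees add up because coefficients of odd degree vanish.\<close>

lemma cf_dv_rw:
  "cf (dv l (rw h)) m = (\<Sum>a\<in>submsets m. cf (dv l cumu) a * cf (rw (\<lambda>x. h (x + half_deg l a))) (m - a))"
proof -
  have "cf (dv l (rw h)) m = h (half_deg l m) * cf (dv l mu) m"
    by (simp add: cf_dv rw_def half_deg_def)
  also have "\<dots> = (\<Sum>a\<in>submsets m. h (half_deg l m) * (cf (dv l cumu) a * cf mu (m - a)))"
    by (simp add: dv_mu cf_mult sum_distrib_left)
  also have "\<dots> = (\<Sum>a\<in>submsets m. cf (dv l cumu) a * cf (rw (\<lambda>x. h (x + half_deg l a))) (m - a))"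
  proof (rule sum.cong)
    fix a assume a: "a \<in> submsets m"
    show "h (half_deg l m) * (cf (dv l cumu) a * cf mu (m - a))
      = cf (dv l cumu) a * cf (rw (\<lambda>x. h (x + half_deg l a))) (m - a)"
    proof (cases "even (length l + size (tot a)) \<and> even (size (tot (m - a)))")
      case True
      moreover have *: "size (tot m) = size (tot a) + size (tot (m - a))"
        using a by (intro size_tot_diff) simp
      ultimately have "half_deg l m = size (tot (m - a)) div 2 + half_deg l a"
        unfolding half_deg_def * by presburger
      then show ?thesis by (simp add: rw_def)
    next
      case False
      then have "cf (dv l cumu) a = 0 \<or> cf mu (m - a) = 0"
        using dv_cumu_odd even_mu by (auto simp: even_mps_def)
      then show ?thesis by (auto simp: rw_def)
    qed
  qed simp
  finally show ?thesis .
qed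

text \<open>The quotient of the reweighted by the Gaussian moment series, \<open>nu\<close> being
  the inverse of \<open>mu\<close>.\<close>

definition erw :: "(nat \<Rightarrow> real) \<Rightarrow> 'a list mps" where
  "erw h = rw h * nu"

lemma rw_diff: "rw (\<lambda>x. f x - g x) = rw f - rw g"
  by (rule mps_eqI) (simp add: rw_def algebra_simps)

lemma cf_erw_empty [simp]: "cf (erw h) {#} = h 0"
  by (simp add: erw_def) (simp add: rw_def)

text \<open>Differentiating \<open>nu\<close> subtracts the same convolution with the unshifted
  weight. So the derivative of a quotient is a combination of quotients of the same kind, with
  differences of the weight: here the cancellation between the two moment series is
  captured.\<close>

lemma cf_dv_erw:
  "cf (dv l (erw h)) m
    = (\<Sum>a\<in>submsets m. cf (dv l cumu) a * cf (erw (\<lambda>x. h (x + half_deg l a) - h x)) (m - a))"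
proof -
  let ?h = "\<lambda>a x. h (x + half_deg l a)"
  have "dv l (erw h) = dv l (rw h) * nu - dv l cumu * erw h"
    by (simp add: erw_def dv_mult dv_nu algebra_simps)
  moreover have "cf (dv l (rw h) * nu) m
    = (\<Sum>c\<in>submsets m. \<Sum>a\<in>submsets c. cf (dv l cumu) a * cf (rw (?h a)) (c - a) * cf nu (m - c))"
    by (simp add: cf_mult[of "dv l (rw h)"] cf_dv_rw sum_distrib_right)
  moreover have "\<dots> = (\<Sum>a\<in>submsets m. \<Sum>b\<in>submsets (m - a).
      cf (dv l cumu) a * cf (rw (?h a)) b * cf nu (m - a - b))"
    by (rule sum_submsets_assoc[symmetric])
  moreover have "\<dots> = (\<Sum>a\<in>submsets m. cf (dv l cumu) a * cf (erw (?h a)) (m - a))"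
    by (simp add: erw_def cf_mult sum_distrib_left mult.assoc)
  ultimately show ?thesis
    by (simp add: cf_mult[of "dv l cumu"] erw_def rw_diff left_diff_distrib right_diff_distrib
        sum_subtractf)
qed

text \<open>Majorant for one derivative of \<open>erw\<close>: a block of half degree
  \<open>j\<close> costs \<open>j\<close> unit differences, each of relative size \<open>s\<close>,
  times its Gaussian cumulant.\<close>

definition qser :: "real \<Rightarrow> 'a list mps" where
  "qser s = Mps (\<lambda>m. s * (real (size (tot m) div 2) * cf cumu m))"

lemma cf_qser_empty [simp]: "cf (qser s) {#} = 0"
  by (simp add: qser_def)

lemma cf_dv_qser: "cf (dv l (qser s)) a = s * (real (half_deg l a) * cf (dv l cumu) a)"
  by (simp add: cf_dv qser_def half_deg_def mult_ac)

lemma qser_nonneg: "0 \<le> s \<Longrightarrow> 0 \<le> cf (qser s) m"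
  by (simp add: qser_def cumu_nonneg)

lemma dv_geo_power:
  assumes "cf f {#} = 0"
  shows "dv x (geo f ^ Suc r) = cst (real (Suc r)) * (dv x f * geo f ^ Suc (Suc r))"
  unfolding dv_power dv_geo[OF assms] by (simp add: power2_eq_square mult_ac)

text \<open>A derivative of \<open>fact r * geo (qser s) ^ Suc r\<close> raises \<open>r\<close> by
  one and brings out the factor \<open>s * j\<close> and a cumulant. Passing from \<open>h\<close>
  to its difference over \<open>j\<close> steps does the same to the hypotheses: \<open>r\<close>
  becomes \<open>r + 1\<close>, \<open>A\<close> becomes \<open>A * j * s\<close>, and
  \<open>X\<close> becomes \<open>X - j\<close>. Hence the induction over all \<open>h\<close>,
  \<open>A\<close>, \<open>r\<close>, \<open>X\<close>.\<close>

lemma erw_bound: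
  fixes m :: "'a list multiset"
  assumes "0 \<le> s" "0 \<le> A"
    and "\<And>k x. x + k \<le> X \<Longrightarrow> \<bar>fdiff k h x\<bar> \<le> A * (fact (r + k) * s ^ k)"
    and "size (tot m) div 2 \<le> X"
  shows "\<bar>cf (erw h) m\<bar> \<le> A * (fact r * cf (geo (qser s) ^ Suc r) m)"
  using assms(2-)
proof (induction m arbitrary: h A r X rule: measure_induct_rule[of size])
  case (less m)
  show ?case
  proof (cases m)
    case empty
    have "\<bar>fdiff 0 h 0\<bar> \<le> A * (fact (r + 0) * s ^ 0)" by (rule less.prems) simp
    then show ?thesis by (simp add: empty geo_def del: power_Suc)
  next
    case (add l m')
    define P where "P = geo (qser s :: 'a list mps) ^ Suc (Suc r)"
    have dP: "cf (dv l (geo (qser s) ^ Suc r)) m'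
      = real (Suc r) * (\<Sum>a\<in>submsets m'. s * (real (half_deg l a) * cf (dv l cumu) a) * cf P (m' - a))"
      unfolding dv_geo_power[OF cf_qser_empty] cf_cst_mult cf_mult[of "dv l (qser s)"] cf_dv_qser P_def ..
    have "\<bar>cf (dv l (erw h)) m'\<bar>
      \<le> (\<Sum>a\<in>submsets m'. cf (dv l cumu) a * \<bar>cf (erw (\<lambda>x. h (x + half_deg l a) - h x)) (m' - a)\<bar>)"
      unfolding cf_dv_erw
      by (rule order_trans[OF sum_abs]) (simp add: abs_mult dv_cumu_nonneg)
    also have "\<dots> \<le> (\<Sum>a\<in>submsets m'. cf (dv l cumu) a *
        ((A * real (half_deg l a) * s) * (fact (Suc r) * cf P (m' - a))))"
    proof (rule sum_mono)
      fix a assume "a \<in> submsets m'"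
      then have a: "a \<subseteq># m'" by simp
      show "cf (dv l cumu) a * \<bar>cf (erw (\<lambda>x. h (x + half_deg l a) - h x)) (m' - a)\<bar>
        \<le> cf (dv l cumu) a * ((A * real (half_deg l a) * s) * (fact (Suc r) * cf P (m' - a)))"
      proof (cases "even (length l + size (tot a))")
        case True
        let ?j = "half_deg l a"
        have size: "size (tot m) = 2 * ?j + size (tot (m' - a))"
          using True size_tot_diff[OF a] by (simp add: add half_deg_def)
        with less.prems(3) have jX: "?j \<le> X" by linarith
        have "\<bar>cf (erw (\<lambda>x. h (x + ?j) - h x)) (m' - a)\<bar>
          \<le> (A * real ?j * s) * (fact (Suc r) * cf P (m' - a))"
          unfolding P_def
        proof (rule less.IH)
          show "size (m' - a) < size m" using a by (simp add: add size_Diff_submset)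
          show "0 \<le> A * real ?j * s" using less.prems(1) assms(1) by simp
          show "size (tot (m' - a)) div 2 \<le> X - ?j"
            using size less.prems(3) by linarith
          fix k x assume "x + k \<le> X - ?j"
          then have "\<bar>\<Sum>i<?j. fdiff (Suc k) h (x + i)\<bar> \<le> (\<Sum>i<?j. A * (fact (r + Suc k) * s ^ Suc k))"
            using jX by (intro order_trans[OF sum_abs] sum_mono less.prems(2)) auto
          then show "\<bar>fdiff k (\<lambda>x. h (x + ?j) - h x) x\<bar> \<le> A * real ?j * s * (fact (Suc r + k) * s ^ k)"
            unfolding fdiff_shift_diff by (simp add: mult_ac)
        qed
        then show ?thesis by (intro mult_left_mono dv_cumu_nonneg)
      qed (simp add: dv_cumu_odd)
    qed
    also have "\<dots> = A * (fact r * cf (dv l (geo (qser s) ^ Suc r)) m')"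
      unfolding dP fact_Suc sum_distrib_left by (intro sum.cong refl) (simp add: mult_ac)
    finally have "\<bar>cf (dv l (erw h)) m'\<bar> / (real (count m' l) + 1)
      \<le> A * (fact r * cf (dv l (geo (qser s) ^ Suc r)) m') / (real (count m' l) + 1)"
      by (intro divide_right_mono) auto
    then show ?thesis
      unfolding add cf_via_dv by simp
  qed
qed

text \<open>With \<open>E = erw (wt N)\<close>, coefficientwise \<open>\<bar>E - 1\<bar> \<le> Q / (1 - Q)\<close> gives
  \<open>\<bar>1 / E\<bar> \<le> (1 - Q) / (1 - 2 Q) \<le> 1 / (1 - 2 Q)\<close>.\<close>

lemma minv_erw_bound:
  fixes m :: "'a list multiset"
  assumes "0 < N" "real X ^ 2 \<le> N" "size (tot m) div 2 \<le> X"
  shows "\<bar>cf (minv (erw (wt N))) m\<bar> \<le> cf (geo (cst 2 * qser (1 / sqrt N))) m"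
proof -
  define s where "s = 1 / sqrt N"
  have s: "0 \<le> s" using assms by (simp add: s_def)
  define Q I J E y where "Q = (qser s :: 'a list mps)" and "I = geo Q" and "J = geo (cst 2 * Q)"
    and "E = (erw (wt N) :: 'a list mps)" and "y = minv E"
  have Q0: "cf Q {#} = 0" by (simp add: Q_def)
  have Qn: "0 \<le> cf Q m" for m unfolding Q_def by (rule qser_nonneg[OF s])
  have Jn: "0 \<le> cf J m" for m unfolding J_def by (rule geo_nonneg) (simp add: Qn)
  have I: "I = 1 + Q * I" using geo_inverse[OF Q0] by (simp add: I_def algebra_simps)
  have "cst 2 * Q = Q + Q" by (rule mps_eqI) (simp only: cf_cst_mult cf_add mult_2)
  then have J: "J = 1 + Q * J + Q * J"
    using geo_inverse[of "cst 2 * Q"] Q0 by (simp add: J_def algebra_simps)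
  \<comment> \<open>\<open>Y\<close> is \<open>(1 - Q) / (1 - 2 Q)\<close>. By \<open>YI\<close> it
    satisfies \<open>Y = 1 + Y * (Q * I)\<close>, the majorant form of
    \<open>y = 1 - y * (E - 1)\<close>.\<close>
  define Y where "Y = 1 + Q * J"
  have Y': "Y = (1 - Q) * J"
    using arg_cong[OF J, of "\<lambda>f. f - Q * J"] unfolding Y_def left_diff_distrib by simp
  have YI: "Y * (Q * I) = Q * J"
    using geo_inverse[OF Q0] unfolding Y' I_def by (metis mult.assoc mult.commute mult_1)
  have E: "\<bar>cf (E - 1) a\<bar> \<le> cf (Q * I) a" if "size (tot a) div 2 \<le> X" for a
  proof (cases "a = {#}")
    case False
    have "\<bar>cf E a\<bar> \<le> 1 * (fact 0 * cf (I ^ Suc 0) a)"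
      unfolding E_def I_def Q_def
      by (rule erw_bound[OF s _ _ that])
         (use fdiff_wt_bound[OF assms(1,2)] in \<open>auto simp: s_def\<close>)
    also have "\<dots> = cf 1 a + cf (Q * I) a" using arg_cong[OF I, of "\<lambda>f. cf f a"] by simp
    finally show ?thesis using False by (simp add: cf_1)
  qed (simp add: E_def Q0)
  have y: "y * E = 1" unfolding y_def by (rule minv_mult) (simp add: E_def)
  \<comment> \<open>The induction closes because \<open>E - 1\<close> has no constant term: only
    proper divisors of \<open>m\<close> contribute to \<open>y * (E - 1)\<close>.\<close>
  have "\<bar>cf y m\<bar> \<le> cf Y m" using assms(3)
  proof (induction m rule: measure_induct_rule[of size])
    case (less m)
    have "cf y m = cf (1 - y * (E - 1)) m" by (simp add: y right_diff_distrib)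
    also have "\<bar>\<dots>\<bar> \<le> cf 1 m + \<bar>cf (y * (E - 1)) m\<bar>"
      using abs_triangle_ineq4[of "cf 1 m" "cf (y * (E - 1)) m"]
      by (simp add: cf_1 del: cf_mult_empty split: if_splits)
    also have "\<bar>cf (y * (E - 1)) m\<bar> \<le> (\<Sum>a\<in>submsets m. \<bar>cf y a * cf (E - 1) (m - a)\<bar>)"
      unfolding cf_mult by (rule sum_abs)
    also have "\<dots> \<le> (\<Sum>a\<in>submsets m. cf Y a * cf (Q * I) (m - a))"
    proof (rule sum_mono)
      fix a assume "a \<in> submsets m"
      then have a: "a \<subseteq># m" by simp
      show "\<bar>cf y a * cf (E - 1) (m - a)\<bar> \<le> cf Y a * cf (Q * I) (m - a)"
      proof (cases "a = m")
        case True
        then show ?thesis by (simp add: E_def Q0)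
      next
        case False
        then have "size a < size m" using a by (simp add: mset_subset_size subset_mset.less_le)
        then have "\<bar>cf y a\<bar> \<le> cf Y a"
          using less size_tot_mono[OF a] by (meson div_le_mono le_trans)
        moreover have "\<bar>cf (E - 1) (m - a)\<bar> \<le> cf (Q * I) (m - a)"
          using less.prems size_tot_mono[of "m - a" m]
          by (intro E) (meson diff_subset_eq_self div_le_mono le_trans)
        ultimately show ?thesis unfolding abs_mult by (intro mult_mono) auto
      qed
    qed
    also have "\<dots> = cf (Q * J) m" by (simp add: YI flip: cf_mult)
    finally show ?case by (simp add: Y_def)
  qed
  also have "\<dots> \<le> cf J m"
  proof -
    have "cf J m = cf 1 m + cf (Q * J) m + cf (Q * J) m"
      using arg_cong[OF J, of "\<lambda>f. cf f m"] by (simp only: cf_add)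
    moreover have "0 \<le> cf (Q * J) m" by (rule cf_mult_nonneg) (auto simp: Qn Jn)
    ultimately show ?thesis by (simp add: Y_def)
  qed
  finally show ?thesis by (simp add: y_def E_def J_def Q_def s_def)
qed

subsection \<open>Monomials of fixed odd degree\<close>

lemma size_tot_const: "set_mset m \<subseteq> {l. length l = p} \<Longrightarrow> size (tot m) = p * size m"
  by (induction m) auto

text \<open>The cumulant of a single monomial of odd degree vanishes, so on such variables
  \<open>qser s\<close> starts with pairs and its \<open>k\<close>-th power with \<open>2 k\<close>
  variables.\<close>

lemma qser_power_small:
  assumes "odd p" "set_mset m \<subseteq> {l. length l = p}" "size m < 2 * k"
  shows "cf (qser s ^ k) m = 0"
  using assms(2,3)
proof (induction k arbitrary: m)
  case (Suc k)
  have "cf (qser s) a * cf (qser s ^ k) (m - a) = 0" if a: "a \<subseteq># m" for a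
  proof (cases "size a \<ge> 2")
    case True
    then have "size (m - a) < 2 * k"
      using Suc.prems size_mset_mono[OF a] by (simp add: size_Diff_submset[OF a])
    moreover have "set_mset (m - a) \<subseteq> {l. length l = p}"
      using Suc.prems by (auto dest: in_diffD)
    ultimately show ?thesis using Suc.IH by simp
  next
    case False
    then have "a = {#} \<or> odd (size (tot a))"
    proof -
      have "size (tot a) = p * size a"
        using a Suc.prems set_mset_mono[OF a] by (intro size_tot_const) auto
      moreover have "size a = 0 \<or> size a = 1" using False by linarith
      ultimately show ?thesis using assms(1) by auto
    qed
    then show ?thesis using even_cumu by (auto simp: qser_def even_mps_def)
  qed
  then show ?case unfolding power_Suc cf_mult by (intro sum.neutral) simp
qed simp

lemma cst_mult_power: "cf ((cst c * f) ^ k) m = c ^ k * cf (f ^ k) m"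
proof -
  have "(cst c * f) ^ k = cst (c ^ k) * f ^ k"
  proof (induction k)
    case (Suc k)
    have "cst (c ^ Suc k) * f ^ Suc k = (cst c * f) * (cst (c ^ k) * f ^ k)"
      by (rule mps_eqI) (simp add: mult.assoc mult.left_commute[of f])
    with Suc show ?case by simp
  qed simp
  then show ?thesis by simp
qed

text \<open>Only powers with \<open>2 k \<le> D\<close> survive, and for them
  \<open>2 ^ k * fact k \<le> (2 k) ^ k \<le> D ^ k\<close>. The exponential has an explicit
  logarithmic derivative, so its products with \<open>mu\<close> are within reach of
  \<open>ode_mono\<close>.\<close>

lemma geo_le_mexp:
  assumes "odd p" "set_mset m \<subseteq> {l. length l = p}" "size m \<le> D" "0 \<le> s"
  shows "cf (geo (cst 2 * qser s)) m \<le> cf (mexp (cst (real D) * qser s)) m"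
proof -
  have "2 ^ k * cf (qser s ^ k) m \<le> 1 / fact k * (real D ^ k * cf (qser s ^ k) m)" for k
  proof (cases "size m < 2 * k")
    case True
    then show ?thesis by (simp add: qser_power_small[OF assms(1,2)])
  next
    case False
    then have k: "2 * real k \<le> real D" using assms(3) by simp
    have "2 ^ k * fact k \<le> 2 ^ k * real k ^ k"
      using fact_le_power[of k] by (intro mult_left_mono) auto
    also have "\<dots> = (2 * real k) ^ k" by (simp add: power_mult_distrib)
    also have "\<dots> \<le> real D ^ k" using k by (intro power_mono) auto
    finally have "2 ^ k \<le> real D ^ k / fact k" by (simp add: field_simps)
    then have "2 ^ k * cf (qser s ^ k) m \<le> real D ^ k / fact k * cf (qser s ^ k) m"
      by (intro mult_right_mono cf_power_nonneg qser_nonneg assms)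
    then show ?thesis by simp
  qed
  then show ?thesis
    unfolding geo_def mexp_def ucomp_def by (simp add: cst_mult_power sum_mono)
qed

text \<open>The logarithm of the product is \<open>2 * cumu + D * qser s\<close>, and doubling every
  variable multiplies the coefficient of \<open>cumu\<close> at size \<open>k\<close> by
  \<open>2 ^ k\<close>. Only even \<open>k \<ge> 2\<close> matter; there \<open>D * s\<close> times
  the half degree \<open>p * k / 2\<close> is at most \<open>k / 2\<close>, and
  \<open>2 + k / 2 \<le> 2 ^ k\<close>.\<close>

lemma mu_mu_mexp_bound:
  fixes m :: "'a list multiset"
  assumes "odd p" "set_mset m \<subseteq> {l. length l = p}" "0 \<le> s" "real p * real D * s \<le> 1"
  shows "cf (mu * mu * mexp (cst (real D) * qser s)) m \<le> 2 ^ size m * cf mu m"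
proof -
  define Q where "Q = cst (real D) * (qser s :: 'a list mps)"
  have Q0: "cf Q {#} = 0" by (simp add: Q_def)
  have "\<bar>cf (mu * mu * mexp Q) m\<bar> \<le> cf (Mps (\<lambda>m. 2 ^ size m * cf mu m)) m"
  proof (rule ode_mono)
    show "dv x (mu * mu * mexp Q) = (dv x cumu + dv x cumu + dv x Q) * (mu * mu * mexp Q)" for x
      by (simp add: dv_mult dv_mu[of x] dv_mexp[OF Q0]) (simp add: algebra_simps)
    show "dv x (Mps (\<lambda>m. 2 ^ size m * cf mu m))
      = Mps (\<lambda>a. 2 ^ Suc (size a) * cf (dv x cumu) a) * Mps (\<lambda>m. 2 ^ size m * cf mu m)" for x :: "'a list"
    proof (rule mps_eqI)
      fix m :: "'a list multiset"
      have "cf (dv x (Mps (\<lambda>m. 2 ^ size m * cf mu m))) m = 2 ^ Suc (size m) * cf (dv x mu) m"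
        by (simp add: cf_dv)
      also have "\<dots> = (\<Sum>a\<in>submsets m. 2 ^ Suc (size m) * (cf (dv x cumu) a * cf mu (m - a)))"
        by (simp add: dv_mu cf_mult sum_distrib_left)
      also have "\<dots> = (\<Sum>a\<in>submsets m. 2 ^ Suc (size a) * cf (dv x cumu) a * (2 ^ size (m - a) * cf mu (m - a)))"
      proof (rule sum.cong)
        fix a assume "a \<in> submsets m"
        then have "Suc (size m) = Suc (size a) + size (m - a)"
          by (simp add: size_Diff_submset size_mset_mono)
        then show "2 ^ Suc (size m) * (cf (dv x cumu) a * cf mu (m - a))
          = 2 ^ Suc (size a) * cf (dv x cumu) a * (2 ^ size (m - a) * cf mu (m - a))"
          by (simp only: power_add mult_ac)
      qed simp
      finally show "cf (dv x (Mps (\<lambda>m. 2 ^ size m * cf mu m))) m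
        = cf (Mps (\<lambda>a. 2 ^ Suc (size a) * cf (dv x cumu) a) * Mps (\<lambda>m. 2 ^ size m * cf mu m)) m"
        by (simp add: cf_mult)
    qed
  next
    fix x a assume xa: "add_mset x a \<subseteq># m"
    let ?t = "length x + size (tot a)"
    have t: "?t = p * Suc (size a)"
      using size_tot_const[of "add_mset x a" p] subset_trans[OF set_mset_mono[OF xa] assms(2)] by simp
    show "\<bar>cf (dv x cumu + dv x cumu + dv x Q) a\<bar> \<le> cf (Mps (\<lambda>a. 2 ^ Suc (size a) * cf (dv x cumu) a)) a"
    proof (cases "even ?t")
      case False
      then show ?thesis unfolding cf_add Q_def dv_cst_mult by (simp add: dv_cumu_odd cf_dv_qser)
    next
      case True
      then have ev: "even (Suc (size a))" using t assms(1) by (metis even_mult_iff)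
      have "real D * (s * real (half_deg x a)) = (real p * real D * s) * (real (Suc (size a)) / 2)"
        using True by (simp add: half_deg_def real_of_nat_div t algebra_simps)
      also have "\<dots> \<le> 1 * (real (Suc (size a)) / 2)"
        using assms(4) by (intro mult_right_mono) auto
      finally have 1: "real D * (s * real (half_deg x a)) \<le> real (Suc (size a)) / 2" by simp
      have 2: "2 + real (Suc (size a)) / 2 \<le> 2 ^ Suc (size a)"
      proof -
        have "Suc (Suc (size a)) \<le> 2 ^ Suc (size a)" using less_exp[of "Suc (size a)"] by linarith
        then have "real (Suc (Suc (size a))) \<le> 2 ^ Suc (size a)"
          by (metis of_nat_le_iff of_nat_numeral of_nat_power)
        moreover have "1 \<le> real (size a)" using ev by (cases "size a") auto
        ultimately show ?thesis by (simp add: field_simps)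
      qed
      have "cf (dv x cumu + dv x cumu + dv x Q) a
        = (2 + real D * (s * real (half_deg x a))) * cf (dv x cumu) a"
        unfolding Q_def cf_add dv_cst_mult cf_cst_mult cf_dv_qser by (simp add: algebra_simps)
      moreover have "0 \<le> \<dots>" using assms(3) dv_cumu_nonneg[of x a] by simp
      moreover have "(2 + real D * (s * real (half_deg x a))) * cf (dv x cumu) a
        \<le> 2 ^ Suc (size a) * cf (dv x cumu) a"
        by (rule mult_right_mono[OF _ dv_cumu_nonneg]) (use 1 2 in linarith)
      ultimately show ?thesis by (simp del: power_Suc)
    qed
  qed simp
  then show ?thesis by (simp add: Q_def)
qed

text \<open>The generating series of the joint cumulants of \<open>v\<^sub>i\<close> with monomials in \<open>v\<close>, for \<open>v\<close> uniform on the
  sphere of squared radius \<open>n = 2 N\<close>.\<close>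

definition kappa :: "real \<Rightarrow> 'a \<Rightarrow> 'a list mps" where
  "kappa N i = dv [i] (rw (wt N)) * (nu * minv (erw (wt N)))"

lemma kappa_eq: "kappa N i * rw (wt N) = dv [i] (rw (wt N))"
proof -
  have "minv (erw (wt N)) * (rw (wt N) * nu) = 1"
    using minv_mult[of "erw (wt N)"] by (simp add: erw_def[symmetric])
  then show ?thesis
    unfolding kappa_def by (metis mult.assoc mult.commute mult_1)
qed

text \<open>Of the two inverses in \<open>kappa\<close>, the Gaussian one is bounded by
  \<open>mu\<close> and the other by \<open>J\<close>. Writing \<open>dv [i] mu\<close> as
  \<open>dv [i] cumu * mu\<close> frees a second \<open>mu\<close>; then \<open>mu * mu * J\<close>
  is reduced to \<open>mu\<close> at the price of 2 per variable, and
  \<open>dv [i] cumu * mu\<close> is \<open>dv [i] mu\<close> again. The monomial \<open>[i]\<close>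
  has degree 1 and enters only through a derivative, so all of \<open>m\<close> may be taken of
  degree \<open>p\<close>.\<close>

theorem kappa_bound:
  fixes m :: "'a list multiset"
  assumes "odd p" "set_mset m \<subseteq> {l. length l = p}" "size m \<le> D"
    and "0 < N" "(real p * real D)\<^sup>2 \<le> N"
  shows "\<bar>cf (kappa N i) m\<bar> \<le> 2 ^ size m * cf (dv [i] mu) m"
proof -
  define s where "s = 1 / sqrt N"
  have s: "0 \<le> s" "real p * real D * s \<le> 1"
    using assms(4) real_le_rsqrt[OF assms(5)] by (simp_all add: s_def)
  define J where "J = mexp (cst (real D) * (qser s :: 'a list mps))"
  have sub: "set_mset a \<subseteq> {l. length l = p}" "size a \<le> size m" "size a \<le> D" if "a \<subseteq># m" for a
    using set_mset_mono[OF that] size_mset_mono[OF that] assms(2,3) by auto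
  have B: "\<bar>cf (nu * minv (erw (wt N))) b\<bar> \<le> cf (mu * J) b" if b: "b \<subseteq># m" for b
  proof (rule cf_mult_mono)
    fix a assume "a \<subseteq># b"
    then have a: "a \<subseteq># m" using b by (rule subset_mset.order_trans)
    have "\<bar>cf (minv (erw (wt N))) a\<bar> \<le> cf (geo (cst 2 * qser (1 / sqrt N))) a"
    proof (rule minv_erw_bound[OF assms(4)])
      show "real (p * D) ^ 2 \<le> N" using assms(5) by simp
      have "p * size a div 2 \<le> p * D"
        using mult_le_mono2[OF sub(3)[OF a], of p] by linarith
      then show "size (tot a) div 2 \<le> p * D" using size_tot_const[OF sub(1)[OF a]] by simp
    qed
    also have "\<dots> \<le> cf J a"
      unfolding J_def s_def[symmetric] by (rule geo_le_mexp[OF assms(1)]) (use sub[OF a] s in auto)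
    finally show "\<bar>cf (minv (erw (wt N))) a\<bar> \<le> cf J a" .
  qed (rule nu_bound)
  have "\<bar>cf (kappa N i) m\<bar> \<le> cf (dv [i] mu * (mu * J)) m"
    unfolding kappa_def
  proof (rule cf_mult_mono)
    fix a
    show "\<bar>cf (dv [i] (rw (wt N))) a\<bar> \<le> cf (dv [i] mu) a"
      unfolding cf_dv rw_def
      using wt_pos[OF assms(4)] wt_le_1[OF assms(4)]
      by (auto simp: abs_mult less_imp_le cf_mu_nonneg intro!: mult_left_mono mult_left_le_one_le)
  qed (use B in simp)
  also have "\<dots> = cf (dv [i] cumu * (mu * mu * J)) m"
    by (simp add: dv_mu mult.assoc)
  also have "\<dots> \<le> cf (dv [i] cumu * (cst (2 ^ size m) * mu)) m"
    unfolding cf_mult[of "dv [i] cumu"]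
  proof (intro sum_mono mult_left_mono dv_cumu_nonneg)
    fix a assume "a \<in> submsets m"
    have b: "m - a \<subseteq># m" by simp
    have "cf (mu * mu * J) (m - a) \<le> 2 ^ size (m - a) * cf mu (m - a)"
      unfolding J_def by (rule mu_mu_mexp_bound[OF assms(1)]) (use sub[OF b] s in auto)
    also have "\<dots> \<le> 2 ^ size m * cf mu (m - a)"
      using sub[OF b] by (intro mult_right_mono cf_mu_nonneg power_increasing) auto
    finally show "cf (mu * mu * J) (m - a) \<le> cf (cst (2 ^ size m) * mu) (m - a)" by simp
  qed
  also have "\<dots> = 2 ^ size m * cf (dv [i] mu) m"
    by (simp add: dv_mu mult.left_commute[of _ "cst _"])
  finally show ?thesis .
qed

subsection \<open>Gaussian integrals\<close>

lemma prob_space_std_gauss [simp]: "prob_space std_gauss"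
  unfolding std_gauss_def by (rule prob_space_normal_density) simp

lemma sets_std_gauss [simp, measurable_cong]: "sets std_gauss = sets borel"
  and space_std_gauss [simp]: "space std_gauss = UNIV"
  by (simp_all add: std_gauss_def)

interpretation std_gauss: prob_space std_gauss by simp

interpretation std_gauss_prod: product_sigma_finite "\<lambda>_. std_gauss" by standard

lemma gmom_even: "gmom (2 * k) = fact (2 * k) / (2 ^ k * fact k)"
proof (induction k)
  case (Suc k)
  have "fact (2 * Suc k) = (2 * (real k + 1)) * ((2 * real k + 1) * fact (2 * k))"
    by (simp add: algebra_simps)
  moreover have "2 ^ Suc k * fact (Suc k) = (2 * (real k + 1)) * (2 ^ k * fact k)"
    by (simp add: algebra_simps)
  moreover have "gmom (2 * Suc k) = (2 * real k + 1) * gmom (2 * k)" by simp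
  moreover have "2 * (real k + 1) \<noteq> 0" by (simp add: add_nonneg_eq_0_iff)
  ultimately show ?case unfolding Suc by (simp only: mult_divide_mult_cancel_left times_divide_eq_right not_False_eq_True)
qed simp

lemma normal_moment:
  assumes "0 < r"
  shows "has_bochner_integral lborel (\<lambda>x. normal_density 0 r x * x ^ k) (gmom k * r ^ k)"
proof (cases "even k")
  case True
  then obtain j where k: "k = 2 * j" by (auto elim: evenE)
  have "fact (2 * j) / ((2 / r\<^sup>2) ^ j * fact j) = gmom k * r ^ k"
    unfolding k gmom_even power_mult power_divide using assms by simp
  with normal_moment_even[OF assms, of 0 j] show ?thesis by (simp add: k)
next
  case False
  then obtain j where k: "k = 2 * j + 1" by (auto elim: oddE)
  show ?thesis using normal_moment_odd[OF assms, of 0 j] False by (simp add: k gmom_odd)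
qed

text \<open>The damping turns the standard normal density into \<open>r t\<close> times the normal
  density of standard deviation \<open>r t\<close>.\<close>

lemma gauss_damped_moment:
  defines "r \<equiv> \<lambda>t. 1 / sqrt (1 + t\<^sup>2)"
  shows "has_bochner_integral std_gauss (\<lambda>x. x ^ k * exp (- t\<^sup>2 * x\<^sup>2 / 2)) (gmom k * r t ^ Suc k)"
proof -
  have pos: "0 < 1 + t\<^sup>2" by (simp add: add_pos_nonneg)
  have r: "0 < r t" "(r t)\<^sup>2 = 1 / (1 + t\<^sup>2)" using pos by (simp_all add: r_def power_divide)
  have "std_normal_density x * (x ^ k * exp (- t\<^sup>2 * x\<^sup>2 / 2)) = r t * (normal_density 0 (r t) x * x ^ k)" for x
  proof -
    have "exp (- x\<^sup>2 / 2) * exp (- t\<^sup>2 * x\<^sup>2 / 2) = exp (- x\<^sup>2 / (2 * (r t)\<^sup>2))"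
      unfolding exp_add[symmetric] r(2) using pos by (simp add: field_simps)
    moreover have "1 / sqrt (2 * pi) = r t * (1 / sqrt (2 * pi * (r t)\<^sup>2))"
      using r(1) by (simp add: real_sqrt_mult)
    ultimately show ?thesis
      unfolding std_normal_density_def normal_density_def by (simp add: mult_ac)
  qed
  then have "(\<lambda>x. std_normal_density x *\<^sub>R (x ^ k * exp (- t\<^sup>2 * x\<^sup>2 / 2)))
      = (\<lambda>x. r t * (normal_density 0 (r t) x * x ^ k))"
    by (simp only: real_scaleR_def)
  then have "has_bochner_integral lborel (\<lambda>x. std_normal_density x *\<^sub>R (x ^ k * exp (- t\<^sup>2 * x\<^sup>2 / 2)))
      (r t * (gmom k * r t ^ k))"
    using has_bochner_integral_mult_right[OF normal_moment[OF r(1), of k], of "r t"] by (simp only: refl if_True)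
  then show ?thesis
    unfolding std_gauss_def
    by (intro has_bochner_integral_density) (auto simp: normal_density_nonneg mult_ac)
qed

lemma gauss_moment: "has_bochner_integral std_gauss (\<lambda>x. x ^ k) (gmom k)"
  using gauss_damped_moment[of k 0] by simp

subsection \<open>Moments of the uniform distribution on the sphere\<close>

abbreviation gauss_vec :: "nat \<Rightarrow> (nat \<Rightarrow> real) measure" where
  "gauss_vec n \<equiv> PiM {..<n} (\<lambda>_. std_gauss)"

lemma borel_measurable_vnorm [measurable]: "vnorm n \<in> borel_measurable (gauss_vec n)"
  unfolding vnorm_def by measurable

lemma borel_measurable_sphere_vec [measurable]: "(\<lambda>g. sphere_vec n g i) \<in> borel_measurable (gauss_vec n)"
  unfolding sphere_vec_def by (cases "i < n") simp_all

lemma vnorm_sq: "(vnorm n g)\<^sup>2 = (\<Sum>i<n. (g i)\<^sup>2)"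
  by (simp add: vnorm_def sum_nonneg)

lemma abs_le_vnorm: "i < n \<Longrightarrow> \<bar>g i\<bar> \<le> vnorm n g"
  unfolding vnorm_def
  by (rule real_le_rsqrt) (simp add: member_le_sum[where f="\<lambda>i. (g i)\<^sup>2"])

lemma vnorm_nonneg: "0 \<le> vnorm n g"
  by (simp add: vnorm_def sum_nonneg)

text \<open>True at every point: where \<open>vnorm n g = 0\<close> the quotient is 0 by
  convention.\<close>

lemma abs_sphere_vec_le: "\<bar>sphere_vec n g i\<bar> \<le> sqrt (real n)"
proof (cases "i < n")
  case True
  have "\<bar>g i\<bar> / vnorm n g \<le> 1"
    using abs_le_vnorm[OF True, of g] vnorm_nonneg[of n g]
    by (cases "vnorm n g = 0") (auto simp: divide_le_eq_1)
  then have "sqrt (real n) * (\<bar>g i\<bar> / vnorm n g) \<le> sqrt (real n) * 1"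
    by (intro mult_left_mono) auto
  then show ?thesis
    using True vnorm_nonneg[of n g] by (simp add: sphere_vec_def abs_mult)
qed (simp add: sphere_vec_def)

lemma AE_vnorm_pos:
  assumes "0 < n"
  shows "AE g in gauss_vec n. 0 < vnorm n g"
proof -
  have "AE x in std_gauss. x \<noteq> (0::real)"
    unfolding std_gauss_def
    by (subst AE_density) (auto intro: AE_mp[OF AE_lborel_singleton[of 0]])
  then have "AE g in gauss_vec n. g 0 \<noteq> 0"
    by (intro AE_PiM_component) (use assms in auto)
  then show ?thesis
  proof eventually_elim
    fix g :: "nat \<Rightarrow> real" assume "g 0 \<noteq> 0"
    with abs_le_vnorm[OF assms, of g] show "0 < vnorm n g" by linarith
  qed
qed

lemma prod_mset_eq_prod:
  fixes x :: "'a \<Rightarrow> 'b::comm_monoid_mult"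
  assumes "finite A" "set_mset M \<subseteq> A"
  shows "(\<Prod>c\<in>#M. x c) = (\<Prod>c\<in>A. x c ^ count M c)"
  using assms(2)
proof (induction M)
  case (add c M)
  have "(\<Prod>d\<in>A. x d ^ count (add_mset c M) d) = (\<Prod>d\<in>A. (if d = c then x d else 1) * x d ^ count M d)"
    by (rule prod.cong) auto
  also have "\<dots> = x c * (\<Prod>d\<in>A. x d ^ count M d)"
    using add.prems assms(1) by (simp add: prod.distrib)
  finally show ?case using add by simp
qed simp

lemma integral_power_exp:
  fixes k :: nat
  assumes "0 < a"
  defines "c \<equiv> sqrt (2 * pi) * (\<integral>y. std_normal_density y * \<bar>y\<bar> ^ k \<partial>lborel)"
  shows "has_bochner_integral lborel (\<lambda>t. \<bar>t\<bar> ^ k * exp (- t\<^sup>2 * a\<^sup>2 / 2)) (c / a ^ Suc k)"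
proof -
  let ?f = "\<lambda>y. std_normal_density y * \<bar>y\<bar> ^ k"
  have "has_bochner_integral lborel ?f (c / sqrt (2 * pi))"
    using integrable_std_normal_moment_abs[of k] by (simp add: c_def has_bochner_integral_integrable)
  then have "has_bochner_integral lborel (\<lambda>t. ?f (0 + a * t)) ((c / sqrt (2 * pi)) /\<^sub>R \<bar>a\<bar>)"
    using assms by (subst (asm) lborel_has_bochner_integral_real_affine_iff[of a _ _ 0]) auto
  from has_bochner_integral_mult_right[OF this, of "sqrt (2 * pi) / a ^ k"]
  have "has_bochner_integral lborel (\<lambda>t. sqrt (2 * pi) / a ^ k * ?f (a * t)) (c / a ^ Suc k)"
    using assms by (simp add: field_simps)
  moreover have "sqrt (2 * pi) / a ^ k * ?f (a * t) = \<bar>t\<bar> ^ k * exp (- t\<^sup>2 * a\<^sup>2 / 2)" for t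
    using assms by (simp add: std_normal_density_def abs_mult power_mult_distrib mult_ac)
  ultimately show ?thesis by simp
qed

lemma std_normal_abs_moment_pos: "0 < (\<integral>y. std_normal_density y * \<bar>y\<bar> ^ k \<partial>lborel)"
proof (cases "even k")
  case True
  then obtain j where "k = 2 * j" by (auto elim: evenE)
  then show ?thesis using integral_std_normal_moment_even[of j] by (simp add: power_even_abs)
next
  case False
  then obtain j where "k = 2 * j + 1" by (auto elim: oddE)
  then show ?thesis using integral_std_normal_moment_abs_odd[of j] by simp
qed

abbreviation sphere_mom :: "nat \<Rightarrow> nat multiset \<Rightarrow> real" where
  "sphere_mom n M \<equiv> \<integral>g. (\<Prod>c\<in>#M. sphere_vec n g c) \<partial>gauss_vec n"

lemma prod_sphere_vec:
  assumes "set_mset M \<subseteq> {..<n}"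
  shows "(\<Prod>c\<in>#M. sphere_vec n g c) = sqrt (real n) ^ size M * (\<Prod>c<n. g c ^ count M c) / vnorm n g ^ size M"
proof -
  have "(\<Prod>c\<in>#M. sphere_vec n g c) = (\<Prod>c\<in>#M. sqrt (real n) * g c / vnorm n g)"
    by (intro arg_cong[of _ _ prod_mset] image_mset_cong) (use assms in \<open>auto simp: sphere_vec_def\<close>)
  also have "\<dots> = sqrt (real n) ^ size M * (\<Prod>c\<in>#M. g c) / vnorm n g ^ size M"
    by (induction M) auto
  also have "(\<Prod>c\<in>#M. g c) = (\<Prod>c<n. g c ^ count M c)"
    by (rule prod_mset_eq_prod) (use assms in auto)
  finally show ?thesis .
qed

lemma abs_prod_mset_sphere_vec: "\<bar>\<Prod>c\<in>#M. sphere_vec n g c\<bar> \<le> sqrt (real n) ^ size M"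
  by (induction M) (auto simp: abs_mult intro!: mult_mono abs_sphere_vec_le)

lemma integrable_sphere: "integrable (gauss_vec n) (\<lambda>g. \<Prod>c\<in>#M. sphere_vec n g c)"
proof -
  interpret prob_space "gauss_vec n" by (rule prob_space_PiM) simp
  have "(\<lambda>g. \<Prod>c\<in>#M. sphere_vec n g c) \<in> borel_measurable (gauss_vec n)"
    by (induction M) auto
  then show ?thesis
    by (intro integrable_const_bound[where B="sqrt (real n) ^ size M"])
       (auto intro!: AE_I2 simp: abs_prod_mset_sphere_vec)
qed

text \<open>Writing the power of the norm in the denominator as an integral of Gaussian factors
  reduces the moment to a product of one-dimensional integrals.\<close>

lemma sphere_mom_proportional:
  assumes "0 < n"
  shows "\<exists>C. \<forall>M. set_mset M \<subseteq> {..<n} \<longrightarrow> size M = Suc k \<longrightarrow> sphere_mom n M = C * gm M"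
proof -
  define c where "c = sqrt (2 * pi) * (\<integral>y. std_normal_density y * \<bar>y\<bar> ^ k \<partial>lborel)"
  have c: "0 < c" using std_normal_abs_moment_pos[of k] by (simp add: c_def)
  define r where "r = (\<lambda>t::real. 1 / sqrt (1 + t\<^sup>2))"
  define C where "C = sqrt (real n) ^ Suc k / c * (\<integral>t. \<bar>t\<bar> ^ k * r t ^ (Suc k + n) \<partial>lborel)"
  have "sphere_mom n M = C * gm M" if M: "set_mset M \<subseteq> {..<n}" and size: "size M = Suc k" for M
  proof -
    interpret P: prob_space "gauss_vec n" by (rule prob_space_PiM) simp
    interpret pair_sigma_finite "gauss_vec n" "lborel :: real measure" ..
    define mon where "mon = (\<lambda>g::nat \<Rightarrow> real. \<Prod>c<n. g c ^ count M c)"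
    define f where "f = (\<lambda>g t. mon g * (\<bar>t\<bar> ^ k * exp (- t\<^sup>2 * (vnorm n g)\<^sup>2 / 2)))"
    have mon[measurable]: "mon \<in> borel_measurable (gauss_vec n)" unfolding mon_def by measurable
    have int: "has_bochner_integral lborel (\<lambda>t. f g t) (mon g * (c / vnorm n g ^ Suc k))"
      and intn: "has_bochner_integral lborel (\<lambda>t. norm (f g t)) (\<bar>mon g\<bar> * (c / vnorm n g ^ Suc k))"
      if "0 < vnorm n g" for g
      using has_bochner_integral_mult_right[OF integral_power_exp[OF that, of k]]
      unfolding f_def c_def by (auto simp: abs_mult)
    have sph: "(\<Prod>c\<in>#M. sphere_vec n g c) = sqrt (real n) ^ Suc k * mon g / vnorm n g ^ Suc k" for g
      using prod_sphere_vec[OF M] by (simp add: mon_def size)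
    have meas[measurable]: "case_prod f \<in> borel_measurable (gauss_vec n \<Otimes>\<^sub>M lborel)"
      unfolding f_def by measurable
    \<comment> \<open>Needed for Fubini: integrating the absolute value over \<open>t\<close> gives,
      up to a constant, a product of entries of \<open>sphere_vec\<close>, which is bounded.\<close>
    have bound: "\<bar>mon g\<bar> * (c / vnorm n g ^ Suc k) \<le> c" if "0 < vnorm n g" for g
    proof -
      have s: "0 < sqrt (real n) ^ Suc k" using assms by simp
      have "sqrt (real n) ^ Suc k * (\<bar>mon g\<bar> / vnorm n g ^ Suc k) \<le> sqrt (real n) ^ Suc k * 1"
        using abs_prod_mset_sphere_vec[of n g M] that unfolding sph size
        by (simp add: abs_mult abs_divide del: power_Suc)
      then have "\<bar>mon g\<bar> / vnorm n g ^ Suc k \<le> 1" using s by (simp only: mult_le_cancel_left_pos)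
      then have "c * (\<bar>mon g\<bar> / vnorm n g ^ Suc k) \<le> c * 1" using c by (intro mult_left_mono) auto
      then show ?thesis by (simp add: mult_ac)
    qed
    have "integrable (gauss_vec n \<Otimes>\<^sub>M lborel) (case_prod f)"
    proof (rule Fubini_integrable[OF meas])
      show "AE g in gauss_vec n. integrable lborel (\<lambda>t. case_prod f (g, t))"
        using AE_vnorm_pos[OF assms] by eventually_elim (use int in \<open>auto dest: integrable.intros\<close>)
      show "integrable (gauss_vec n) (\<lambda>g. \<integral>t. norm (case_prod f (g, t)) \<partial>lborel)"
      proof (rule P.integrable_const_bound[where B=c])
        show "AE g in gauss_vec n. norm (\<integral>t. norm (case_prod f (g, t)) \<partial>lborel) \<le> c"
          using AE_vnorm_pos[OF assms]
        proof eventually_elim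
          fix g assume g: "0 < vnorm n g"
          then have "(\<integral>t. norm (case_prod f (g, t)) \<partial>lborel) = \<bar>mon g\<bar> * (c / vnorm n g ^ Suc k)"
            using has_bochner_integral_integral_eq[OF intn[OF g]] by simp
          then show "norm (\<integral>t. norm (case_prod f (g, t)) \<partial>lborel) \<le> c"
            using bound[OF g] g c by simp
        qed
      qed measurable
    qed
    note fub = Fubini_integral[OF this]
    \<comment> \<open>For fixed \<open>t\<close> the exponential of the squared norm factors over
      the coordinates, and the result depends on \<open>M\<close> only through \<open>gm M\<close>
      and the size.\<close>
    have ft: "(\<integral>g. f g t \<partial>gauss_vec n) = gm M * (\<bar>t\<bar> ^ k * r t ^ (Suc k + n))" for t
    proof -
      have "f g t = \<bar>t\<bar> ^ k * (\<Prod>c<n. g c ^ count M c * exp (- t\<^sup>2 * (g c)\<^sup>2 / 2))" for g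
        by (simp add: f_def mon_def vnorm_sq prod.distrib sum_distrib_left sum_divide_distrib
            flip: exp_sum)
      moreover have "(\<integral>g. (\<Prod>c<n. g c ^ count M c * exp (- t\<^sup>2 * (g c)\<^sup>2 / 2)) \<partial>gauss_vec n)
        = (\<Prod>c<n. gmom (count M c) * r t ^ Suc (count M c))"
        unfolding r_def has_bochner_integral_integral_eq[OF gauss_damped_moment, symmetric]
        by (intro std_gauss_prod.product_integral_prod integrable.intros[OF gauss_damped_moment]) simp
      moreover have "\<dots> = gm M * r t ^ (Suc k + n)"
      proof -
        have "(\<Sum>c<n. Suc (count M c)) = size M + n"
          unfolding size_multiset_overloaded_eq
          using M by (subst sum.mono_neutral_left[of "{..<n}" "set_mset M"]) (auto simp: not_in_iff sum_Suc)
        then show ?thesis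
          unfolding prod.distrib power_sum[symmetric] gm_superset[OF finite_lessThan M] size by simp
      qed
      ultimately show ?thesis by simp
    qed
    from fub
    have "(\<integral>g. (\<integral>t. f g t \<partial>lborel) \<partial>gauss_vec n) = (\<integral>t. (\<integral>g. f g t \<partial>gauss_vec n) \<partial>lborel)" by simp
    also have "\<dots> = (\<integral>t. gm M * (\<bar>t\<bar> ^ k * r t ^ (Suc k + n)) \<partial>lborel)" by (simp only: ft)
    also have "(\<integral>t. gm M * (\<bar>t\<bar> ^ k * r t ^ (Suc k + n)) \<partial>lborel)
      = gm M * (\<integral>t. \<bar>t\<bar> ^ k * r t ^ (Suc k + n) \<partial>lborel)" by simp
    finally have "(\<integral>g. (\<integral>t. f g t \<partial>lborel) \<partial>gauss_vec n) = c * (C / sqrt (real n) ^ Suc k * gm M)"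
      using c assms by (simp add: C_def)
    also have "(\<integral>g. (\<integral>t. f g t \<partial>lborel) \<partial>gauss_vec n)
      = (\<integral>g. c / sqrt (real n) ^ Suc k * (\<Prod>c\<in>#M. sphere_vec n g c) \<partial>gauss_vec n)"
    proof (rule integral_cong_AE)
      show "AE g in gauss_vec n. (\<integral>t. f g t \<partial>lborel) = c / sqrt (real n) ^ Suc k * (\<Prod>c\<in>#M. sphere_vec n g c)"
        using AE_vnorm_pos[OF assms]
      proof eventually_elim
        fix g assume "0 < vnorm n g"
        from has_bochner_integral_integral_eq[OF int[OF this]]
        show "(\<integral>t. f g t \<partial>lborel) = c / sqrt (real n) ^ Suc k * (\<Prod>c\<in>#M. sphere_vec n g c)"
          using assms unfolding sph by (simp del: power_Suc)
      qed
    qed (use integrable_sphere in auto)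
    also have "\<dots> = c / sqrt (real n) ^ Suc k * sphere_mom n M" by simp
    finally show ?thesis using c assms by (simp add: field_simps)
  qed
  then show ?thesis by blast
qed

lemma sphere_vec_norm:
  assumes "0 < vnorm n g"
  shows "(\<Sum>i<n. (sphere_vec n g i)\<^sup>2) = real n"
proof -
  have "(\<Sum>i<n. (sphere_vec n g i)\<^sup>2) = (\<Sum>i<n. real n / (vnorm n g)\<^sup>2 * (g i)\<^sup>2)"
    by (rule sum.cong) (auto simp: sphere_vec_def power_mult_distrib power_divide)
  also have "\<dots> = real n / (vnorm n g)\<^sup>2 * (vnorm n g)\<^sup>2"
    unfolding vnorm_sq by (simp add: sum_distrib_left)
  finally show ?thesis using assms by simp
qed

lemma gm_add_add: "gm (add_mset c (add_mset c M)) = (real (count M c) + 1) * gm M"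
  by (simp add: gm_add)

text \<open>The constant in each even degree comes from summing over a repeated index: on the sphere
  the squares add up to \<open>n\<close>, so \<open>C (2 x + 2) * (2 x + n) = n * C (2 x)\<close>,
  which is the recursion of \<open>wt\<close>. In odd degree both sides vanish.\<close>

lemma sphere_mom_eq:
  assumes "0 < n" "set_mset M \<subseteq> {..<n}"
  shows "sphere_mom n M = wt (real n / 2) (size M div 2) * gm M"
proof -
  interpret P: prob_space "gauss_vec n" by (rule prob_space_PiM) simp
  have "\<exists>C. \<forall>M. set_mset M \<subseteq> {..<n} \<longrightarrow> size M = k \<longrightarrow> sphere_mom n M = C * gm M" for k
  proof (cases k)
    case 0
    have "sphere_mom n {#} = 1 * gm {#}" by (simp add: P.prob_space)
    then show ?thesis unfolding 0 by (intro exI[of _ 1]) auto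
  qed (use sphere_mom_proportional[OF assms(1)] in simp)
  then obtain C where C: "\<And>k M. set_mset M \<subseteq> {..<n} \<Longrightarrow> size M = k \<Longrightarrow> sphere_mom n M = C k * gm M"
    by metis
  have rec: "C (2 * x) = wt (real n / 2) x" for x
  proof (induction x)
    case 0
    show ?case using C[of "{#}" 0] by (simp add: P.prob_space)
  next
    case (Suc x)
    \<comment> \<open>A test multiset; what matters is its size and that its Gaussian moment is not
      zero, so that it can be cancelled.\<close>
    define M where "M = replicate_mset (2 * x) (0::nat)"
    have M: "set_mset M \<subseteq> {..<n}" "size M = 2 * x" using assms by (auto simp: M_def)
    have gmM: "gm M \<noteq> 0" by (simp add: M_def gm_def gmom_even)
    have "(\<Sum>i<n. sphere_mom n (add_mset i (add_mset i M)))
      = (\<integral>g. (\<Sum>i<n. \<Prod>c\<in>#add_mset i (add_mset i M). sphere_vec n g c) \<partial>gauss_vec n)"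
      by (rule Bochner_Integration.integral_sum[symmetric]) (rule integrable_sphere)
    also have "\<dots> = (\<integral>g. real n * (\<Prod>c\<in>#M. sphere_vec n g c) \<partial>gauss_vec n)"
    proof (rule integral_cong_AE)
      show "AE g in gauss_vec n. (\<Sum>i<n. \<Prod>c\<in>#add_mset i (add_mset i M). sphere_vec n g c)
        = real n * (\<Prod>c\<in>#M. sphere_vec n g c)"
        using AE_vnorm_pos[OF assms(1)]
      proof eventually_elim
        fix g assume "0 < vnorm n g"
        have "(\<Sum>i<n. \<Prod>c\<in>#add_mset i (add_mset i M). sphere_vec n g c)
          = (\<Sum>i<n. (sphere_vec n g i)\<^sup>2) * (\<Prod>c\<in>#M. sphere_vec n g c)"
          by (simp add: sum_distrib_right power2_eq_square mult.assoc)
        then show "(\<Sum>i<n. \<Prod>c\<in>#add_mset i (add_mset i M). sphere_vec n g c)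
          = real n * (\<Prod>c\<in>#M. sphere_vec n g c)"
          using sphere_vec_norm[OF \<open>0 < vnorm n g\<close>] by simp
      qed
    qed (use integrable_sphere in \<open>auto intro!: borel_measurable_sum borel_measurable_integrable\<close>)
    also have "\<dots> = real n * (C (2 * x) * gm M)" using C[OF M] by simp
    also have "(\<Sum>i<n. sphere_mom n (add_mset i (add_mset i M)))
      = (\<Sum>i<n. C (2 * Suc x) * ((real (count M i) + 1) * gm M))"
      by (intro sum.cong refl) (subst C[of _ "2 * Suc x"], use M in \<open>auto simp: gm_add_add\<close>)
    also have "\<dots> = C (2 * Suc x) * ((\<Sum>i<n. real (count M i) + 1) * gm M)"
      by (simp add: sum_distrib_left sum_distrib_right)
    also have "(\<Sum>i<n. real (count M i) + 1) = (\<Sum>i<n. (if i = 0 then real (2 * x) else 0) + 1)"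
      by (intro sum.cong) (auto simp: M_def)
    also have "\<dots> = real (2 * x) + real n"
      using assms(1) by (simp add: sum.distrib)
    finally have "C (2 * Suc x) * (real (2 * x) + real n) = real n * C (2 * x)"
      using gmM by simp
    moreover have "0 < real (2 * x) + real n" using assms(1) by simp
    ultimately have "C (2 * Suc x) = real n * C (2 * x) / (real (2 * x) + real n)"
      by (simp add: field_simps)
    also have "\<dots> = C (2 * x) / (1 + real x / (real n / 2))"
      using assms(1) by (simp add: field_simps)
    finally show ?case by (simp add: Suc wt_Suc)
  qed
  show ?thesis
  proof (cases "even (size M)")
    case True
    then show ?thesis using C[OF assms(2) refl] rec[of "size M div 2"] by simp
  next
    case False
    then show ?thesis using C[OF assms(2) refl] by (simp add: gm_odd)
  qed
qed

subsection \<open>Hermite polynomials\<close>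

text \<open>Probabilists' Hermite polynomials divided by the factorial of the degree.\<close>

fun hp :: "nat \<Rightarrow> real poly" where
  "hp 0 = 1"
| "hp (Suc 0) = [:0, 1:]"
| "hp (Suc (Suc k)) = smult (1 / (real k + 2)) (pCons 0 (hp (Suc k)) - hp k)"

lemma hp_rec: "smult (real k + 1) (hp (Suc k)) = pCons 0 (hp k) - (if k = 0 then 0 else hp (k - 1))"
proof (cases k)
  case 0
  then show ?thesis by (simp add: one_pCons)
next
  case (Suc j)
  have "real (Suc j) + 1 = real j + 2" "real j + 2 \<noteq> 0" by auto
  then show ?thesis by (simp only: Suc hp.simps smult_smult) simp
qed

lemma pderiv_hp: "pderiv (hp (Suc k)) = hp k"
proof (induction k rule: less_induct)
  case (less k)
  show ?case
  proof (cases k)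
    case 0
    then show ?thesis by (simp add: pderiv_pCons one_pCons)
  next
    case (Suc j)
    have nz: "real j + 2 \<noteq> 0" by linarith
    have 1: "pderiv (hp (Suc j)) = hp j" using less[of j] Suc by simp
    have 2: "pderiv (hp j) = (if j = 0 then 0 else hp (j - 1))"
      using less[of "j - 1"] Suc by (cases j) auto
    have "pderiv (hp (Suc k))
      = smult (1 / (real j + 2)) (hp (Suc j) + (pCons 0 (hp j) - (if j = 0 then 0 else hp (j - 1))))"
      by (simp add: Suc pderiv_smult pderiv_diff pderiv_pCons 1 2 add_diff_eq)
    also have "pCons 0 (hp j) - (if j = 0 then 0 else hp (j - 1)) = smult (real j + 1) (hp (Suc j))"
      by (rule hp_rec[symmetric])
    also have "hp (Suc j) + smult (real j + 1) (hp (Suc j)) = smult (real j + 2) (hp (Suc j))"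
    proof -
      have "real j + 2 = 1 + (real j + 1)" by simp
      then show ?thesis by (simp only: smult_add_left smult_1_left)
    qed
    finally show ?thesis using nz by (simp add: Suc)
  qed
qed

section \<open>Orthogonality of the Hermite polynomials\<close>

definition gint :: "real poly \<Rightarrow> real" where
  "gint p = (\<integral>x. poly p x \<partial>std_gauss)"

lemma integrable_power_gauss: "integrable std_gauss (\<lambda>x::real. x ^ k)"
  by (rule integrable.intros[OF gauss_moment])

lemma integrable_poly_gauss: "integrable std_gauss (poly p)"
proof -
  have "poly p = (\<lambda>x. \<Sum>i\<le>degree p. coeff p i * x ^ i)" by (rule ext) (rule poly_altdef)
  then show ?thesis by (simp add: integrable_power_gauss)
qed

lemma gint_add: "gint (p + q) = gint p + gint q"
  and gint_diff: "gint (p - q) = gint p - gint q"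
  and gint_smult: "gint (smult c p) = c * gint p"
  by (simp_all add: gint_def integrable_poly_gauss)

lemma gint_sum: "gint (\<Sum>i\<in>A. f i) = (\<Sum>i\<in>A. gint (f i))"
  by (induction A rule: infinite_finite_induct) (auto simp: gint_add, simp_all add: gint_def)

lemma pderiv_sum: "pderiv (\<Sum>i\<in>A. f i) = (\<Sum>i\<in>A. pderiv (f i))"
  by (induction A rule: infinite_finite_induct) (auto simp: pderiv_add)

lemma gint_monom: "gint (monom c k) = c * gmom k"
  using has_bochner_integral_integral_eq[OF gauss_moment[of k]] by (simp add: gint_def poly_monom)

text \<open>Stein's identity; by linearity it reduces to monomials, where it is the recursion
  \<open>gmom_Suc\<close>.\<close>

lemma gint_stein: "gint (pCons 0 p) = gint (pderiv p)"
proof -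
  have p: "p = (\<Sum>i\<le>degree p. monom (coeff p i) i)" by (rule poly_as_sum_of_monoms[symmetric])
  have "gint (pCons 0 p) = gint (monom 1 1 * p)" by (simp add: monom_altdef)
  also have "\<dots> = (\<Sum>i\<le>degree p. gint (monom (coeff p i) (Suc i)))"
    by (subst p) (simp add: sum_distrib_left gint_sum mult_monom)
  also have "\<dots> = (\<Sum>i\<le>degree p. gint (pderiv (monom (coeff p i) i)))"
    by (rule sum.cong) (auto simp: gint_monom pderiv_monom gmom_Suc)
  also have "\<dots> = gint (pderiv p)"
    by (subst (3) p) (simp add: pderiv_sum gint_sum)
  finally show ?thesis .
qed

text \<open>By Stein's identity, raising the Hermite degree is adjoint to differentiation. With
  \<open>pderiv_hp\<close> this lowers both degrees in \<open>gint_hp\<close> together.\<close>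

lemma gint_hp_Suc: "(real k + 1) * gint (hp (Suc k) * q) = gint (hp k * pderiv q)"
proof -
  have d: "pderiv (hp k) = (if k = 0 then 0 else hp (k - 1))" using pderiv_hp[of "k - 1"] by (cases k) auto
  have "(real k + 1) * gint (hp (Suc k) * q) = gint (smult (real k + 1) (hp (Suc k)) * q)"
    by (simp add: gint_smult)
  also have "\<dots> = gint (pCons 0 (hp k * q)) - gint (pderiv (hp k) * q)"
    unfolding hp_rec d by (simp add: left_diff_distrib gint_diff)
  also have "\<dots> = gint (hp k * pderiv q)"
    unfolding gint_stein pderiv_mult gint_add by (simp add: mult.commute)
  finally show ?thesis .
qed

lemma gint_hp: "gint (hp j * hp k) = (if j = k then 1 / fact k else 0)"
proof (induction j arbitrary: k)
  case 0
  show ?case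
  proof (cases k)
    case 0
    then show ?thesis using gint_monom[of 1 0] by (simp add: monom_0 one_pCons)
  next
    case (Suc i)
    have "(real i + 1) * gint (hp (Suc i) * hp 0) = gint (hp i * pderiv (hp 0))" by (rule gint_hp_Suc)
    moreover have "real i + 1 \<noteq> 0" by linarith
    ultimately show ?thesis using Suc by (simp add: gint_def)
  qed
next
  case (Suc j)
  have nz: "real j + 1 \<noteq> 0" by linarith
  have "(real j + 1) * gint (hp (Suc j) * hp k) = gint (hp j * pderiv (hp k))" by (rule gint_hp_Suc)
  then have eq: "gint (hp (Suc j) * hp k) = gint (hp j * pderiv (hp k)) / (real j + 1)"
    using nz by (simp add: field_simps)
  show ?case
  proof (cases k)
    case 0
    then show ?thesis unfolding eq by (simp add: gint_def)
  next
    case (Suc i)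
    then show ?thesis
      using eq unfolding \<open>k = Suc i\<close> pderiv_hp Suc.IH by (simp add: add.commute)
  qed
qed

section \<open>Multivariate Hermite polynomials and their shift formula\<close>

definition hm :: "'a multiset \<Rightarrow> ('a \<Rightarrow> real) \<Rightarrow> real" where
  "hm m z = (\<Prod>x\<in>set_mset m. poly (hp (count m x)) (z x))"

lemma hm_superset:
  assumes "finite A" "set_mset m \<subseteq> A"
  shows "hm m z = (\<Prod>x\<in>A. poly (hp (count m x)) (z x))"
  unfolding hm_def by (rule prod.mono_neutral_left) (use assms in \<open>auto simp: not_in_iff\<close>)

lemma hm_empty [simp]: "hm {#} z = 1"
  by (simp add: hm_def)

lemma hm_add: "(real (count m x) + 1) * hm (add_mset x m) z
  = z x * hm m z - (if x \<in># m then hm (m - {#x#}) z else 0)"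
proof -
  let ?A = "insert x (set_mset m)"
  define R where "R = (\<Prod>y\<in>?A - {x}. poly (hp (count m y)) (z y))"
  have 1: "hm (add_mset x m) z = poly (hp (Suc (count m x))) (z x) * R"
    by (subst hm_superset[of ?A], simp, simp, subst prod.remove[of _ x])
       (auto simp: R_def intro!: prod.cong split: if_splits)
  have 2: "hm m z = poly (hp (count m x)) (z x) * R"
    by (subst hm_superset[of ?A], simp, force, subst prod.remove[of _ x]) (auto simp: R_def)
  have 3: "hm (m - {#x#}) z = poly (hp (count m x - 1)) (z x) * R"
    by (subst hm_superset[of ?A], simp, force dest: in_diffD, subst prod.remove[of _ x])
       (auto simp: R_def intro!: prod.cong split: if_splits)
  have "(real (count m x) + 1) * poly (hp (Suc (count m x))) (z x)
    = poly (smult (real (count m x) + 1) (hp (Suc (count m x)))) (z x)" by simp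
  also have "\<dots> = z x * poly (hp (count m x)) (z x)
      - (if x \<in># m then poly (hp (count m x - 1)) (z x) else 0)"
    unfolding hp_rec by (auto simp: not_in_iff)
  finally have "(real (count m x) + 1) * poly (hp (Suc (count m x))) (z x) * R
    = (z x * poly (hp (count m x)) (z x)
        - (if x \<in># m then poly (hp (count m x - 1)) (z x) else 0)) * R"
    by (simp only:)
  then show ?thesis unfolding 1 2 3 by (cases "x \<in># m") (simp_all add: algebra_simps)
qed

text \<open>Formally the exponential of the sum over \<open>x\<close> of
  \<open>t x * z x - (t x)^2 / 2\<close>, with \<open>t x\<close> the variables of the series;
  \<open>pser y\<close> is the exponential of the sum of \<open>t x * y x\<close>.\<close>

definition hser :: "('a \<Rightarrow> real) \<Rightarrow> 'a mps" where
  "hser z = Mps (\<lambda>m. hm m z)"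

definition pser :: "('a \<Rightarrow> real) \<Rightarrow> 'a mps" where
  "pser y = Mps (\<lambda>m. (\<Prod>x\<in>#m. y x) / mfact m)"

text \<open>Both sides have the logarithmic derivative \<open>z x + y x\<close> minus the variable
  \<open>x\<close>, and constant coefficient 1.\<close>

lemma hser_add: "hser (\<lambda>x. z x + y x) = hser z * pser y"
proof (rule ode_unique[where A="\<lambda>x. cst (z x + y x) - var x"])
  have h: "dv x (hser z) = (cst (z x) - var x) * hser z" for x :: 'a and z
    by (rule mps_eqI) (simp add: cf_dv hser_def hm_add left_diff_distrib cf_var_mult)
  have p: "dv x (pser y) = cst (y x) * pser y" for x :: 'a
  proof (rule mps_eqI)
    fix m
    have "real (count m x) + 1 \<noteq> 0" by linarith
    then show "cf (dv x (pser y)) m = cf (cst (y x) * pser y) m"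
      by (simp add: cf_dv pser_def mfact_add)
  qed
  show "dv x (hser (\<lambda>x. z x + y x)) = (cst (z x + y x) - var x) * hser (\<lambda>x. z x + y x)" for x by (rule h)
  show "dv x (hser z * pser y) = (cst (z x + y x) - var x) * (hser z * pser y)" for x
    by (simp add: dv_mult h p cst_add algebra_simps)
qed (simp add: hser_def, simp add: pser_def)

lemma hm_shift: "hm m (\<lambda>x. z x + y x) = (\<Sum>a\<in>submsets m. hm a z * cf (pser y) (m - a))"
  using arg_cong[OF hser_add[of z y], of "\<lambda>f. cf f m"] by (simp add: cf_mult hser_def)

subsection \<open>Orthogonal expansions\<close>

definition msets :: "'a set \<Rightarrow> nat \<Rightarrow> 'a multiset set" where
  "msets T d = {m. set_mset m \<subseteq> T \<and> size m \<le> d}"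

lemma finite_msets: "finite T \<Longrightarrow> finite (msets T d)"
proof -
  assume T: "finite T"
  have "msets T d \<subseteq> mset ` {xs. set xs \<subseteq> T \<and> length xs \<le> d}"
  proof
    fix m assume m: "m \<in> msets T d"
    obtain xs where "mset xs = m" using ex_mset by blast
    with m show "m \<in> mset ` {xs. set xs \<subseteq> T \<and> length xs \<le> d}"
      by (intro image_eqI[of _ _ xs]) (auto simp: msets_def)
  qed
  then show ?thesis using finite_lists_length_le[OF T] finite_surj by blast
qed

lemma msets_subset: "a \<subseteq># m \<Longrightarrow> m \<in> msets T d \<Longrightarrow> a \<in> msets T d"
  by (auto simp: msets_def dest: mset_subset_eqD size_mset_mono)

lemma hm_integrable_mult:
  assumes "finite T" "a \<in> msets T d" "b \<in> msets T d"
  shows "has_bochner_integral (PiM T (\<lambda>_. std_gauss)) (\<lambda>G. hm a G * hm b G) (if a = b then 1 / mfact a else 0)"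
proof -
  have eq: "hm a G * hm b G = (\<Prod>x\<in>T. poly (hp (count a x) * hp (count b x)) (G x))" for G
    using assms by (simp add: hm_superset[of T] msets_def prod.distrib)
  have "integrable (PiM T (\<lambda>_. std_gauss)) (\<lambda>G. \<Prod>x\<in>T. poly (hp (count a x) * hp (count b x)) (G x))"
    using assms(1) by (intro std_gauss_prod.product_integrable_prod integrable_poly_gauss)
  moreover have "(\<integral>G. (\<Prod>x\<in>T. poly (hp (count a x) * hp (count b x)) (G x)) \<partial>PiM T (\<lambda>_. std_gauss))
    = (\<Prod>x\<in>T. gint (hp (count a x) * hp (count b x)))"
    unfolding gint_def using assms(1)
    by (intro std_gauss_prod.product_integral_prod integrable_poly_gauss)
  moreover have "\<dots> = (if a = b then 1 / mfact a else 0)"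
  proof (cases "a = b")
    case True
    then show ?thesis
      using assms by (simp add: gint_hp mfact_superset[of T] msets_def prod_dividef)
  next
    case False
    then obtain x where x: "count a x \<noteq> count b x" by (meson multiset_eqI)
    then have "x \<in># a \<or> x \<in># b" by (metis not_in_iff)
    then have "x \<in> T" using assms by (auto simp: msets_def)
    with x assms(1) False show ?thesis by (auto simp: gint_hp)
  qed
  ultimately show ?thesis by (simp add: eq has_bochner_integral_iff)
qed

lemma has_bochner_integral_pair_mult:
  fixes r :: "'a \<Rightarrow> real" and q :: "'b \<Rightarrow> real"
  assumes "prob_space M1" "prob_space M2"
    and r: "has_bochner_integral M1 r A" and q: "has_bochner_integral M2 q B"
  shows "has_bochner_integral (M1 \<Otimes>\<^sub>M M2) (\<lambda>w. r (fst w) * q (snd w)) (A * B)"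
proof -
  interpret M1: prob_space M1 by fact
  interpret M2: prob_space M2 by fact
  interpret pair_sigma_finite M1 M2 ..
  have i: "integrable M1 r" "integrable M2 q" and v: "integral\<^sup>L M1 r = A" "integral\<^sup>L M2 q = B"
    using r q by (auto simp: has_bochner_integral_iff)
  note [measurable] = borel_measurable_integrable[OF i(1)] borel_measurable_integrable[OF i(2)]
  have int: "integrable (M1 \<Otimes>\<^sub>M M2) (\<lambda>w. r (fst w) * q (snd w))"
    by (rule Fubini_integrable) (use i in \<open>auto simp: abs_mult\<close>)
  from integral_fst'[OF int] have "integral\<^sup>L (M1 \<Otimes>\<^sub>M M2) (\<lambda>w. r (fst w) * q (snd w)) = A * B"
    by (simp add: v)
  with int show ?thesis by (simp add: has_bochner_integral_iff)
qed

text \<open>Boundedness at every point, not almost everywhere: the entries of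
  \<open>sphere_vec\<close> have it, and it is stable under sums and products, so integrability on
  the signal side is automatic.\<close>

definition bdd_fun :: "'a measure \<Rightarrow> ('a \<Rightarrow> real) \<Rightarrow> bool" where
  "bdd_fun M r \<longleftrightarrow> r \<in> borel_measurable M \<and> (\<exists>B. \<forall>x. \<bar>r x\<bar> \<le> B)"

lemma bdd_fun_const: "bdd_fun M (\<lambda>_. c)"
  by (auto simp: bdd_fun_def)

lemma bdd_fun_mult:
  assumes "bdd_fun M r" "bdd_fun M s"
  shows "bdd_fun M (\<lambda>x. r x * s x)"
proof -
  obtain B C where "\<forall>x. \<bar>r x\<bar> \<le> B" "\<forall>x. \<bar>s x\<bar> \<le> C" using assms by (auto simp: bdd_fun_def)
  then have "\<forall>x. \<bar>r x * s x\<bar> \<le> B * C"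
    unfolding abs_mult by (meson abs_ge_zero mult_mono order_trans)
  then show ?thesis using assms by (auto simp: bdd_fun_def)
qed

lemma bdd_fun_sum:
  assumes "\<And>i. i \<in> I \<Longrightarrow> bdd_fun M (r i)"
  shows "bdd_fun M (\<lambda>x. \<Sum>i\<in>I. r i x)"
  using assms
proof (induction I rule: infinite_finite_induct)
  case (insert i I)
  obtain C where "\<forall>x. \<bar>\<Sum>i\<in>I. r i x\<bar> \<le> C" using insert by (auto simp: bdd_fun_def)
  moreover obtain B where "\<forall>x. \<bar>r i x\<bar> \<le> B" using insert.prems[of i] by (auto simp: bdd_fun_def)
  ultimately have "\<forall>x. \<bar>r i x + (\<Sum>i\<in>I. r i x)\<bar> \<le> B + C"
    by (meson abs_triangle_ineq add_mono order_trans)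
  moreover have "(\<lambda>x. r i x + (\<Sum>i\<in>I. r i x)) \<in> borel_measurable M"
    by (rule borel_measurable_add) (use insert in \<open>auto simp: bdd_fun_def\<close>)
  ultimately show ?case using insert.hyps by (auto simp: bdd_fun_def)
qed (auto simp: bdd_fun_const)

lemma bdd_fun_integrable: "prob_space M \<Longrightarrow> bdd_fun M r \<Longrightarrow> integrable M r"
  unfolding bdd_fun_def
  by (auto intro!: finite_measure.integrable_const_bound[OF prob_space.finite_measure] AE_I2)

definition hexp :: "'b set \<Rightarrow> nat \<Rightarrow> ('b multiset \<Rightarrow> 'a \<Rightarrow> real) \<Rightarrow> 'a \<times> ('b \<Rightarrow> real) \<Rightarrow> real" where
  "hexp T d R w = (\<Sum>a\<in>msets T d. R a (fst w) * hm a (snd w))"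

text \<open>Independence of signal and noise separates the integrals, and orthogonality of the
  \<open>hm a\<close> keeps the diagonal.\<close>

lemma hexp_inner:
  assumes "finite T" "prob_space M"
    and R: "\<And>a. a \<in> msets T d \<Longrightarrow> bdd_fun M (R a)" and S: "\<And>a. a \<in> msets T d \<Longrightarrow> bdd_fun M (S a)"
  shows "has_bochner_integral (M \<Otimes>\<^sub>M PiM T (\<lambda>_. std_gauss)) (\<lambda>w. hexp T d R w * hexp T d S w)
     (\<Sum>a\<in>msets T d. (\<integral>x. R a x * S a x \<partial>M) / mfact a)"
proof -
  let ?G = "PiM T (\<lambda>_. std_gauss)"
  have G: "prob_space ?G" by (rule prob_space_PiM) simp
  have eq: "hexp T d R w * hexp T d S w
    = (\<Sum>a\<in>msets T d. \<Sum>b\<in>msets T d. (R a (fst w) * S b (fst w)) * (hm a (snd w) * hm b (snd w)))" for w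
    by (simp add: hexp_def sum_product mult_ac)
  have "has_bochner_integral (M \<Otimes>\<^sub>M ?G) (\<lambda>w. hexp T d R w * hexp T d S w)
    (\<Sum>a\<in>msets T d. \<Sum>b\<in>msets T d. (\<integral>x. R a x * S b x \<partial>M) * (if a = b then 1 / mfact a else 0))"
    unfolding eq
  proof (intro has_bochner_integral_sum has_bochner_integral_pair_mult assms G)
    fix a b assume ab: "a \<in> msets T d" "b \<in> msets T d"
    then show "has_bochner_integral M (\<lambda>x. R a x * S b x) (\<integral>x. R a x * S b x \<partial>M)"
      by (intro has_bochner_integral_integrable bdd_fun_integrable[OF assms(2)] bdd_fun_mult R S)
    from hm_integrable_mult[OF assms(1) ab]
    show "has_bochner_integral ?G (\<lambda>G. hm a G * hm b G) (if a = b then 1 / mfact a else 0)" .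
  qed
  also have "(\<Sum>a\<in>msets T d. \<Sum>b\<in>msets T d. (\<integral>x. R a x * S b x \<partial>M) * (if a = b then 1 / mfact a else 0))
    = (\<Sum>a\<in>msets T d. (\<integral>x. R a x * S a x \<partial>M) / mfact a)"
    by (intro sum.cong refl) (simp add: if_distrib finite_msets[OF assms(1)] cong: if_cong)
  finally show ?thesis .
qed

section \<open>Polynomials of bounded degree in the Hermite basis\<close>

definition hspan :: "'b set \<Rightarrow> nat \<Rightarrow> (('b \<Rightarrow> real) \<Rightarrow> real) set" where
  "hspan T d = {F. \<exists>c. \<forall>z. F z = (\<Sum>m\<in>msets T d. c m * hm m z)}"

context
  fixes T :: "'b set"
  assumes T: "finite T"
begin

lemma hspan_hm: "m \<in> msets T d \<Longrightarrow> hm m \<in> hspan T d"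
  unfolding hspan_def
  by (auto intro!: exI[of _ "\<lambda>m'. if m' = m then 1 else 0"] simp: finite_msets[OF T] if_distribR if_distrib cong: if_cong)

lemma hspan_scale: "F \<in> hspan T d \<Longrightarrow> (\<lambda>z. c * F z) \<in> hspan T d"
  unfolding hspan_def
proof clarify
  fix e assume "\<forall>z. F z = (\<Sum>m\<in>msets T d. e m * hm m z)"
  then show "\<exists>e. \<forall>z. c * F z = (\<Sum>m\<in>msets T d. e m * hm m z)"
    by (intro exI[of _ "\<lambda>m. c * e m"]) (simp add: sum_distrib_left mult.assoc)
qed

lemma hspan_add: "F \<in> hspan T d \<Longrightarrow> H \<in> hspan T d \<Longrightarrow> (\<lambda>z. F z + H z) \<in> hspan T d"
  unfolding hspan_def
proof clarify
  fix c e assume "\<forall>z. F z = (\<Sum>m\<in>msets T d. c m * hm m z)" "\<forall>z. H z = (\<Sum>m\<in>msets T d. e m * hm m z)"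
  then show "\<exists>c. \<forall>z. F z + H z = (\<Sum>m\<in>msets T d. c m * hm m z)"
    by (intro exI[of _ "\<lambda>m. c m + e m"]) (simp add: distrib_right sum.distrib)
qed

lemma hspan_sum: "(\<And>i. i \<in> I \<Longrightarrow> F i \<in> hspan T d) \<Longrightarrow> (\<lambda>z. \<Sum>i\<in>I. F i z) \<in> hspan T d"
proof (induction I rule: infinite_finite_induct)
  case (insert i I)
  then show ?case by (simp add: hspan_add)
next
  case empty
  then show ?case by (auto simp: hspan_def intro!: exI[of _ "\<lambda>_. 0"])
next
  case (infinite A)
  then show ?case by (auto simp: hspan_def intro!: exI[of _ "\<lambda>_. 0"])
qed

lemma hspan_mono: "F \<in> hspan T d \<Longrightarrow> d \<le> e \<Longrightarrow> F \<in> hspan T e"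
proof -
  assume F: "F \<in> hspan T d" and le: "d \<le> e"
  obtain c where c: "\<And>z. F z = (\<Sum>m\<in>msets T d. c m * hm m z)" using F by (auto simp: hspan_def)
  have "(\<lambda>z. \<Sum>m\<in>msets T d. c m * hm m z) \<in> hspan T e"
    by (intro hspan_sum hspan_scale hspan_hm) (use le in \<open>auto simp: msets_def\<close>)
  then show ?thesis by (simp add: c[abs_def])
qed

lemma hspan_mult_coord:
  assumes "F \<in> hspan T d" "x \<in> T"
  shows "(\<lambda>z. z x * F z) \<in> hspan T (Suc d)"
proof -
  obtain c where c: "\<And>z. F z = (\<Sum>m\<in>msets T d. c m * hm m z)" using assms by (auto simp: hspan_def)
  have "(\<lambda>z. \<Sum>m\<in>msets T d. c m * (z x * hm m z)) \<in> hspan T (Suc d)"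
  proof (intro hspan_sum hspan_scale)
    fix m assume m: "m \<in> msets T d"
    have eq: "z x * hm m z = (real (count m x) + 1) * hm (add_mset x m) z
      + (if x \<in># m then 1 else 0) * hm (m - {#x#}) z" for z
      unfolding hm_add by simp
    have "m - {#x#} \<in> msets T d" by (rule msets_subset[OF diff_subset_eq_self m])
    then have "m - {#x#} \<in> msets T (Suc d)" unfolding msets_def by fastforce
    moreover have "add_mset x m \<in> msets T (Suc d)" using m assms(2) by (auto simp: msets_def)
    ultimately show "(\<lambda>z. z x * hm m z) \<in> hspan T (Suc d)"
      unfolding eq by (intro hspan_add hspan_scale hspan_hm)
  qed
  then show ?thesis by (simp add: c sum_distrib_left mult.left_commute)
qed

text \<open>Every factor of a monomial becomes a linear form, and multiplying by a coordinate raises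
  the Hermite degree by at most one. The shape of \<open>L\<close> is that of the symmetrization in
  \<open>wigner\<close>.\<close>

lemma hspan_poly_linear:
  fixes L :: "('b \<Rightarrow> real) \<Rightarrow> 'c \<Rightarrow> real"
  assumes "finite U" "poly_deg_le U d F"
    and L: "\<And>u z. u \<in> U \<Longrightarrow> L z u = (\<Sum>j\<in>J u. w u * z (e u j))"
    and e: "\<And>u j. u \<in> U \<Longrightarrow> j \<in> J u \<Longrightarrow> e u j \<in> T"
  shows "(\<lambda>z. F (L z)) \<in> hspan T d"
proof -
  obtain c where c: "\<And>Y. F Y = (\<Sum>m\<in>msets U d. c m * (\<Prod>x\<in>#m. Y x))"
    using assms(2) by (auto simp: poly_deg_le_def msets_def)
  have mon: "(\<lambda>z. \<Prod>u\<in>#m. L z u) \<in> hspan T (size m)" if "set_mset m \<subseteq> U" for m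
    using that
  proof (induction m)
    case empty
    have "hm {#} \<in> hspan T 0" by (rule hspan_hm) (simp add: msets_def)
    then show ?case by (simp add: hm_empty[abs_def])
  next
    case (add u m)
    have "(\<lambda>z. \<Sum>j\<in>J u. w u * (z (e u j) * (\<Prod>u\<in>#m. L z u))) \<in> hspan T (Suc (size m))"
      by (intro hspan_sum hspan_scale hspan_mult_coord) (use add e in auto)
    then show ?case using add.prems by (simp add: L sum_distrib_right mult.assoc)
  qed
  have "(\<lambda>z. \<Sum>m\<in>msets U d. c m * (\<Prod>u\<in>#m. L z u)) \<in> hspan T d"
    by (intro hspan_sum hspan_scale hspan_mono[OF mon]) (auto simp: msets_def)
  then show ?thesis by (simp add: c)
qed

end

subsection \<open>The certificate\<close>

abbreviation tens :: "nat \<Rightarrow> (nat \<Rightarrow> real) \<Rightarrow> nat list \<Rightarrow> real" where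
  "tens n g e \<equiv> \<Prod>c\<in>#mset e. sphere_vec n g c"

lemma finite_tuples [simp]: "finite (tuples n p)"
  unfolding tuples_def using finite_lists_length_eq[of "{..<n}" p] by (simp add: conj_commute)

text \<open>The signal is symmetric, so each of the \<open>fact p\<close> permutations contributes
  the same entry, and two factors \<open>1 / sqrt (fact p)\<close> cancel their number. Thus the
  signal can be added before symmetrizing, and the noise stays i.i.d.\<close>

lemma spiked_obs_eq:
  "spiked_obs n p lam g G = wigner n p (\<lambda>e. G e + lam / sqrt (fact p) * tens n g e)"
proof
  fix js
  show "spiked_obs n p lam g G js = wigner n p (\<lambda>e. G e + lam / sqrt (fact p) * tens n g e) js"
  proof (cases "js \<in> tuples n p")
    case True
    then have len: "length js = p" by (simp add: tuples_def)
    let ?P = "{\<pi>. \<pi> permutes {..<p}}"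
    have "tens n g (map (\<lambda>k. js ! \<pi> k) [0..<p]) = tens n g js" if "\<pi> \<in> ?P" for \<pi>
      using mset_permute_list[of \<pi> "js"] that len by (simp add: permute_list_def)
    then have "(\<Sum>\<pi>\<in>?P. lam / sqrt (fact p) * tens n g (map (\<lambda>k. js ! \<pi> k) [0..<p]))
      = fact p * (lam / sqrt (fact p) * tens n g js)"
      by (simp add: card_permutations[of "{..<p}" p])
    moreover have "tens n g js = (\<Prod>k<p. sphere_vec n g (js ! k))"
    proof -
      have "tens n g js = prod_list (map (sphere_vec n g) js)"
        by (simp add: prod_mset_prod_list flip: mset_map)
      then show ?thesis by (simp add: prod.list_conv_set_nth len atLeast0LessThan)
    qed
    moreover have "(1 / sqrt (fact p)) * (fact p * (lam / sqrt (fact p) * t)) = lam * t" for t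
      by simp
    ultimately show ?thesis
      using True by (simp add: spiked_obs_def wigner_def tensor_pow_def sum.distrib distrib_left)
  qed (simp add: spiked_obs_def wigner_def tensor_pow_def)
qed

lemma wigner_hspan:
  assumes "poly_deg_le (tuples n p) d F"
  shows "(\<lambda>z. F (wigner n p z)) \<in> hspan (tuples n p) d"
proof (rule hspan_poly_linear[OF finite_tuples finite_tuples assms])
  fix js :: "nat list" and z assume is_in: "js \<in> tuples n p"
  show "wigner n p z js = (\<Sum>\<pi>\<in>{\<pi>. \<pi> permutes {..<p}}.
      (1 / sqrt (fact p)) * z (map (\<lambda>k. js ! \<pi> k) [0..<p]))"
    using is_in by (simp add: wigner_def sum_distrib_left)
  fix \<pi> assume "\<pi> \<in> {\<pi>. \<pi> permutes {..<p}}"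
  then have \<pi>: "\<pi> permutes {..<p}" by simp
  show "map (\<lambda>k. js ! \<pi> k) [0..<p] \<in> tuples n p"
    using is_in permutes_in_image[OF \<pi>]
    by (auto simp: tuples_def) (metis lessThan_iff nth_mem subsetD)
qed

lemma set_tot: "set_mset (tot m) = (\<Union>l\<in>set_mset m. set l)"
  by (induction m) auto

lemma prod_tens: "(\<Prod>e\<in>#m. l * tens n g e) = l ^ size m * (\<Prod>c\<in>#tot m. sphere_vec n g c)"
  by (induction m) auto

lemma cf_pser_tens:
  "cf (pser (\<lambda>e. l * tens n g e)) m = l ^ size m * (\<Prod>c\<in>#tot m. sphere_vec n g c) / mfact m"
  by (simp add: pser_def prod_tens)

lemma tot_tuples: "set_mset m \<subseteq> tuples n p \<Longrightarrow> set_mset (tot m) \<subseteq> {..<n}"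
  by (auto simp: set_tot tuples_def subset_iff)

lemma pser_mean:
  assumes "0 < n" "set_mset m \<subseteq> tuples n p"
  shows "(\<integral>g. cf (pser (\<lambda>e. l * tens n g e)) m \<partial>gauss_vec n) = l ^ size m * cf (rw (wt (real n / 2))) m"
  using sphere_mom_eq[OF assms(1) tot_tuples[OF assms(2)]]
  by (simp add: cf_pser_tens rw_def mu_def)

lemma pser_mean_vec:
  assumes "0 < n" "i < n" "set_mset m \<subseteq> tuples n p"
  shows "(\<integral>g. sphere_vec n g i * cf (pser (\<lambda>e. l * tens n g e)) m \<partial>gauss_vec n)
    = l ^ size m * cf (dv [i] (rw (wt (real n / 2)))) m"
proof -
  have "sphere_mom n (add_mset i (tot m)) = wt (real n / 2) (Suc (size (tot m)) div 2) * gm (add_mset i (tot m))"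
    using sphere_mom_eq[OF assms(1), of "add_mset i (tot m)"] tot_tuples[OF assms(3)] assms(2) by simp
  moreover have "sphere_vec n g i * cf (pser (\<lambda>e. l * tens n g e)) m
    = l ^ size m / mfact m * (\<Prod>c\<in>#add_mset i (tot m). sphere_vec n g c)" for g
    by (simp add: cf_pser_tens)
  moreover have "real (count m [i]) + 1 \<noteq> 0" by linarith
  ultimately show ?thesis
    by (simp add: cf_dv rw_def mu_def mfact_add)
qed

lemma bdd_fun_sphere_vec: "bdd_fun (gauss_vec n) (\<lambda>g. sphere_vec n g i)"
  unfolding bdd_fun_def using abs_sphere_vec_le by (auto intro: borel_measurable_sphere_vec)

lemma bdd_fun_pser: "bdd_fun (gauss_vec n) (\<lambda>g. cf (pser (\<lambda>e. l * tens n g e)) m)"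
proof -
  have "bdd_fun (gauss_vec n) (\<lambda>g. \<Prod>c\<in>#M. sphere_vec n g c)" for M
    by (induction M) (simp_all add: bdd_fun_const bdd_fun_mult bdd_fun_sphere_vec)
  then have "bdd_fun (gauss_vec n) (\<lambda>g. (l ^ size m / mfact m) * (\<Prod>c\<in>#tot m. sphere_vec n g c))"
    by (intro bdd_fun_mult bdd_fun_const)
  then show ?thesis by (simp add: cf_pser_tens)
qed

text \<open>If \<open>F\<close> has Hermite coefficients \<open>c\<close>, this is the coefficient
  of \<open>hm a\<close> in the noise when \<open>F\<close> is evaluated at noise plus signal, as
  given by \<open>hm_shift\<close>.\<close>

definition obs_coeff :: "nat \<Rightarrow> nat \<Rightarrow> nat \<Rightarrow> real \<Rightarrow> (nat list multiset \<Rightarrow> real) \<Rightarrow> nat list multiset \<Rightarrow> (nat \<Rightarrow> real) \<Rightarrow> real" where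
  "obs_coeff n p d l c a g = (\<Sum>m\<in>msets (tuples n p) d.
     if a \<subseteq># m then c m * cf (pser (\<lambda>e. l * tens n g e)) (m - a) else 0)"

lemma bdd_fun_obs_term:
  "bdd_fun (gauss_vec n) (\<lambda>g. if a \<subseteq># m then c * cf (pser (\<lambda>e. l * tens n g e)) (m - a) else 0)"
  by (cases "a \<subseteq># m") (simp_all add: bdd_fun_const bdd_fun_mult bdd_fun_pser)

lemma bdd_fun_obs_coeff: "bdd_fun (gauss_vec n) (obs_coeff n p d l c a)"
  unfolding obs_coeff_def[abs_def] by (rule bdd_fun_sum) (rule bdd_fun_obs_term)

lemma submsets_in_msets:
  assumes "finite T" "m \<in> msets T d"
  shows "(\<Sum>a\<in>submsets m. h a) = (\<Sum>a\<in>msets T d. if a \<subseteq># m then h a else (0::real))"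
proof -
  have "msets T d \<inter> {a. a \<subseteq># m} = submsets m"
    using msets_subset[OF _ assms(2)] by auto
  then show ?thesis by (simp add: sum.If_cases finite_msets[OF assms(1)])
qed

lemma obs_hexp:
  assumes "\<And>z. F z = (\<Sum>m\<in>msets (tuples n p) d. c m * hm m z)"
  shows "F (\<lambda>e. snd w e + l * tens n (fst w) e) = hexp (tuples n p) d (obs_coeff n p d l c) w"
proof -
  let ?M = "msets (tuples n p) d" and ?P = "cf (pser (\<lambda>e. l * tens n (fst w) e))"
  have "F (\<lambda>e. snd w e + l * tens n (fst w) e)
    = (\<Sum>m\<in>?M. \<Sum>a\<in>submsets m. c m * ?P (m - a) * hm a (snd w))"
    unfolding assms hm_shift by (simp add: sum_distrib_left mult_ac)
  also have "\<dots> = (\<Sum>m\<in>?M. \<Sum>a\<in>?M. if a \<subseteq># m then c m * ?P (m - a) * hm a (snd w) else 0)"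
    by (intro sum.cong refl submsets_in_msets) auto
  also have "\<dots> = (\<Sum>a\<in>?M. \<Sum>m\<in>?M. if a \<subseteq># m then c m * ?P (m - a) * hm a (snd w) else 0)"
    by (rule sum.swap)
  also have "\<dots> = hexp (tuples n p) d (obs_coeff n p d l c) w"
    unfolding hexp_def obs_coeff_def sum_distrib_right by (intro sum.cong refl) auto
  finally show ?thesis .
qed

text \<open>The factor \<open>mfact a\<close> offsets the squared norm \<open>1 / mfact a\<close> of
  \<open>hm a\<close>.\<close>

definition cert_coeff :: "nat \<Rightarrow> real \<Rightarrow> nat \<Rightarrow> nat list multiset \<Rightarrow> real" where
  "cert_coeff n l i a = l ^ size a * cf (kappa (real n / 2) i) a * mfact a"

lemma integral_bdd_sum:
  assumes "\<And>i. i \<in> I \<Longrightarrow> bdd_fun (gauss_vec n) (f i)"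
  shows "(\<integral>g. (\<Sum>i\<in>I. f i g) \<partial>gauss_vec n) = (\<Sum>i\<in>I. \<integral>g. f i g \<partial>gauss_vec n)"
  by (intro Bochner_Integration.integral_sum bdd_fun_integrable prob_space_PiM assms) auto

text \<open>The certificate does not depend on the signal, so only the mean of
  \<open>obs_coeff\<close> enters on the left, and the sum over \<open>a\<close> convolves
  \<open>kappa\<close> with the moment series at each \<open>m\<close>. By \<open>kappa_eq\<close>
  this is the moment of \<open>v_i\<close> with \<open>m\<close>. On the right only
  \<open>{#}\<close> appears, because \<open>v_i\<close> is constant in the noise.\<close>

lemma certificate:
  assumes "0 < n" "i < n"
  shows "(\<Sum>a\<in>msets (tuples n p) d. (\<integral>g. cert_coeff n l i a * obs_coeff n p d l c a g \<partial>gauss_vec n) / mfact a)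
    = (\<integral>g. sphere_vec n g i * obs_coeff n p d l c {#} g \<partial>gauss_vec n)"
proof -
  let ?M = "msets (tuples n p) d" and ?rw = "rw (wt (real n / 2)) :: nat list mps"
  let ?K = "kappa (real n / 2) i"
  have sub: "set_mset (m - a) \<subseteq> tuples n p" if "m \<in> ?M" for m a
    using that by (auto simp: msets_def dest: in_diffD)
  have mean: "(\<integral>g. obs_coeff n p d l c a g \<partial>gauss_vec n)
    = (\<Sum>m\<in>?M. if a \<subseteq># m then c m * (l ^ size (m - a) * cf ?rw (m - a)) else 0)" for a
  proof -
    have "(\<integral>g. obs_coeff n p d l c a g \<partial>gauss_vec n) = (\<Sum>m\<in>?M.
       \<integral>g. (if a \<subseteq># m then c m * cf (pser (\<lambda>e. l * tens n g e)) (m - a) else 0) \<partial>gauss_vec n)"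
      unfolding obs_coeff_def
      by (rule integral_bdd_sum) (rule bdd_fun_obs_term)
    also have "\<dots> = (\<Sum>m\<in>?M. if a \<subseteq># m then c m * (l ^ size (m - a) * cf ?rw (m - a)) else 0)"
      by (intro sum.cong refl) (use pser_mean[OF assms(1) sub] in simp)
    finally show ?thesis .
  qed
  have "(\<Sum>a\<in>?M. (\<integral>g. cert_coeff n l i a * obs_coeff n p d l c a g \<partial>gauss_vec n) / mfact a)
    = (\<Sum>a\<in>?M. \<Sum>m\<in>?M. if a \<subseteq># m then c m * l ^ size m * (cf ?K a * cf ?rw (m - a)) else 0)"
  proof (rule sum.cong)
    fix a assume "a \<in> ?M"
    have "mfact a \<noteq> 0" using mfact_pos[of a] by linarith
    then have "(\<integral>g. cert_coeff n l i a * obs_coeff n p d l c a g \<partial>gauss_vec n) / mfact a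
      = (l ^ size a * cf ?K a) * (\<Sum>m\<in>?M. if a \<subseteq># m then c m * (l ^ size (m - a) * cf ?rw (m - a)) else 0)"
      by (simp add: mean cert_coeff_def)
    also have "\<dots> = (\<Sum>m\<in>?M. if a \<subseteq># m then c m * l ^ size m * (cf ?K a * cf ?rw (m - a)) else 0)"
      unfolding sum_distrib_left
    proof (intro sum.cong refl)
      fix m
      have "l ^ size m = l ^ size a * l ^ size (m - a)" if "a \<subseteq># m"
        using that by (simp add: size_Diff_submset size_mset_mono flip: power_add)
      then show "l ^ size a * cf ?K a * (if a \<subseteq># m then c m * (l ^ size (m - a) * cf ?rw (m - a)) else 0)
        = (if a \<subseteq># m then c m * l ^ size m * (cf ?K a * cf ?rw (m - a)) else 0)"
        by simp
    qed
    finally show "(\<integral>g. cert_coeff n l i a * obs_coeff n p d l c a g \<partial>gauss_vec n) / mfact a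
      = (\<Sum>m\<in>?M. if a \<subseteq># m then c m * l ^ size m * (cf ?K a * cf ?rw (m - a)) else 0)" .
  qed simp
  also have "\<dots> = (\<Sum>m\<in>?M. \<Sum>a\<in>?M. if a \<subseteq># m then c m * l ^ size m * (cf ?K a * cf ?rw (m - a)) else 0)"
    by (rule sum.swap)
  also have "\<dots> = (\<Sum>m\<in>?M. c m * (l ^ size m * cf (?K * ?rw) m))"
    by (intro sum.cong refl)
       (simp add: cf_mult sum_distrib_left mult.assoc flip: submsets_in_msets[OF finite_tuples])
  also have "\<dots> = (\<Sum>m\<in>?M. \<integral>g. c m * (sphere_vec n g i * cf (pser (\<lambda>e. l * tens n g e)) m) \<partial>gauss_vec n)"
    by (intro sum.cong refl)
       (use pser_mean_vec[OF assms] in \<open>auto simp: kappa_eq msets_def\<close>)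
  also have "\<dots> = (\<integral>g. (\<Sum>m\<in>?M. c m * (sphere_vec n g i * cf (pser (\<lambda>e. l * tens n g e)) m)) \<partial>gauss_vec n)"
    by (rule integral_bdd_sum[symmetric])
       (simp add: bdd_fun_const bdd_fun_mult bdd_fun_pser bdd_fun_sphere_vec)
  also have "\<dots> = (\<integral>g. sphere_vec n g i * obs_coeff n p d l c {#} g \<partial>gauss_vec n)"
    by (simp add: obs_coeff_def sum_distrib_left mult.left_commute)
  finally show ?thesis .
qed

lemma hexp_const:
  assumes "finite T"
  shows "hexp T d (\<lambda>a g. if a = {#} then v g else 0) w = v (fst w)"
proof -
  have "{#} \<in> msets T d" by (simp add: msets_def)
  then show ?thesis
    by (simp add: hexp_def finite_msets[OF assms] if_distribR if_distrib cong: if_cong)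
qed

definition cert_norm :: "nat \<Rightarrow> nat \<Rightarrow> nat \<Rightarrow> real \<Rightarrow> real" where
  "cert_norm n p d l = (\<Sum>i<n. \<Sum>a\<in>msets (tuples n p) d. (cert_coeff n l i a)\<^sup>2 / mfact a)"

lemma cert_norm_nonneg: "0 \<le> cert_norm n p d l"
  by (auto simp: cert_norm_def less_imp_le intro!: sum_nonneg divide_nonneg_nonneg)

text \<open>Take the vertex \<open>t = S / B\<close>. If \<open>B = 0\<close>, the expression is
  affine in \<open>t\<close>, hence bounded below only for \<open>S = 0\<close>.\<close>

lemma quadratic_nonneg_discrim:
  fixes Q S B :: real
  assumes "0 \<le> B" and nonneg: "\<And>t. 0 \<le> Q - 2 * t * S + t\<^sup>2 * B"
  shows "S\<^sup>2 \<le> Q * B"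
proof (cases "B = 0")
  case True
  have "S = 0"
  proof (rule ccontr)
    assume "S \<noteq> 0"
    then have "0 \<le> Q - (Q + 1)" using nonneg[of "(Q + 1) / (2 * S)"] True by simp
    then show False by simp
  qed
  then show ?thesis using True by simp
next
  case False
  have "0 \<le> Q - 2 * (S / B) * S + (S / B)\<^sup>2 * B" by (rule nonneg)
  also have "\<dots> = Q - S\<^sup>2 / B" using False by (simp add: power2_eq_square)
  finally show ?thesis using False assms(1) by (simp add: field_simps)
qed

text \<open>All integrands are finite Hermite expansions in the noise with bounded coefficients depending
  on the signal, so every second moment is a sum over matching coefficients.\<close>

proposition low_degree_bounds:
  fixes n p d lam f
  assumes n: "0 < n" and f: "f \<in> poly_maps n p d"
  defines "Y \<equiv> \<lambda>w. spiked_obs n p lam (fst w) (snd w)"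
    and "B \<equiv> cert_norm n p d (lam / sqrt (fact p))"
  defines "Q \<equiv> \<integral>w. (\<Sum>i<n. (f (Y w) i)\<^sup>2) \<partial>noise_space n p"
    and "S \<equiv> \<integral>w. (\<Sum>i<n. sphere_vec n (fst w) i * f (Y w) i) \<partial>noise_space n p"
  shows "0 \<le> Q" "S\<^sup>2 \<le> Q * B"
    and "(\<integral>w. (\<Sum>i<n. (f (Y w) i - sphere_vec n (fst w) i)\<^sup>2) \<partial>noise_space n p) = Q - 2 * S + real n"
    and "real n - B \<le> Q - 2 * S + real n"
proof -
  let ?T = "tuples n p" and ?N = "noise_space n p"
  define l where "l = lam / sqrt (fact p)"
  have gp: "prob_space (gauss_vec n)" by (rule prob_space_PiM) simp
  have "\<exists>c. \<forall>z. f (wigner n p z) i = (\<Sum>m\<in>msets ?T d. c m * hm m z)" if "i < n" for i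
    using wigner_hspan[of n p d "\<lambda>Y. f Y i"] f that by (auto simp: poly_maps_def hspan_def)
  then obtain c where c: "\<And>i z. i < n \<Longrightarrow> f (wigner n p z) i = (\<Sum>m\<in>msets ?T d. c i m * hm m z)"
    by metis
  define F U V where "F = (\<lambda>i w. f (Y w) i)"
    and "U = (\<lambda>i. hexp ?T d (\<lambda>a (g::nat \<Rightarrow> real). cert_coeff n l i a))"
    and "V = (\<lambda>i (w::(nat \<Rightarrow> real) \<times> (nat list \<Rightarrow> real)). sphere_vec n (fst w) i)"
  have F: "F i w = hexp ?T d (obs_coeff n p d l (c i)) w" if "i < n" for i w
    using obs_hexp[of "\<lambda>z. f (wigner n p z) i", OF c[OF that]]
    unfolding F_def Y_def spiked_obs_eq l_def[symmetric] .
  have V: "V i w = hexp ?T d (\<lambda>a g. if a = {#} then sphere_vec n g i else 0) w" for i w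
    by (simp add: V_def hexp_const)
  have bV: "bdd_fun (gauss_vec n) (\<lambda>g. if a = {#} then sphere_vec n g i else 0)" for a :: "nat list multiset" and i
    by (cases "a = {#}") (simp_all add: bdd_fun_sphere_vec bdd_fun_const)
  note inner = hexp_inner[OF finite_tuples[of n p] gp, folded noise_space_def]
  have FF: "integrable ?N (\<lambda>w. F i w * F i w)" if "i < n" for i
    unfolding F[OF that] by (rule integrable.intros[OF inner]) (rule bdd_fun_obs_coeff)+
  have UF: "has_bochner_integral ?N (\<lambda>w. U i w * F i w)
      (\<integral>g. sphere_vec n g i * obs_coeff n p d l (c i) {#} g \<partial>gauss_vec n)" if "i < n" for i
    unfolding F[OF that] U_def certificate[OF n that, symmetric]
    by (rule inner) (rule bdd_fun_const bdd_fun_obs_coeff)+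
  have VF: "has_bochner_integral ?N (\<lambda>w. V i w * F i w)
      (\<integral>g. sphere_vec n g i * obs_coeff n p d l (c i) {#} g \<partial>gauss_vec n)" if "i < n" for i
  proof -
    have "(\<Sum>a\<in>msets ?T d. (\<integral>g. (if a = {#} then sphere_vec n g i else 0) * obs_coeff n p d l (c i) a g \<partial>gauss_vec n) / mfact a)
      = (\<Sum>a\<in>msets ?T d. if a = {#} then \<integral>g. sphere_vec n g i * obs_coeff n p d l (c i) {#} g \<partial>gauss_vec n else 0)"
      by (intro sum.cong) auto
    also have "\<dots> = (\<integral>g. sphere_vec n g i * obs_coeff n p d l (c i) {#} g \<partial>gauss_vec n)"
      by (simp add: finite_msets) (simp add: msets_def)
    finally have eq: "(\<Sum>a\<in>msets ?T d. (\<integral>g. (if a = {#} then sphere_vec n g i else 0) * obs_coeff n p d l (c i) a g \<partial>gauss_vec n) / mfact a)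
      = (\<integral>g. sphere_vec n g i * obs_coeff n p d l (c i) {#} g \<partial>gauss_vec n)" .
    show ?thesis
      unfolding F[OF that] V eq[symmetric] by (rule inner) (rule bV bdd_fun_obs_coeff)+
  qed
  have UU: "has_bochner_integral ?N (\<lambda>w. U i w * U i w) (\<Sum>a\<in>msets ?T d. (cert_coeff n l i a)\<^sup>2 / mfact a)" for i
  proof -
    interpret prob_space "gauss_vec n" by (rule gp)
    have "has_bochner_integral ?N (\<lambda>w. U i w * U i w)
      (\<Sum>a\<in>msets ?T d. (\<integral>g. cert_coeff n l i a * cert_coeff n l i a \<partial>gauss_vec n) / mfact a)"
      unfolding U_def by (rule inner) (rule bdd_fun_const)+
    then show ?thesis by (simp add: prob_space power2_eq_square)
  qed
  have VV: "has_bochner_integral ?N (\<lambda>w. V i w * V i w) (\<integral>g. (sphere_vec n g i)\<^sup>2 \<partial>gauss_vec n)" for i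
  proof -
    have "(\<Sum>a\<in>msets ?T d. (\<integral>g. (if a = {#} then sphere_vec n g i else 0) * (if a = {#} then sphere_vec n g i else 0) \<partial>gauss_vec n) / mfact a)
      = (\<Sum>a\<in>msets ?T d. if a = {#} then \<integral>g. (sphere_vec n g i)\<^sup>2 \<partial>gauss_vec n else 0)"
      by (intro sum.cong) (auto simp: power2_eq_square)
    also have "\<dots> = (\<integral>g. (sphere_vec n g i)\<^sup>2 \<partial>gauss_vec n)"
      by (simp add: finite_msets) (simp add: msets_def)
    finally have eq: "(\<Sum>a\<in>msets ?T d. (\<integral>g. (if a = {#} then sphere_vec n g i else 0) * (if a = {#} then sphere_vec n g i else 0) \<partial>gauss_vec n) / mfact a)
      = (\<integral>g. (sphere_vec n g i)\<^sup>2 \<partial>gauss_vec n)" .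
    show ?thesis unfolding V eq[symmetric] by (rule inner) (rule bV)+
  qed
  have Q: "has_bochner_integral ?N (\<lambda>w. \<Sum>i<n. F i w * F i w) Q"
    unfolding Q_def has_bochner_integral_iff F_def power2_eq_square
    using FF by (auto simp: F_def)
  have S: "has_bochner_integral ?N (\<lambda>w. \<Sum>i<n. V i w * F i w) S"
    unfolding S_def has_bochner_integral_iff V_def F_def
    using VF by (auto simp: V_def F_def has_bochner_integral_iff)
  \<comment> \<open>By \<open>certificate\<close>, \<open>U\<close> has the same inner product with
    \<open>F\<close> as the signal \<open>V\<close>.\<close>
  have S': "has_bochner_integral ?N (\<lambda>w. \<Sum>i<n. U i w * F i w) S"
  proof -
    have "S = (\<Sum>i<n. \<integral>g. sphere_vec n g i * obs_coeff n p d l (c i) {#} g \<partial>gauss_vec n)"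
      by (rule has_bochner_integral_eq[OF S]) (rule has_bochner_integral_sum, use VF in auto)
    then show ?thesis using UF by (auto intro: has_bochner_integral_sum)
  qed
  have B: "has_bochner_integral ?N (\<lambda>w. \<Sum>i<n. U i w * U i w) B"
    unfolding B_def cert_norm_def l_def[symmetric] by (rule has_bochner_integral_sum) (rule UU)
  have NV: "has_bochner_integral ?N (\<lambda>w. \<Sum>i<n. V i w * V i w) (real n)"
  proof -
    interpret prob_space "gauss_vec n" by (rule gp)
    have "(\<Sum>i<n. \<integral>g. (sphere_vec n g i)\<^sup>2 \<partial>gauss_vec n) = (\<integral>g. (\<Sum>i<n. (sphere_vec n g i)\<^sup>2) \<partial>gauss_vec n)"
      unfolding power2_eq_square
      by (rule integral_bdd_sum[symmetric]) (intro bdd_fun_mult bdd_fun_sphere_vec)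
    also have "\<dots> = (\<integral>g. real n \<partial>gauss_vec n)"
      using AE_vnorm_pos[OF n] by (intro integral_cong_AE) (auto elim!: eventually_mono simp: sphere_vec_norm)
    finally have "(\<Sum>i<n. \<integral>g. (sphere_vec n g i)\<^sup>2 \<partial>gauss_vec n) = real n" by (simp add: prob_space)
    moreover have "has_bochner_integral ?N (\<lambda>w. \<Sum>i<n. V i w * V i w)
      (\<Sum>i<n. \<integral>g. (sphere_vec n g i)\<^sup>2 \<partial>gauss_vec n)"
      by (rule has_bochner_integral_sum) (rule VV)
    ultimately show ?thesis by (simp only:)
  qed
  have quad: "0 \<le> Q - 2 * t * S + t\<^sup>2 * B" for t
  proof -
    have "has_bochner_integral ?N (\<lambda>w. (\<Sum>i<n. F i w * F i w) - 2 * t * (\<Sum>i<n. U i w * F i w)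
        + t\<^sup>2 * (\<Sum>i<n. U i w * U i w)) (Q - 2 * t * S + t\<^sup>2 * B)"
      by (intro has_bochner_integral_add has_bochner_integral_diff has_bochner_integral_mult_right Q S' B)
    moreover have "(\<Sum>i<n. F i w * F i w) - 2 * t * (\<Sum>i<n. U i w * F i w) + t\<^sup>2 * (\<Sum>i<n. U i w * U i w)
      = (\<Sum>i<n. (F i w - t * U i w)\<^sup>2)" for w
      by (simp add: sum_distrib_left power2_eq_square algebra_simps sum.distrib sum_subtractf)
    ultimately have "has_bochner_integral ?N (\<lambda>w. \<Sum>i<n. (F i w - t * U i w)\<^sup>2) (Q - 2 * t * S + t\<^sup>2 * B)"
      by simp
    then have "Q - 2 * t * S + t\<^sup>2 * B = (\<integral>w. (\<Sum>i<n. (F i w - t * U i w)\<^sup>2) \<partial>?N)"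
      by (simp add: has_bochner_integral_iff)
    also have "\<dots> \<ge> 0" by (intro Bochner_Integration.integral_nonneg sum_nonneg) simp
    finally show ?thesis .
  qed
  show "0 \<le> Q" using quad[of 0] by simp
  show "S\<^sup>2 \<le> Q * B" by (rule quadratic_nonneg_discrim[OF _ quad]) (simp add: B_def cert_norm_nonneg)
  \<comment> \<open>At \<open>t = 1\<close> the quadratic is the mean square of
    \<open>F - U\<close>, so \<open>Q - 2 * S\<close> is at least \<open>- B\<close>.\<close>
  show "real n - B \<le> Q - 2 * S + real n" using quad[of 1] by simp
  have "has_bochner_integral ?N (\<lambda>w. (\<Sum>i<n. F i w * F i w) - 2 * (\<Sum>i<n. V i w * F i w)
      + (\<Sum>i<n. V i w * V i w)) (Q - 2 * S + real n)"
    by (intro has_bochner_integral_add has_bochner_integral_diff has_bochner_integral_mult_right Q S NV)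
  moreover have "(\<Sum>i<n. F i w * F i w) - 2 * (\<Sum>i<n. V i w * F i w) + (\<Sum>i<n. V i w * V i w)
    = (\<Sum>i<n. (f (Y w) i - sphere_vec n (fst w) i)\<^sup>2)" for w
    by (simp add: F_def V_def sum_distrib_left power2_eq_square algebra_simps sum.distrib sum_subtractf)
  ultimately show "(\<integral>w. (\<Sum>i<n. (f (Y w) i - sphere_vec n (fst w) i)\<^sup>2) \<partial>?N) = Q - 2 * S + real n"
    by (simp add: has_bochner_integral_iff)
qed

subsection \<open>The second moment of the certificate\<close>

definition nlists :: "'a set \<Rightarrow> nat \<Rightarrow> 'a list set" where
  "nlists T k = {xs. set xs \<subseteq> T \<and> length xs = k}"

lemma tuples_eq_nlists: "tuples n p = nlists {..<n} p"
  by (auto simp: tuples_def nlists_def)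

lemma nlists_0 [simp]: "nlists T 0 = {[]}"
  by (auto simp: nlists_def)

lemma finite_nlists [simp]: "finite T \<Longrightarrow> finite (nlists T k)"
  unfolding nlists_def by (rule finite_lists_length_eq)

lemma sum_nlists_Suc: "(\<Sum>xs\<in>nlists T (Suc k). h xs) = (\<Sum>x\<in>T. \<Sum>xs\<in>nlists T k. h (x # xs))"
proof -
  have "(\<Sum>xs\<in>nlists T (Suc k). h xs) = (\<Sum>(x, xs)\<in>T \<times> nlists T k. h (x # xs))"
    by (rule sum.reindex_bij_witness[of _ "\<lambda>(x, xs). x # xs" "\<lambda>xs. (hd xs, tl xs)"])
       (auto simp: nlists_def length_Suc_conv)
  then show ?thesis by (simp add: sum.cartesian_product)
qed

lemma sum_nlists_append:
  "(\<Sum>c\<in>nlists T (k + m). h (mset c)) = (\<Sum>a\<in>nlists T k. \<Sum>b\<in>nlists T m. h (mset a + mset b))"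
proof (induction k arbitrary: h)
  case (Suc k)
  show ?case by (simp add: sum_nlists_Suc Suc.IH[of "\<lambda>M. h (add_mset _ M)"])
qed simp

lemma sum_nlists_concat:
  "(\<Sum>e\<in>nlists (nlists T p) d. h (mset (concat e))) = (\<Sum>c\<in>nlists T (p * d). h (mset c))"
proof (induction d arbitrary: h)
  case (Suc d)
  have "(\<Sum>e\<in>nlists (nlists T p) (Suc d). h (mset (concat e)))
    = (\<Sum>x\<in>nlists T p. \<Sum>e\<in>nlists (nlists T p) d. h (mset x + mset (concat e)))"
    by (simp add: sum_nlists_Suc)
  also have "\<dots> = (\<Sum>x\<in>nlists T p. \<Sum>c\<in>nlists T (p * d). h (mset x + mset c))"
    by (intro sum.cong refl Suc.IH)
  finally show ?case by (simp add: sum_nlists_append)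
qed simp

text \<open>The count selects one of \<open>K + 1\<close> positions that holds \<open>k\<close>;
  erasing it leaves an arbitrary list of length \<open>K\<close>.\<close>

lemma sum_nlists_count:
  fixes f :: "'a multiset \<Rightarrow> real"
  assumes "finite T" "k \<in> T"
  shows "(\<Sum>c\<in>nlists T (Suc K). real (count (mset c) k) * f (mset c))
    = (real K + 1) * (\<Sum>c\<in>nlists T K. f (add_mset k (mset c)))"
proof (induction K arbitrary: f)
  case 0
  have "(\<Sum>x\<in>T. real (count {#x#} k) * f {#x#}) = (\<Sum>x\<in>T. if x = k then f {#k#} else 0)"
    by (rule sum.cong) auto
  then show ?case using assms by (simp add: sum_nlists_Suc)
next
  case (Suc K)
  have "(\<Sum>c\<in>nlists T (Suc (Suc K)). real (count (mset c) k) * f (mset c))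
    = (\<Sum>x\<in>T. \<Sum>c\<in>nlists T (Suc K). (if x = k then f (add_mset k (mset c)) else 0)
         + real (count (mset c) k) * f (add_mset x (mset c)))"
    unfolding sum_nlists_Suc[of _ _ "Suc K"] by (intro sum.cong refl) (auto simp: algebra_simps)
  also have "\<dots> = (\<Sum>x\<in>T. if x = k then \<Sum>c\<in>nlists T (Suc K). f (add_mset k (mset c)) else 0)
      + (\<Sum>x\<in>T. \<Sum>c\<in>nlists T (Suc K). real (count (mset c) k) * f (add_mset x (mset c)))"
    unfolding sum.distrib by (intro arg_cong2[of _ _ _ _ "(+)"] sum.cong refl) auto
  also have "(\<Sum>x\<in>T. if x = k then \<Sum>c\<in>nlists T (Suc K). f (add_mset k (mset c)) else 0)
    = (\<Sum>c\<in>nlists T (Suc K). f (add_mset k (mset c)))"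
    using assms by simp
  also have "(\<Sum>x\<in>T. \<Sum>c\<in>nlists T (Suc K). real (count (mset c) k) * f (add_mset x (mset c)))
    = (\<Sum>x\<in>T. (real K + 1) * (\<Sum>c\<in>nlists T K. f (add_mset x (add_mset k (mset c)))))"
    by (intro sum.cong refl Suc.IH[of "\<lambda>M. f (add_mset _ M)"])
  also have "\<dots> = (real K + 1) * (\<Sum>c\<in>nlists T (Suc K). f (add_mset k (mset c)))"
    by (simp add: sum_nlists_Suc sum_distrib_left add_mset_commute)
  finally show ?case by (simp add: algebra_simps)
qed

text \<open>The \<open>K\<close>-th moment of the inner product of two independent standard Gaussian
  vectors, expanded over index lists.\<close>

definition gm_sq :: "nat \<Rightarrow> nat \<Rightarrow> real" where
  "gm_sq n K = (\<Sum>c\<in>nlists {..<n} K. (gm (mset c))\<^sup>2)"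

lemma gm_sq_odd: "odd K \<Longrightarrow> gm_sq n K = 0"
  by (auto simp: gm_sq_def nlists_def gm_odd intro!: sum.neutral)

text \<open>Given one of the vectors, the inner product is Gaussian with variance its squared norm:
  this explains \<open>K + 1\<close> and \<open>K + n\<close>. In terms of lists, Wick's rule is
  applied to one factor of the square, \<open>sum_nlists_count\<close> uses up the resulting count
  and yields \<open>K + 1\<close>, and the multiplicities that remain add up to
  \<open>K\<close>.\<close>

lemma gm_sq_rec: "gm_sq n (Suc (Suc K)) = (real K + 1) * (real K + real n) * gm_sq n K"
proof -
  let ?L = "nlists {..<n}"
  have "gm_sq n (Suc (Suc K)) = (\<Sum>k<n. \<Sum>c\<in>?L (Suc K). real (count (mset c) k) *
      (gm (mset c - {#k#}) * gm (add_mset k (mset c))))"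
    unfolding gm_sq_def sum_nlists_Suc[of _ _ "Suc K"]
    by (intro sum.cong refl) (simp add: gm_add power2_eq_square)
  also have "\<dots> = (\<Sum>k<n. (real K + 1) * (\<Sum>c\<in>?L K. gm (mset c) * gm (add_mset k (add_mset k (mset c)))))"
    by (intro sum.cong refl) (subst sum_nlists_count, auto)
  also have "\<dots> = (real K + 1) * (\<Sum>k<n. \<Sum>c\<in>?L K. (real (count (mset c) k) + 1) * (gm (mset c))\<^sup>2)"
    by (simp add: sum_distrib_left gm_add_add power2_eq_square mult_ac)
  also have "(\<Sum>k<n. \<Sum>c\<in>?L K. (real (count (mset c) k) + 1) * (gm (mset c))\<^sup>2)
    = (\<Sum>c\<in>?L K. (\<Sum>k<n. real (count (mset c) k) + 1) * (gm (mset c))\<^sup>2)"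
    by (subst sum.swap) (simp add: sum_distrib_right)
  also have "\<dots> = (\<Sum>c\<in>?L K. (real K + real n) * (gm (mset c))\<^sup>2)"
  proof (rule sum.cong)
    fix c assume c: "c \<in> ?L K"
    have "(\<Sum>k<n. count (mset c) k) = size (mset c)"
      unfolding size_multiset_overloaded_eq
      by (rule sum.mono_neutral_right) (use c in \<open>auto simp: nlists_def count_eq_zero_iff\<close>)
    then have "(\<Sum>k<n. real (count (mset c) k)) = real K"
      using c by (simp add: nlists_def flip: of_nat_sum)
    then show "(\<Sum>k<n. real (count (mset c) k) + 1) * (gm (mset c))\<^sup>2 = (real K + real n) * (gm (mset c))\<^sup>2"
      by (simp add: sum.distrib)
  qed simp
  finally show ?thesis by (simp add: gm_sq_def sum_distrib_left mult.assoc)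
qed

lemma gm_sq_even_le:
  assumes "q \<le> r" "2 * r \<le> n"
  shows "gm_sq n (2 * q) \<le> (4 * real r * real n) ^ q"
  using assms(1)
proof (induction q)
  case (Suc q)
  have "gm_sq n (2 * Suc q) = ((real (2 * q) + 1) * (real (2 * q) + real n)) * gm_sq n (2 * q)"
    using gm_sq_rec[of n "2 * q"] by simp
  also have "\<dots> \<le> ((2 * real r) * (2 * real n)) * (4 * real r * real n) ^ q"
    using Suc assms(2) by (intro mult_mono) (auto simp: gm_sq_def sum_nonneg)
  finally show ?case by simp
qed (simp add: gm_sq_def)

text \<open>A multiset \<open>a\<close> of size \<open>d\<close> has \<open>fact d / mfact a\<close>
  orderings.\<close>

lemma sum_nlists_mset:
  fixes h :: "'a multiset \<Rightarrow> real"
  assumes "finite T"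
  shows "(\<Sum>e\<in>nlists T d. h (mset e)) = fact d * (\<Sum>a\<in>{a. set_mset a \<subseteq> T \<and> size a = d}. h a / mfact a)"
proof -
  let ?A = "{a. set_mset a \<subseteq> T \<and> size a = d}"
  have finA: "finite ?A" by (rule finite_subset[OF _ finite_msets[OF assms, of d]]) (auto simp: msets_def)
  have "(\<Sum>e\<in>nlists T d. h (mset e)) = (\<Sum>a\<in>?A. \<Sum>e\<in>{e\<in>nlists T d. mset e = a}. h (mset e))"
    by (rule sum.group[symmetric, OF finite_nlists[OF assms] finA]) (auto simp: nlists_def)
  also have "\<dots> = (\<Sum>a\<in>?A. fact d * (h a / mfact a))"
  proof (rule sum.cong)
    fix a assume a: "a \<in> ?A"
    then have "{e\<in>nlists T d. mset e = a} = permutations_of_multiset a"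
      by (auto simp: nlists_def permutations_of_multiset_def)
    moreover have "(\<Prod>x\<in>set_mset a. fact (count a x) :: nat) dvd fact d"
      using card_permutations_of_multiset(2)[of a] a by simp
    then have "real (card (permutations_of_multiset a)) = fact d / mfact a"
      using a by (simp add: card_permutations_of_multiset real_of_nat_div mfact_def)
    moreover have "(\<Sum>e\<in>permutations_of_multiset a. h (mset e)) = (\<Sum>e\<in>permutations_of_multiset a. h a)"
      by (rule sum.cong) (auto simp: permutations_of_multiset_def)
    ultimately show "(\<Sum>e\<in>{e\<in>nlists T d. mset e = a}. h (mset e)) = fact d * (h a / mfact a)"
      by simp
  qed simp
  finally show ?thesis by (simp add: sum_distrib_left)
qed

lemma tot_mset: "tot (mset e) = mset (concat e)"
  by (induction e) auto

text \<open>Squaring \<open>kappa_bound\<close> makes the price 4 per variable. With the factor in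
  \<open>cert_coeff\<close>, exactly one \<open>1 / mfact a\<close> remains, the weight needed to
  pass from multisets to ordered lists. The index \<open>i\<close> followed by \<open>d\<close>
  concatenated tuples is a list of length \<open>p * d + 1\<close>.\<close>

lemma cert_norm_le:
  assumes "odd p" "0 < n" "(real p * real D)\<^sup>2 \<le> real n / 2"
  shows "cert_norm n p D l \<le> (\<Sum>d\<le>D. (4 * l\<^sup>2) ^ d / fact d * gm_sq n (Suc (p * d)))"
proof -
  let ?T = "tuples n p"
  define h where "h = (\<lambda>i (a :: nat list multiset). (gm (add_mset i (tot a)))\<^sup>2)"
  have "cert_norm n p D l \<le> (\<Sum>i<n. \<Sum>a\<in>msets ?T D. (4 * l\<^sup>2) ^ size a * (h i a / mfact a))"
    unfolding cert_norm_def
  proof (intro sum_mono)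
    fix i a assume a: "a \<in> msets ?T D"
    have pos: "0 < mfact a" by simp
    have "\<bar>cf (kappa (real n / 2) i) a\<bar> \<le> 2 ^ size a * cf (dv [i] mu) a"
      by (rule kappa_bound[OF assms(1)]) (use a assms in \<open>auto simp: msets_def tuples_def\<close>)
    also have "\<dots> = 2 ^ size a * (gm (add_mset i (tot a)) / mfact a)"
      by (simp add: cf_dv_mu)
    finally have "\<bar>cf (kappa (real n / 2) i) a\<bar>\<^sup>2 \<le> (2 ^ size a * (gm (add_mset i (tot a)) / mfact a))\<^sup>2"
      by (rule power_mono) simp
    moreover have "(2 ^ size a)\<^sup>2 = (4::real) ^ size a"
      by (simp add: power2_eq_square flip: power_mult_distrib)
    ultimately have "(cf (kappa (real n / 2) i) a)\<^sup>2 \<le> 4 ^ size a * h i a / (mfact a)\<^sup>2"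
      by (simp add: h_def power_mult_distrib power_divide)
    then have "(l ^ size a)\<^sup>2 * mfact a * (cf (kappa (real n / 2) i) a)\<^sup>2
      \<le> (l ^ size a)\<^sup>2 * mfact a * (4 ^ size a * h i a / (mfact a)\<^sup>2)"
      using pos by (intro mult_left_mono mult_nonneg_nonneg) (auto simp: less_imp_le)
    also have "\<dots> = (4 * l\<^sup>2) ^ size a * (h i a / mfact a)"
      using pos by (simp add: power2_eq_square power_mult_distrib)
    finally show "(cert_coeff n l i a)\<^sup>2 / mfact a \<le> (4 * l\<^sup>2) ^ size a * (h i a / mfact a)"
      using pos by (simp add: cert_coeff_def power_mult_distrib power2_eq_square mult_ac)
  qed
  also have "\<dots> = (\<Sum>i<n. \<Sum>d\<le>D. (4 * l\<^sup>2) ^ d * (\<Sum>a\<in>{a. set_mset a \<subseteq> ?T \<and> size a = d}. h i a / mfact a))"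
  proof (rule sum.cong)
    fix i
    have "(\<Sum>a\<in>msets ?T D. (4 * l\<^sup>2) ^ size a * (h i a / mfact a))
      = (\<Sum>d\<le>D. \<Sum>a\<in>{a\<in>msets ?T D. size a = d}. (4 * l\<^sup>2) ^ size a * (h i a / mfact a))"
      by (rule sum.group[symmetric]) (auto simp: finite_msets, simp add: msets_def)
    also have "\<dots> = (\<Sum>d\<le>D. (4 * l\<^sup>2) ^ d * (\<Sum>a\<in>{a. set_mset a \<subseteq> ?T \<and> size a = d}. h i a / mfact a))"
      unfolding sum_distrib_left by (intro sum.cong) (auto simp: msets_def)
    finally show "(\<Sum>a\<in>msets ?T D. (4 * l\<^sup>2) ^ size a * (h i a / mfact a))
      = (\<Sum>d\<le>D. (4 * l\<^sup>2) ^ d * (\<Sum>a\<in>{a. set_mset a \<subseteq> ?T \<and> size a = d}. h i a / mfact a))" .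
  qed simp
  also have "\<dots> = (\<Sum>d\<le>D. \<Sum>i<n. (4 * l\<^sup>2) ^ d / fact d * (\<Sum>e\<in>nlists ?T d. h i (mset e)))"
    by (subst sum.swap) (simp add: sum_nlists_mset mult.assoc)
  also have "\<dots> = (\<Sum>d\<le>D. (4 * l\<^sup>2) ^ d / fact d * gm_sq n (Suc (p * d)))"
  proof (rule sum.cong)
    fix d
    have "(\<Sum>i<n. \<Sum>e\<in>nlists ?T d. h i (mset e)) = gm_sq n (Suc (p * d))"
      by (simp add: h_def tot_mset tuples_eq_nlists gm_sq_def sum_nlists_Suc
          sum_nlists_concat[where h="\<lambda>M. (gm (add_mset _ M))\<^sup>2"])
    then show "(\<Sum>i<n. (4 * l\<^sup>2) ^ d / fact d * (\<Sum>e\<in>nlists ?T d. h i (mset e)))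
      = (4 * l\<^sup>2) ^ d / fact d * gm_sq n (Suc (p * d))"
      by (simp only: sum_distrib_left[symmetric])
  qed simp
  finally show ?thesis .
qed

text \<open>A single term of the exponential series at \<open>d\<close>, together with
  \<open>exp 1 \<le> 3\<close>.\<close>

lemma power_self_le_fact: "real d ^ d \<le> 3 ^ d * fact d"
proof -
  have "real d ^ d / fact d \<le> (\<Sum>k. real d ^ k /\<^sub>R fact k)"
    using sum_le_suminf[OF summable_exp_generic[of "real d"], of "{d}"]
    by (simp add: field_simps)
  also have "\<dots> = exp (real d)" by (simp add: exp_def)
  also have "\<dots> = exp 1 ^ d" using exp_of_nat_mult[of d "1::real"] by simp
  also have "\<dots> \<le> 3 ^ d" by (intro power_mono exp_le) simp
  finally show ?thesis by (simp add: field_simps)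
qed

text \<open>Chosen so that the square of the \<open>d\<close>-th term of the bound is at most \<open>n / 4\<^sup>d\<close>.\<close>

definition snr_const :: "nat \<Rightarrow> real" where
  "snr_const p = 1 / (4 * (1152 * real p * (4 * real p) ^ p))"

text \<open>Squaring turns the exponent \<open>q\<close> into \<open>p * d + 1\<close>. Then each of
  \<open>d\<close> equal factors carries \<open>d ^ p\<close> from the Gaussian moment and, up to a
  constant, \<open>1 / d ^ 2\<close> from the squared factorial; the remaining
  \<open>d ^ (p - 2)\<close> is the origin of the power of \<open>D\<close> in the
  threshold.\<close>

lemma cert_term_le:
  assumes p: "3 \<le> p" and d: "1 \<le> d" "d \<le> D" and n: "(real p * real D)\<^sup>2 \<le> real n / 2"
    and l: "l ^ 4 * real D ^ (p - 2) * real n ^ p \<le> snr_const p"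
  shows "(4 * l\<^sup>2) ^ d / fact d * gm_sq n (Suc (p * d)) \<le> sqrt (real n) * (1 / 2) ^ d"
proof (cases "even (Suc (p * d))")
  case False
  then show ?thesis using gm_sq_odd[of "Suc (p * d)" n] by simp
next
  case True
  then obtain q where q: "Suc (p * d) = 2 * q" by (rule evenE)
  have pd: "1 \<le> p * d" using p d by simp
  then have qpd: "q \<le> p * d" using q by linarith
  have n0: "0 < real n"
  proof -
    have "0 < (real p * real D)\<^sup>2" using p d by simp
    then show ?thesis using n by linarith
  qed
  have "2 * q \<le> n"
  proof -
    have "1 \<le> real (p * d)" using pd of_nat_mono[OF pd] by (metis of_nat_1)
    then have "real (p * d) * 1 \<le> real (p * d) * real (p * d)" by (intro mult_left_mono) auto
    also have "\<dots> \<le> real (p * D) * real (p * D)"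
      using d by (intro mult_mono of_nat_mono mult_le_mono2) auto
    finally have "2 * real (p * d) \<le> real n" using n by (simp add: power2_eq_square)
    then show ?thesis using q pd by linarith
  qed
  then have S: "gm_sq n (Suc (p * d)) \<le> (4 * real q * real n) ^ q"
    unfolding q by (intro gm_sq_even_le) auto
  define y where "y = 4 * real p * real d * real n"
  have y: "4 * real q * real n \<le> y" "0 \<le> y"
    using qpd n0 unfolding y_def by (simp_all del: of_nat_mult add: of_nat_mult[symmetric])
  have yp: "y ^ p = (4 * real p) ^ p * real d ^ (p - 2) * real n ^ p * (real d)\<^sup>2"
  proof -
    have "real d ^ p = real d ^ (p - 2) * (real d)\<^sup>2"
    proof -
      have "p = (p - 2) + 2" using p by simp
      then show ?thesis by (metis power_add)
    qed
    then show ?thesis by (simp add: y_def power_mult_distrib)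
  qed
  \<comment> \<open>The constant is \<open>16 * 9 * 8\<close>: 16 from the square of
    \<open>4 * l ^ 2\<close>, 9 from the square of the 3 in \<open>power_self_le_fact\<close>, and
    \<open>8 * p\<close> from the one surplus factor \<open>y\<close>, through
    \<open>4 * p * d \<le> (8 * p) ^ d\<close>. The power \<open>(4 * p) ^ p\<close> comes from
    \<open>y ^ p\<close>.\<close>
  define b where "b = 1152 * real p * (4 * real p) ^ p * (l ^ 4 * real d ^ (p - 2) * real n ^ p)"
  have b: "0 \<le> b" "b \<le> 1 / 4"
  proof -
    define C where "C = 1152 * real p * (4 * real p) ^ p"
    have c: "0 < C" using p by (simp add: C_def)
    have "l ^ 4 * real d ^ (p - 2) * real n ^ p \<le> l ^ 4 * real D ^ (p - 2) * real n ^ p"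
      using d by (intro mult_right_mono mult_left_mono power_mono) auto
    with l have "l ^ 4 * real d ^ (p - 2) * real n ^ p \<le> snr_const p" by linarith
    then have "b \<le> C * snr_const p"
      unfolding b_def C_def[symmetric] using c by (intro mult_left_mono) auto
    then show "b \<le> 1 / 4" using c unfolding snr_const_def C_def[symmetric] by simp
    show "0 \<le> b" unfolding b_def by simp
  qed
  define x where "x = (4 * l\<^sup>2) ^ d / fact d * (4 * real q * real n) ^ q"
  have "x\<^sup>2 = (16 * l ^ 4) ^ d * (4 * real q * real n) ^ Suc (p * d) / (fact d)\<^sup>2"
  proof -
    have sq: "(z ^ k)\<^sup>2 = (z\<^sup>2) ^ k" for z :: real and k by (simp add: mult.commute flip: power_mult)
    have "(4 * l\<^sup>2)\<^sup>2 = 16 * l ^ 4" by (simp add: power2_eq_square power4_eq_xxxx)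
    then show ?thesis
      unfolding q x_def
      by (simp only: power_mult_distrib[of _ _ 2] power_divide sq[of _ d] sq[of _ q] power_mult[of _ 2 q] times_divide_eq_left)
  qed
  also have "\<dots> \<le> (16 * l ^ 4) ^ d * y ^ Suc (p * d) / (fact d)\<^sup>2"
    using y n0 by (intro divide_right_mono mult_left_mono power_mono) auto
  also have "\<dots> \<le> (16 * l ^ 4) ^ d * y ^ Suc (p * d) * (9 ^ d / (real d ^ d)\<^sup>2)"
  proof -
    have "(real d ^ d)\<^sup>2 \<le> (3 ^ d * fact d)\<^sup>2" by (intro power_mono power_self_le_fact) simp
    also have "\<dots> = 9 ^ d * (fact d)\<^sup>2"
    proof -
      have "(3 ^ d)\<^sup>2 = (9::real) ^ d" by (simp add: power2_eq_square flip: power_mult_distrib)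
      then show ?thesis by (simp only: power_mult_distrib)
    qed
    finally have "1 / (fact d)\<^sup>2 \<le> 9 ^ d / (real d ^ d)\<^sup>2" using d by (simp add: field_simps)
    then have "(16 * l ^ 4) ^ d * y ^ Suc (p * d) * (1 / (fact d)\<^sup>2)
      \<le> (16 * l ^ 4) ^ d * y ^ Suc (p * d) * (9 ^ d / (real d ^ d)\<^sup>2)"
      using y by (intro mult_left_mono) auto
    then show ?thesis by simp
  qed
  also have "\<dots> = y * (144 * (4 * real p) ^ p * (l ^ 4 * real d ^ (p - 2) * real n ^ p)) ^ d"
  proof -
    define Z E where "Z = (4 * real p) ^ p * real d ^ (p - 2) * real n ^ p" and "E = (real d ^ d)\<^sup>2"
    have E: "E \<noteq> 0" using d by (simp add: E_def)
    have "y ^ Suc (p * d) = y * ((4 * real p) ^ p * real d ^ (p - 2) * real n ^ p) ^ d * (real d ^ d)\<^sup>2"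
    proof -
      have "((real d)\<^sup>2) ^ d = (real d ^ d)\<^sup>2" by (simp add: mult.commute flip: power_mult)
      then show ?thesis by (simp only: power_Suc power_mult yp power_mult_distrib mult.assoc)
    qed
    then have yeq: "y ^ Suc (p * d) = y * Z ^ d * E" by (simp only: Z_def E_def)
    have "(16 * l ^ 4) ^ d * y ^ Suc (p * d) * (9 ^ d / E) = y * ((16 * l ^ 4) ^ d * Z ^ d * 9 ^ d)"
      unfolding yeq using E by simp
    also have "(16 * l ^ 4) ^ d * Z ^ d * 9 ^ d = (144 * (4 * real p) ^ p * (l ^ 4 * real d ^ (p - 2) * real n ^ p)) ^ d"
    proof -
      have "144 * A * (L * B * C) = 16 * L * (A * B * C) * 9" for A B C L :: real by simp
      then have "144 * (4 * real p) ^ p * (l ^ 4 * real d ^ (p - 2) * real n ^ p) = 16 * l ^ 4 * Z * 9"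
        unfolding Z_def .
      then show ?thesis by (simp only: power_mult_distrib[of _ 9] power_mult_distrib[of _ Z])
    qed
    finally show ?thesis unfolding E_def .
  qed
  also have "\<dots> \<le> (real n * (8 * real p) ^ d) * (144 * (4 * real p) ^ p * (l ^ 4 * real d ^ (p - 2) * real n ^ p)) ^ d"
  proof (rule mult_right_mono)
    have "real d \<le> 2 ^ d" by (rule less_imp_le) (rule of_nat_less_two_power)
    moreover have "4 * real p \<le> (4 * real p) ^ d" using p d by (intro self_le_power) auto
    ultimately have "4 * real p * real d \<le> (4 * real p) ^ d * 2 ^ d" by (intro mult_mono) auto
    also have "\<dots> = (4 * real p * 2) ^ d" by (rule power_mult_distrib[symmetric])
    also have "4 * real p * 2 = 8 * real p" by simp
    finally have "real n * (4 * real p * real d) \<le> real n * (8 * real p) ^ d" by (intro mult_left_mono) auto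
    then show "y \<le> real n * (8 * real p) ^ d" by (simp add: y_def mult_ac)
  qed simp
  also have "\<dots> = real n * b ^ d"
  proof -
    define X where "X = 144 * (4 * real p) ^ p * (l ^ 4 * real d ^ (p - 2) * real n ^ p)"
    have "1152 * real p * A * W = 8 * real p * (144 * A * W)" for A W :: real by simp
    then have "b = 8 * real p * X" unfolding b_def X_def .
    then show ?thesis
      unfolding X_def[symmetric] by (simp only: power_mult_distrib[of _ X] mult.assoc[of "real n"])
  qed
  also have "\<dots> \<le> real n * (1 / 4) ^ d" using b by (intro mult_left_mono power_mono) auto
  also have "\<dots> = (sqrt (real n) * (1 / 2) ^ d)\<^sup>2"
  proof -
    have "((1 / 2) ^ d)\<^sup>2 = (1 / 4 :: real) ^ d" by (simp add: power2_eq_square flip: power_mult_distrib)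
    then show ?thesis by (simp only: power_mult_distrib real_sqrt_pow2 of_nat_0_le_iff)
  qed
  finally have "x \<le> sqrt (real n) * (1 / 2) ^ d" by (rule power2_le_imp_le) simp
  moreover have "(4 * l\<^sup>2) ^ d / fact d * gm_sq n (Suc (p * d)) \<le> x"
    unfolding x_def by (intro mult_left_mono S) auto
  ultimately show ?thesis by linarith
qed

text \<open>The term \<open>d = 0\<close> vanishes because \<open>v_i\<close> has mean zero, and the
  others form a geometric sum below 1.\<close>

lemma cert_norm_le_sqrt:
  assumes p: "odd p" "3 \<le> p" and n: "0 < n" "(real p * real D)\<^sup>2 \<le> real n / 2"
    and l: "l ^ 4 * real D ^ (p - 2) * real n ^ p \<le> snr_const p"
  shows "cert_norm n p D l \<le> sqrt (real n)"
proof -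
  have "cert_norm n p D l \<le> (\<Sum>d\<le>D. (4 * l\<^sup>2) ^ d / fact d * gm_sq n (Suc (p * d)))"
    by (rule cert_norm_le) fact+
  also have "\<dots> = (\<Sum>d\<in>{1..D}. (4 * l\<^sup>2) ^ d / fact d * gm_sq n (Suc (p * d)))"
    by (rule sum.mono_neutral_right) (auto simp: not_le gm_sq_odd)
  also have "\<dots> \<le> (\<Sum>d\<in>{1..D}. sqrt (real n) * (1 / 2) ^ d)"
    by (intro sum_mono cert_term_le[OF p(2) _ _ n(2) l]) auto
  also have "\<dots> = sqrt (real n) * (\<Sum>d\<in>{1..D}. (1 / 2) ^ d)" by (simp add: sum_distrib_left)
  also have "(\<Sum>d\<in>{1..D}. (1 / 2) ^ d) = 1 - (1 / 2 :: real) ^ D"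
    by (induction D) (auto simp: field_simps)
  also have "sqrt (real n) * (1 - (1 / 2) ^ D) \<le> sqrt (real n)"
    by (simp add: mult_left_le)
  finally show ?thesis .
qed

section \<open>From the certificate to correlation and mean square error\<close>

lemma poly_deg_le_const: "finite T \<Longrightarrow> poly_deg_le T D (\<lambda>_. r)"
proof -
  assume "finite T"
  then have "finite {m. set_mset m \<subseteq> T \<and> size m \<le> D}" using finite_msets by (simp add: msets_def)
  then show ?thesis
    unfolding poly_deg_le_def
    by (intro exI[of _ "\<lambda>m. if m = {#} then r else 0"]) (simp add: if_distribR if_distrib cong: if_cong)
qed

text \<open>On the reals \<open>Sup\<close> and \<open>Inf\<close> are informative only for nonempty
  bounded sets, so each needs a witness. The constant map 1 has second moment \<open>n\<close> and
  is admissible for the correlation; the zero map has error \<open>n\<close>, which bounds the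
  infimum from above.\<close>

lemma low_deg_corr_mmse_bounds:
  assumes n: "0 < n" and B: "cert_norm n p D (lam / sqrt (fact p)) \<le> B"
  shows "(low_deg_corr n p D lam)\<^sup>2 \<le> B" "\<bar>real n - low_deg_mmse n p D lam\<bar> \<le> B"
proof -
  let ?N = "noise_space n p" and ?Y = "\<lambda>\<omega>. spiked_obs n p lam (fst \<omega>) (snd \<omega>)"
  let ?C = "cert_norm n p D (lam / sqrt (fact p))"
  define Q where "Q = (\<lambda>f :: (nat list \<Rightarrow> real) \<Rightarrow> nat \<Rightarrow> real. \<integral>\<omega>. (\<Sum>i<n. (f (?Y \<omega>) i)\<^sup>2) \<partial>?N)"
  define S where "S = (\<lambda>f :: (nat list \<Rightarrow> real) \<Rightarrow> nat \<Rightarrow> real. \<integral>\<omega>. (\<Sum>i<n. sphere_vec n (fst \<omega>) i * f (?Y \<omega>) i) \<partial>?N)"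
  define R where "R = (\<lambda>f :: (nat list \<Rightarrow> real) \<Rightarrow> nat \<Rightarrow> real. \<integral>\<omega>. (\<Sum>i<n. (f (?Y \<omega>) i - sphere_vec n (fst \<omega>) i)\<^sup>2) \<partial>?N)"
  note defs = Q_def S_def R_def
  have bd: "0 \<le> Q f" "(S f)\<^sup>2 \<le> Q f * ?C" "R f = Q f - 2 * S f + real n" "real n - ?C \<le> R f"
    if "f \<in> poly_maps n p D" for f
    using low_degree_bounds[OF n that, of lam] unfolding defs by auto
  have const: "(\<lambda>_ _. r) \<in> poly_maps n p D" for r
    by (auto simp: poly_maps_def poly_deg_le_const)
  have "prob_space ?N"
    unfolding noise_space_def by (intro prob_space_pair prob_space_PiM) auto
  then interpret prob_space ?N .
  have Q1: "Q (\<lambda>_ _. 1) = real n" by (simp add: Q_def prob_space)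
  have C: "0 \<le> ?C" by (rule cert_norm_nonneg)
  have "\<bar>Sup {S f / sqrt (Q f) | f. f \<in> poly_maps n p D \<and> Q f \<noteq> 0}\<bar> \<le> sqrt ?C"
  proof (rule cSup_abs_le)
    show "{S f / sqrt (Q f) | f. f \<in> poly_maps n p D \<and> Q f \<noteq> 0} \<noteq> {}"
      using const[of 1] Q1 n by (auto intro!: exI[of _ "\<lambda>_ _. 1"])
    fix x assume "x \<in> {S f / sqrt (Q f) | f. f \<in> poly_maps n p D \<and> Q f \<noteq> 0}"
    then obtain f where f: "f \<in> poly_maps n p D" "Q f \<noteq> 0" and x: "x = S f / sqrt (Q f)" by auto
    have "0 < Q f" using bd(1)[OF f(1)] f(2) by simp
    then have "x\<^sup>2 \<le> ?C" using bd(2)[OF f(1)] by (simp add: x power_divide field_simps)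
    then show "\<bar>x\<bar> \<le> sqrt ?C" by (rule real_le_rsqrt[of "\<bar>x\<bar>", simplified])
  qed
  then have "\<bar>low_deg_corr n p D lam\<bar> \<le> sqrt ?C"
    unfolding low_deg_corr_def defs .
  then have "(low_deg_corr n p D lam)\<^sup>2 \<le> ?C"
    using power_mono[of "\<bar>low_deg_corr n p D lam\<bar>" "sqrt ?C" 2] C by simp
  with B show "(low_deg_corr n p D lam)\<^sup>2 \<le> B" by linarith
  have eq: "low_deg_mmse n p D lam = Inf {R f | f. f \<in> poly_maps n p D}"
    unfolding low_deg_mmse_def R_def ..
  have "real n - ?C \<le> Inf {R f | f. f \<in> poly_maps n p D}"
    by (rule cInf_greatest) (use const[of 0] bd(4) in auto)
  moreover have "Inf {R f | f. f \<in> poly_maps n p D} \<le> R (\<lambda>_ _. 0)"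
  proof (rule cInf_lower)
    show "bdd_below {R f | f. f \<in> poly_maps n p D}"
      by (rule bdd_belowI[of _ "real n - ?C"]) (use bd(4) in auto)
  qed (use const[of 0] in auto)
  moreover have "R (\<lambda>_ _. 0) = real n"
    using bd(3)[OF const[of 0]] by (simp add: Q_def S_def)
  ultimately show "\<bar>real n - low_deg_mmse n p D lam\<bar> \<le> B" using B C unfolding eq by linarith
qed

theorem theorem5p10:
  fixes p :: nat
  assumes "odd p" and "p \<ge> 3"
  shows "\<exists>c>0. \<forall>(D :: nat \<Rightarrow> nat) (lam :: nat \<Rightarrow> real).
     (\<forall>n. real (D n) \<le> sqrt (real n / (2 * real p ^ 2))
        \<and> 0 \<le> lam n
        \<and> lam n * real (D n) powr ((real p - 2) / 4) \<le> c * real n powr (- real p / 4))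
     \<longrightarrow> (\<lambda>n. (low_deg_corr n p (D n) (lam n))^2) \<in> O(\<lambda>n. sqrt (real n))
       \<and> (\<lambda>n. real n - low_deg_mmse n p (D n) (lam n)) \<in> O(\<lambda>n. sqrt (real n))"
proof (intro exI[of _ "snr_const p powr (1 / 4)"] conjI allI impI)
  have snr_const: "0 < snr_const p" using assms(2) by (simp add: snr_const_def)
  then show "0 < snr_const p powr (1 / 4)" by simp
  fix D :: "nat \<Rightarrow> nat" and lam :: "nat \<Rightarrow> real"
  assume H: "\<forall>n. real (D n) \<le> sqrt (real n / (2 * real p ^ 2))
        \<and> 0 \<le> lam n
        \<and> lam n * real (D n) powr ((real p - 2) / 4) \<le> snr_const p powr (1 / 4) * real n powr (- real p / 4)"
  have B: "cert_norm n p (D n) (lam n / sqrt (fact p)) \<le> sqrt (real n)" if n: "0 < n" for n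
  proof (rule cert_norm_le_sqrt[OF assms n])
    have "(real (D n))\<^sup>2 \<le> real n / (2 * real p ^ 2)"
      using H power_mono[of "real (D n)" "sqrt (real n / (2 * real p ^ 2))" 2] by simp
    then show "(real p * real (D n))\<^sup>2 \<le> real n / 2"
      using assms(2) by (simp add: field_simps)
    let ?l = "lam n / sqrt (fact p)"
    show "?l ^ 4 * real (D n) ^ (p - 2) * real n ^ p \<le> snr_const p"
    proof (cases "D n = 0")
      \<comment> \<open>At \<open>D n = 0\<close> the \<open>powr\<close> term of the hypothesis
        cannot be rewritten as a power of a positive base; here \<open>0 ^ (p - 2)\<close> makes the
        left side zero, as \<open>p \<ge> 3\<close>.\<close>
      case True
      then show ?thesis using snr_const assms(2) by (simp add: power_0_left)
    next
      case False
      have lam: "0 \<le> lam n" using H by simp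
      have "(1::real) \<le> sqrt (fact p)" by simp
      then have "?l \<le> lam n" using lam by (simp add: divide_le_eq mult_left_le_one_le mult_le_cancel_left1)
      then have l4: "?l ^ 4 \<le> lam n ^ 4" using lam by (intro power_mono) auto
      \<comment> \<open>The fourth power clears all quarter exponents; this is why the constant of
        the theorem is a fourth root.\<close>
      have "(lam n * real (D n) powr ((real p - 2) / 4)) ^ 4
        \<le> (snr_const p powr (1 / 4) * real n powr (- real p / 4)) ^ 4"
        using H lam by (intro power_mono) auto
      moreover have pw: "(x powr (a / 4)) ^ 4 = x powr a" if "0 < x" for x a :: real
        using that by (simp add: powr_powr flip: powr_realpow)
      ultimately have "lam n ^ 4 * real (D n) powr (real p - 2) \<le> snr_const p * real n powr (- real p)"
        using False n snr_const pw[of "snr_const p" 1] pw[of "real n" "- real p"] pw[of "real (D n)" "real p - 2"]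
        by (simp add: power_mult_distrib)
      moreover have "real (D n) powr (real p - 2) = real (D n) ^ (p - 2)"
        using False assms(2) by (simp add: of_nat_diff flip: powr_realpow)
      moreover have "real n powr (- real p) = 1 / real n ^ p"
        using n by (simp add: powr_minus powr_realpow divide_inverse)
      ultimately have "lam n ^ 4 * real (D n) ^ (p - 2) * real n ^ p \<le> snr_const p"
        using n by (simp add: field_simps)
      moreover have "?l ^ 4 * (real (D n) ^ (p - 2) * real n ^ p) \<le> lam n ^ 4 * (real (D n) ^ (p - 2) * real n ^ p)"
        by (intro mult_right_mono l4) auto
      ultimately show ?thesis by (simp add: mult.assoc)
    qed
  qed
  note bounds = low_deg_corr_mmse_bounds[OF _ B]
  show "(\<lambda>n. (low_deg_corr n p (D n) (lam n))\<^sup>2) \<in> O(\<lambda>n. sqrt (real n))"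
    by (rule bigoI[of _ 1]) (use bounds(1) in \<open>auto intro!: eventually_at_top_linorderI[of 1]\<close>)
  show "(\<lambda>n. real n - low_deg_mmse n p (D n) (lam n)) \<in> O(\<lambda>n. sqrt (real n))"
    by (rule bigoI[of _ 1]) (use bounds(2) in \<open>auto intro!: eventually_at_top_linorderI[of 1]\<close>)
qed

end
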